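(* Let $k$ be a field, let $Q$ be a connected finite quiver with vertex set $I$, and let $J\subset I$ be a nonempty subset (the set of white vertices). Then the Hilbert series of the partial preprojective algebra $\Pi_{Q,J}(k)$ is $$h_{\Pi_{Q,J}(k)}(t)=(1-Ct+D_Jt^2)^{-1},$$ where $C$ is the adjacency matrix of the double $\bar Q$ and $D_J$ is the diagonal $I\times I$ matrix with $(D_J)_{ii}=0$ if $i\in J$ and $(D_J)_{ii}=1$ if $i\notin J$. In particular, $\Pi_{Q,J}(k)$ is a Koszul algebra.
   Context: Quivers are finite; multiple edges and self-loops are allowed. The field $k$ is arbitrary (any characteristic). For an edge $a$ of $Q$, $h(a)$ and $t(a)$ denote its head and tail. The double $\bar Q$ has the same vertex set $I$ and is obtained from $Q$ by adding, for each edge $a$ from $i$ to $j$, a new edge $a^*$ from $j$ to $i$. Put $R=\bigoplus_{i\in I}k$, the algebra of $k$-valued functions on $I$. The path algebra $k\bar Q$ is the tensor algebra over $R$ of the $R$-bimodule spanned by the edges of $\bar Q$; paths are composed so that, for $a\in Q$, $aa^*$ is a closed path at $h(a)$ and $a^*a$ is a closed path at $t(a)$. The partial preprojective algebra is $$\Pi_{Q,J}(k)=k\bar Q\Big/\Big(\sum_{a\in Q,\ h(a)\in I\setminus J}aa^*-\sum_{a\in Q,\ t(a)\in I\setminus J}a^*a\Big),$$ the quotient by the two-sided ideal generated by the indicated element (equivalently, the preprojective relations are imposed only at the vertices not in $J$). It is $\mathbb Z_+$-graded by path length, with degree-zero part $R$. For a $\mathbb Z_+$-graded $R$-bimodule $W=\bigoplus_{d\ge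 0}W[d]$ with finite-dimensional homogeneous components, write $W[d]=\bigoplus_{i,j\in I}W[d]_{i,j}$ for the decomposition induced by the bimodule structure. The Hilbert series $h_W(t)$ is the $I\times I$ matrix of power series with entries $h_W(t)_{i,j}=\sum_{d\ge0}\dim W[d]_{i,j}\,t^d$. The adjacency matrix $C$ of $\bar Q$ has entries $C_{i,j}$ equal to the number of edges of $\bar Q$ between $i$ and $j$ in one direction, i.e. $C_{i,j}=\dim V_{i,j}$ where $V$ is the $R$-bimodule spanned by the edges of $\bar Q$ (so a self-loop of $Q$ at $i$ contributes $2$ to $C_{i,i}$). Here $1$ is the identity matrix, and the inverse is taken in matrices over $\mathbb Z[[t]]$. A quadratic algebra $A$ (generated over $A[0]=R$ in degree $1$ with relations in degree $2$) is Koszul if $\mathrm{Ext}^i_A(R,R)$ (or dually $\mathrm{Tor}_i^A(R,R)$) is concentrated in internal degree $i$ for all $i$, where $R=A/A_{>0}$. *)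

theory Defs
  imports
    "HOL-Analysis.Determinants"
    "HOL-Algebra.Embedded_Algebras"
    "HOL-Algebra.QuotRing"
    "HOL-Algebra.Generated_Groups"
    "HOL-Library.Poly_Mapping"
    "HOL-Computational_Algebra.Formal_Power_Series"
    "Graph_Theory.Digraph_Component"
begin

section \<open>Graded algebras over the functions on the vertices\<close>

text \<open>
  A graded algebra carries its structure map from the field \<open>'k\<close>, the idempotents of the
  functions on the vertex type \<open>'v\<close>, and its homogeneous components. A vertex set is always the
  whole (finite) type \<open>'v\<close>, so that the library matrices indexed by types can be used.
\<close>

record ('a, 'k, 'v) graded_algebra = "'a ring" +
  emb :: "'k \<Rightarrow> 'a"
  idem :: "'v \<Rightarrow> 'a"
  hpart :: "nat \<Rightarrow> 'a set"

definition graded_quotient ::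
  "('a, 'k, 'v) graded_algebra \<Rightarrow> 'a set \<Rightarrow> ('a set, 'k, 'v) graded_algebra" where
  "graded_quotient A I =
    \<lparr> carrier = carrier (A Quot I), mult = mult (A Quot I), one = one (A Quot I),
      zero = zero (A Quot I), add = add (A Quot I),
      emb = (\<lambda>c. I +>\<^bsub>A\<^esub> emb A c),
      idem = (\<lambda>v. I +>\<^bsub>A\<^esub> idem A v),
      hpart = (\<lambda>d. (\<lambda>x. I +>\<^bsub>A\<^esub> x) ` hpart A d) \<rparr>"

definition hilbert_series :: "('a, 'k, 'v::finite) graded_algebra \<Rightarrow> int fps ^ 'v ^ 'v" where
  "hilbert_series A = (\<chi> i j. Abs_fps (\<lambda>d.
     int (ring.dim A (range (emb A))
       {idem A i \<otimes>\<^bsub>A\<^esub> x \<otimes>\<^bsub>A\<^esub> idem A j | x. x \<in> hpart A d})))"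


section \<open>Path algebras\<close>

text \<open>
  The triple \<open>(u, p, v)\<close> is the path from \<open>u\<close> to \<open>v\<close> that runs through the arcs of \<open>p\<close> in the order
  of travel. In a product the right factor is travelled first, so an arc \<open>a\<close> lies in
  \<open>e\<^sub>h V e\<^sub>t\<close> for its head \<open>h\<close> and its tail \<open>t\<close>.
\<close>

type_synonym ('v, 'e) path = "'v \<times> 'e list \<times> 'v"

definition paths :: "('v, 'e) pre_digraph \<Rightarrow> ('v, 'e) path set" where
  "paths G = {(u, p, v). pre_digraph.awalk G u p v}"

definition path_mult ::
  "(('v, 'e) path \<Rightarrow>\<^sub>0 'k::field) \<Rightarrow> (('v, 'e) path \<Rightarrow>\<^sub>0 'k) \<Rightarrow> (('v, 'e) path \<Rightarrow>\<^sub>0 'k)" where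
  "path_mult f g =
    (\<Sum>(u, p, v) \<in> Poly_Mapping.keys f. \<Sum>(u', q, v') \<in> Poly_Mapping.keys g.
      if v' = u
      then Poly_Mapping.single (u', q @ p, v)
        (Poly_Mapping.lookup f (u, p, v) * Poly_Mapping.lookup g (u', q, v'))
      else 0)"

definition path_algebra ::
  "('v, 'e) pre_digraph \<Rightarrow> (('v, 'e) path \<Rightarrow>\<^sub>0 'k::field, 'k, 'v) graded_algebra" where
  "path_algebra G =
    \<lparr> carrier = {f. Poly_Mapping.keys f \<subseteq> paths G}, mult = path_mult,
      one = (\<Sum>v\<in>verts G. Poly_Mapping.single (v, [], v) 1),
      zero = 0, add = (+),
      emb = (\<lambda>c. \<Sum>v\<in>verts G. Poly_Mapping.single (v, [], v) c),
      idem = (\<lambda>v. Poly_Mapping.single (v, [], v) 1),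
      hpart = (\<lambda>d. {f. Poly_Mapping.keys f \<subseteq> {(u, p, v) \<in> paths G. length p = d}}) \<rparr>"

definition arrow :: "('v, 'e) pre_digraph \<Rightarrow> 'e \<Rightarrow> (('v, 'e) path \<Rightarrow>\<^sub>0 'k::field)" where
  "arrow G a = Poly_Mapping.single (tail G a, [a], head G a) 1"


section \<open>Partial preprojective algebras\<close>

datatype 'e double_arc = Arc 'e | Star 'e

fun double_tail :: "('v, 'e) pre_digraph \<Rightarrow> 'e double_arc \<Rightarrow> 'v" where
  "double_tail Q (Arc a) = tail Q a"
| "double_tail Q (Star a) = head Q a"

fun double_head :: "('v, 'e) pre_digraph \<Rightarrow> 'e double_arc \<Rightarrow> 'v" where
  "double_head Q (Arc a) = head Q a"
| "double_head Q (Star a) = tail Q a"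

definition double_quiver :: "('v, 'e) pre_digraph \<Rightarrow> ('v, 'e double_arc) pre_digraph" where
  "double_quiver Q =
    \<lparr> verts = verts Q, arcs = Arc ` arcs Q \<union> Star ` arcs Q,
      tail = double_tail Q, head = double_head Q \<rparr>"

definition partial_preprojective_relation ::
  "('v, 'e) pre_digraph \<Rightarrow> 'v set \<Rightarrow> (('v, 'e double_arc) path \<Rightarrow>\<^sub>0 'k::field)" where
  "partial_preprojective_relation Q J =
    (let x = arrow (double_quiver Q) in
      (\<Sum>a | a \<in> arcs Q \<and> head Q a \<in> verts Q - J. path_mult (x (Arc a)) (x (Star a)))
    - (\<Sum>a | a \<in> arcs Q \<and> tail Q a \<in> verts Q - J. path_mult (x (Star a)) (x (Arc a))))"

definition partial_preprojective ::
  "('v, 'e) pre_digraph \<Rightarrow> 'v set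
    \<Rightarrow> ((('v, 'e double_arc) path \<Rightarrow>\<^sub>0 'k::field) set, 'k, 'v) graded_algebra" where
  "partial_preprojective Q J =
    (let P = path_algebra (double_quiver Q)
     in graded_quotient P (Idl\<^bsub>P\<^esub> {partial_preprojective_relation Q J}))"

definition adjacency_matrix :: "('v::finite, 'e) pre_digraph \<Rightarrow> int ^ 'v ^ 'v" where
  "adjacency_matrix G = (\<chi> i j. int (card {a \<in> arcs G. head G a = i \<and> tail G a = j}))"

definition black_matrix :: "'v::finite set \<Rightarrow> int ^ 'v ^ 'v" where
  "black_matrix J = (\<chi> i j. if i = j \<and> i \<notin> J then 1 else 0)"


section \<open>Graded Ext groups\<close>

text \<open>
  Left modules over a graded algebra. The library's record of modules extends that of rings; its
  fields \<open>mult\<close> and \<open>one\<close> play no role here.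
\<close>

record ('a, 'm) graded_module = "('a, 'm) module" +
  mpart :: "nat \<Rightarrow> 'm set"

text \<open>
  The bar resolution of a left module \<open>M\<close> has the free modules \<open>A \<otimes> A\<^sup>\<otimes>\<^sup>n \<otimes> M\<close> (tensor products over
  the field) as its terms. The \<open>A\<close>-linear maps from the \<open>n\<close>-th term to \<open>N\<close> are the maps
  \<open>f [a\<^sub>1, \<dots>, a\<^sub>n] m\<close> into \<open>N\<close> that are linear over the field in each of the \<open>n + 1\<close> arguments. Such a map
  has internal degree \<open>d\<close> if it lowers the total degree of homogeneous arguments by \<open>d\<close>. The values
  of \<open>f\<close> outside the carriers and on lists of other lengths are irrelevant.
\<close>

definition bar_cochains ::
  "('a, 'k, 'v) graded_algebra \<Rightarrow> ('a, 'm) graded_module \<Rightarrow> ('a, 'n) graded_module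
    \<Rightarrow> nat \<Rightarrow> int \<Rightarrow> ('a list \<Rightarrow> 'm \<Rightarrow> 'n) set" where
  "bar_cochains A M N n d =
    {f.
      (\<forall>as m. length as = n \<and> set as \<subseteq> carrier A \<and> m \<in> carrier M \<longrightarrow> f as m \<in> carrier N) \<and>
      (\<forall>as x y bs m. length as + 1 + length bs = n \<and> set as \<union> {x, y} \<union> set bs \<subseteq> carrier A
          \<and> m \<in> carrier M \<longrightarrow>
        f (as @ (x \<oplus>\<^bsub>A\<^esub> y) # bs) m = f (as @ x # bs) m \<oplus>\<^bsub>N\<^esub> f (as @ y # bs) m) \<and>
      (\<forall>as c x bs m. length as + 1 + length bs = n \<and> set as \<union> {x} \<union> set bs \<subseteq> carrier A
          \<and> m \<in> carrier M \<longrightarrow>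
        f (as @ (emb A c \<otimes>\<^bsub>A\<^esub> x) # bs) m = emb A c \<odot>\<^bsub>N\<^esub> f (as @ x # bs) m) \<and>
      (\<forall>as m m'. length as = n \<and> set as \<subseteq> carrier A \<and> {m, m'} \<subseteq> carrier M \<longrightarrow>
        f as (m \<oplus>\<^bsub>M\<^esub> m') = f as m \<oplus>\<^bsub>N\<^esub> f as m') \<and>
      (\<forall>as c m. length as = n \<and> set as \<subseteq> carrier A \<and> m \<in> carrier M \<longrightarrow>
        f as (emb A c \<odot>\<^bsub>M\<^esub> m) = emb A c \<odot>\<^bsub>N\<^esub> f as m) \<and>
      (\<forall>as ds m e. length as = n \<and> list_all2 (\<lambda>a k. a \<in> hpart A k) as ds \<and> m \<in> mpart M e \<longrightarrow>
        (let s = int (sum_list ds + e) - d in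
          f as m \<in> (if 0 \<le> s then mpart N (nat s) else {\<zero>\<^bsub>N\<^esub>})))}"

text \<open>
  The value on \<open>[a\<^sub>1, \<dots>, a\<^sub>n\<^sub>+\<^sub>1]\<close> of the differential of an \<open>n\<close>-cochain. The summand for the
  (zero-based) index \<open>i\<close> multiplies the entries \<open>i\<close> and \<open>i + 1\<close> of the list.
\<close>

definition bar_differential ::
  "('a, 'k, 'v) graded_algebra \<Rightarrow> ('a, 'm) graded_module \<Rightarrow> ('a, 'n) graded_module
    \<Rightarrow> ('a list \<Rightarrow> 'm \<Rightarrow> 'n) \<Rightarrow> 'a list \<Rightarrow> 'm \<Rightarrow> 'n" where
  "bar_differential A M N f as m =
    (hd as \<odot>\<^bsub>N\<^esub> f (tl as) m)
    \<oplus>\<^bsub>N\<^esub> (\<Oplus>\<^bsub>N\<^esub>i\<in>{..<length as - 1}. add_pow N ((-1 :: int) ^ (i + 1))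
          (f (take i as @ (as ! i \<otimes>\<^bsub>A\<^esub> as ! (i + 1)) # drop (i + 2) as) m))
    \<oplus>\<^bsub>N\<^esub> add_pow N ((-1 :: int) ^ length as) (f (butlast as) (last as \<odot>\<^bsub>M\<^esub> m))"

definition bar_cocycles ::
  "('a, 'k, 'v) graded_algebra \<Rightarrow> ('a, 'm) graded_module \<Rightarrow> ('a, 'n) graded_module
    \<Rightarrow> nat \<Rightarrow> int \<Rightarrow> ('a list \<Rightarrow> 'm \<Rightarrow> 'n) set" where
  "bar_cocycles A M N n d =
    {f \<in> bar_cochains A M N n d.
      \<forall>as m. length as = n + 1 \<and> set as \<subseteq> carrier A \<and> m \<in> carrier M
        \<longrightarrow> bar_differential A M N f as m = \<zero>\<^bsub>N\<^esub>}"

definition bar_coboundaries ::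
  "('a, 'k, 'v) graded_algebra \<Rightarrow> ('a, 'm) graded_module \<Rightarrow> ('a, 'n) graded_module
    \<Rightarrow> nat \<Rightarrow> int \<Rightarrow> ('a list \<Rightarrow> 'm \<Rightarrow> 'n) set" where
  "bar_coboundaries A M N n d =
    {f \<in> bar_cochains A M N n d. case n of
        0 \<Rightarrow> \<forall>m \<in> carrier M. f [] m = \<zero>\<^bsub>N\<^esub>
      | Suc n' \<Rightarrow> \<exists>g \<in> bar_cochains A M N n' d.
          \<forall>as m. length as = n \<and> set as \<subseteq> carrier A \<and> m \<in> carrier M
            \<longrightarrow> f as m = bar_differential A M N g as m}"

text \<open>The component of internal degree \<open>d\<close> of \<open>Ext\<^sup>n\<^sub>A(M, N)\<close> is zero.\<close>

definition Ext_component_zero ::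
  "('a, 'k, 'v) graded_algebra \<Rightarrow> ('a, 'm) graded_module \<Rightarrow> ('a, 'n) graded_module
    \<Rightarrow> nat \<Rightarrow> int \<Rightarrow> bool" where
  "Ext_component_zero A M N n d \<longleftrightarrow> bar_cocycles A M N n d \<subseteq> bar_coboundaries A M N n d"


section \<open>Koszul algebras\<close>

definition positive_part :: "('a, 'k, 'v) graded_algebra \<Rightarrow> 'a set" where
  "positive_part A = generate (add_monoid A) (\<Union>d\<in>{0<..}. hpart A d)"

text \<open>The quotient \<open>A / A\<^sub>>\<^sub>0\<close> as a left module over \<open>A\<close>.\<close>

definition residue_module :: "('a, 'k, 'v) graded_algebra \<Rightarrow> ('a, 'a set) graded_module" where
  "residue_module A =
    (let I = positive_part A; R = graded_quotient A I in
      \<lparr> carrier = carrier R, mult = mult R, one = one R, zero = zero R, add = add R,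
        smult = (\<lambda>a r. (I +>\<^bsub>A\<^esub> a) \<otimes>\<^bsub>R\<^esub> r),
        mpart = hpart R \<rparr>)"

text \<open>
  The tensor algebra over the functions on the vertices of a finite-dimensional bimodule is the path
  algebra of a finite quiver; its arcs may be taken to be natural numbers.
\<close>

definition quadratic_algebra :: "('a, 'k::field, 'v::finite) graded_algebra \<Rightarrow> bool" where
  "quadratic_algebra A \<longleftrightarrow>
    (\<exists>(G :: ('v, nat) pre_digraph) S \<phi>.
      fin_digraph G \<and> verts G = UNIV \<and>
      S \<subseteq> hpart (path_algebra G :: (_, 'k, 'v) graded_algebra) 2 \<and>
      \<phi> \<in> ring_hom (path_algebra G) A \<and> \<phi> ` carrier (path_algebra G) = carrier A \<and>
      (\<forall>c. \<phi> (emb (path_algebra G) c) = emb A c) \<and>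
      (\<forall>v. \<phi> (idem (path_algebra G :: (_, 'k, 'v) graded_algebra) v) = idem A v) \<and>
      (\<forall>d. \<phi> ` hpart (path_algebra G) d = hpart A d) \<and>
      a_kernel (path_algebra G) A \<phi> = Idl\<^bsub>path_algebra G\<^esub> S)"

definition koszul_algebra :: "('a, 'k::field, 'v::finite) graded_algebra \<Rightarrow> bool" where
  "koszul_algebra A \<longleftrightarrow>
    quadratic_algebra A \<and>
    (\<forall>n d. d \<noteq> int n \<longrightarrow> Ext_component_zero A (residue_module A) (residue_module A) n d)"

end

theory Submission
  imports Defs
begin

text \<open>
  Each black vertex \<open>i\<close>, that is, each vertex outside \<open>J\<close>, carries one relation: the sum over the
  arcs \<open>c\<close> of the double that leave \<open>i\<close>, up to signs, of the closed path \<open>c\<^sup>* c\<close> at \<open>i\<close>. Because the quiver is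
  connected and \<open>J\<close> is not empty, one of these arcs leads closer to \<open>J\<close>; call it the leading arc \<open>b\<^sub>i\<close>
  and call \<open>b\<^sub>i\<^sup>* b\<^sub>i\<close> the leading monomial of the relation. Two leading monomials never overlap: the
  last arc \<open>b\<^sub>i\<^sup>*\<close> of one leads away from \<open>J\<close>, the first arc \<open>b\<^sub>j\<close> of another leads towards \<open>J\<close>. So
  there are no ambiguities to resolve, and the normal paths, those that contain no leading monomial,
  represent a basis of the quotient. This is the diamond lemma without overlaps; it takes the form of a
  map \<open>nf\<close> whose kernel is the ideal of relations and which fixes the normal combinations
  (\<open>rel_ideal_iff\<close>, \<open>nf_normal\<close>).

  The Hilbert series counts normal paths. Prolonging a normal path by an arc gives a normal path
  unless it creates a leading monomial at its end, and cutting off that monomial leaves an arbitrary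
  normal path. Hence the counts satisfy \<open>N\<^sub>n\<^sub>+\<^sub>2 = C N\<^sub>n\<^sub>+\<^sub>1 - D N\<^sub>n\<close> (\<open>card_normal_paths_rec\<close>), which says
  that the series is the inverse of \<open>1 - C t + D t\<^sup>2\<close>.

  For the Koszul property let \<open>A\<close> be the quotient and \<open>R\<close> its residue module. Every element of \<open>A\<close> of
  positive degree is a sum of products \<open>y\<^sub>a a\<close> over the arcs \<open>a\<close>, so \<open>A\<^sub>>\<^sub>0\<close> is a quotient of a sum of the
  projective modules \<open>A e\<close>. The kernel of this quotient is again projective, with one generator of
  degree 2 for each black vertex (\<open>rel_dual_basis\<close>): in the normal basis, a column \<open>y\<close> of the kernel can be
  reduced by multiples of the relations until \<open>y\<^sub>a a\<close> is normal for every \<open>a\<close>, and then it is zero. So \<open>R\<close>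
  has a linear projective resolution of length 2. In terms of bar cochains this is used by shifting
  dimensions twice (\<open>Ext_shift\<close>): vanishing of \<open>Ext\<close> passes from the syzygies to the module, it holds in
  positive cohomological degrees for projective modules (\<open>Ext_projective\<close>), and it holds for \<open>Ext\<^sup>0\<close> in
  every internal degree in which there is no generator (\<open>Ext_zero_degree\<close>).
\<close>

section \<open>Linear extension from a basis\<close>

abbreviation single :: "'a \<Rightarrow> 'k::zero \<Rightarrow> 'a \<Rightarrow>\<^sub>0 'k" where "single \<equiv> Poly_Mapping.single"
abbreviation lookup :: "('a \<Rightarrow>\<^sub>0 'k::zero) \<Rightarrow> 'a \<Rightarrow> 'k" where "lookup \<equiv> Poly_Mapping.lookup"
abbreviation keys :: "('a \<Rightarrow>\<^sub>0 'k::zero) \<Rightarrow> 'a set" where "keys \<equiv> Poly_Mapping.keys"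

definition scale :: "'k::field \<Rightarrow> ('a \<Rightarrow>\<^sub>0 'k) \<Rightarrow> ('a \<Rightarrow>\<^sub>0 'k)" where
  "scale c f = Poly_Mapping.map ((*) c) f"

lemma lookup_scale [simp]: "lookup (scale c f) p = c * lookup f p"
  by (simp add: scale_def map.rep_eq when_def)

lemma scale_simps [simp]:
  "scale c 0 = 0" "scale 0 f = 0" "scale 1 f = f" "scale c (single p d) = single p (c * d)"
  "scale c (scale d f) = scale (c * d) f" "scale (- c) f = - scale c f" "scale c (- f) = - scale c f"
  by (auto intro!: poly_mapping_eqI simp: lookup_single when_def)

lemma scale_add: "scale c (f + g) = scale c f + scale c g"
  by (auto intro!: poly_mapping_eqI simp: lookup_add algebra_simps)

lemma scale_add_left: "scale (c + d) f = scale c f + scale d f"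
  by (auto intro!: poly_mapping_eqI simp: lookup_add algebra_simps)

lemma scale_sum: "scale c (sum F S) = (\<Sum>x\<in>S. scale c (F x))"
  by (auto intro!: poly_mapping_eqI simp: lookup_sum sum_distrib_left)

lemma keys_scale: "keys (scale c f) \<subseteq> keys f"
  by (auto simp: in_keys_iff)

text \<open>
  All maps on path algebras below are linear extensions of maps on basis elements, so that identities
  between them have to be checked only on paths.
\<close>

definition lext :: "('a \<Rightarrow> 'b \<Rightarrow>\<^sub>0 'k) \<Rightarrow> ('a \<Rightarrow>\<^sub>0 'k::field) \<Rightarrow> ('b \<Rightarrow>\<^sub>0 'k)" where
  "lext F f = (\<Sum>p\<in>keys f. scale (lookup f p) (F p))"

lemma lext_superset:
  assumes "finite S" "keys f \<subseteq> S"
  shows "lext F f = (\<Sum>p\<in>S. scale (lookup f p) (F p))"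
  unfolding lext_def using assms by (intro sum.mono_neutral_left) (auto simp: in_keys_iff)

lemma lext_0 [simp]: "lext F 0 = 0"
  by (simp add: lext_def)

lemma lext_single [simp]: "lext F (single p c) = scale c (F p)"
  by (subst lext_superset[of "{p}"]) auto

lemma lext_add: "lext F (f + g) = lext F f + lext F g"
  using keys_add[of f g]
  by (simp add: lext_superset[of "keys f \<union> keys g" f] lext_superset[of "keys f \<union> keys g" g]
      lext_superset[of "keys f \<union> keys g" "f + g"] lookup_add scale_add_left sum.distrib)

lemma lext_scale: "lext F (scale c f) = scale c (lext F f)"
  using keys_scale[of c f] by (subst lext_superset[of "keys f"]) (auto simp: lext_def scale_sum)

lemma lext_uminus [simp]: "lext F (- f) = - lext F f"
  using lext_scale[of F "-1" f] by simp

lemma lext_diff: "lext F (f - g) = lext F f - lext F g"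
  using lext_add[of F f "- g"] by simp

lemma lext_sum: "lext F (sum f S) = (\<Sum>x\<in>S. lext F (f x))"
  by (induction S rule: infinite_finite_induct) (auto simp: lext_add)

lemma lext_cong: "(\<And>p. p \<in> keys f \<Longrightarrow> F p = H p) \<Longrightarrow> lext F f = lext H f"
  by (simp add: lext_def)

lemma lext_lext: "lext F (lext H f) = lext (\<lambda>p. lext F (H p)) f"
  by (simp add: lext_def[of H] lext_sum lext_scale) (simp add: lext_def)

lemma poly_mapping_induct [consumes 1, case_names zero single add]:
  fixes f :: "'a \<Rightarrow>\<^sub>0 'k::comm_monoid_add"
  assumes "keys f \<subseteq> S" and "P 0" and "\<And>p c. p \<in> S \<Longrightarrow> P (single p c)"
    and "\<And>f g. P f \<Longrightarrow> P g \<Longrightarrow> P (f + g)"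
  shows "P f"
proof -
  have *: "f = (\<Sum>p\<in>keys f. single p (lookup f p))"
    by (rule poly_mapping_eqI)
      (auto simp: lookup_sum lookup_single when_def in_keys_iff cong: if_cong)
  have "P (\<Sum>p\<in>T. single p (lookup f p))" if "T \<subseteq> keys f" for T
    using finite_subset[OF that finite_keys] that
    by (induction T) (use assms in auto)
  from this[OF subset_refl] show ?thesis using * by simp
qed

lemma lext_id: "(\<And>p. p \<in> keys f \<Longrightarrow> F p = single p 1) \<Longrightarrow> lext F f = f"
proof -
  assume "\<And>p. p \<in> keys f \<Longrightarrow> F p = single p 1"
  then have "lext F f = lext (\<lambda>p. single p 1) f" by (rule lext_cong)
  also have "\<dots> = f" by (induction f rule: poly_mapping_induct[OF subset_UNIV]) (auto simp: lext_add)
  finally show ?thesis .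
qed

lemma keys_lext: "keys (lext F f) \<subseteq> (\<Union>p\<in>keys f. keys (F p))"
  unfolding lext_def using keys_sum keys_scale by fastforce

lemma lext_mono: "(\<And>p. p \<in> keys f \<Longrightarrow> keys (F p) \<subseteq> T) \<Longrightarrow> keys (lext F f) \<subseteq> T"
  using keys_lext[of F f] by blast

lemma keys_add_subset: "keys f \<subseteq> S \<Longrightarrow> keys g \<subseteq> S \<Longrightarrow> keys (f + g) \<subseteq> S"
  using keys_add[of f g] by blast

lemma keys_diff_subset: "keys f \<subseteq> S \<Longrightarrow> keys g \<subseteq> S \<Longrightarrow> keys (f - g :: _ \<Rightarrow>\<^sub>0 'k::ab_group_add) \<subseteq> S"
  using keys_diff[of f g] by blast

lemma keys_sum_subset: "(\<And>x. x \<in> A \<Longrightarrow> keys (f x) \<subseteq> S) \<Longrightarrow> keys (sum f A) \<subseteq> S"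
  using keys_sum[of f A] by blast

section \<open>The path algebra is a ring\<close>

fun concat_path :: "('v, 'e) path \<Rightarrow> ('v, 'e) path \<Rightarrow> ('v, 'e) path \<Rightarrow>\<^sub>0 'k::field" where
  "concat_path (u, p, v) (u', q, v') = (if v' = u then single (u', q @ p, v) 1 else 0)"

lemma path_mult_lext: "path_mult f g = lext (\<lambda>p. lext (concat_path p) g) f"
  unfolding path_mult_def lext_def scale_sum
  by (intro sum.cong refl) (auto simp: case_prod_beta split: prod.splits intro!: sum.cong)

lemma path_mult_single:
  "path_mult (single (u, p, v) c) (single (u', q, v') d)
    = (if v' = u then single (u', q @ p, v) (c * d) else 0)"
  by (simp add: path_mult_lext)

lemma path_mult_add_left: "path_mult (f + f') g = path_mult f g + path_mult f' g"
  by (simp add: path_mult_lext lext_add)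

lemma path_mult_add_right: "path_mult f (g + g') = path_mult f g + path_mult f g'"
  by (induction f rule: poly_mapping_induct[OF subset_UNIV])
     (auto simp: path_mult_lext lext_add scale_add algebra_simps)

lemma path_mult_zero [simp]: "path_mult 0 g = 0" "path_mult f 0 = 0"
  by (simp_all add: path_mult_lext) (simp add: lext_def)

lemma path_mult_scale:
  "path_mult (scale c f) g = scale c (path_mult f g)" "path_mult f (scale c g) = scale c (path_mult f g)"
  by (simp_all add: path_mult_lext lext_scale)
     (induction f rule: poly_mapping_induct[OF subset_UNIV], auto simp: lext_add scale_add mult.commute)

lemma path_mult_uminus [simp]: "path_mult (- f) g = - path_mult f g" "path_mult f (- g) = - path_mult f g"
  using path_mult_scale(1)[of "-1" f g] path_mult_scale(2)[of f "-1" g] by simp_all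

lemma path_mult_diff_right: "path_mult f (g - g') = path_mult f g - path_mult f g'"
  using path_mult_add_right[of f g "- g'"] by simp

lemma path_mult_sum_left: "path_mult (sum f S) g = (\<Sum>x\<in>S. path_mult (f x) g)"
  by (induction S rule: infinite_finite_induct) (auto simp: path_mult_add_left)

lemma path_mult_sum_right: "path_mult g (sum f S) = (\<Sum>x\<in>S. path_mult g (f x))"
  by (induction S rule: infinite_finite_induct) (auto simp: path_mult_add_right)

lemma path_mult_assoc: "path_mult (path_mult f g) h = path_mult f (path_mult g h)"
proof (induction f rule: poly_mapping_induct[OF subset_UNIV])
  case (2 p c)
  show ?case
  proof (induction g rule: poly_mapping_induct[OF subset_UNIV])
    case (2 q d)
    obtain u p' v u' q' v' where "p = (u, p', v)" "q = (u', q', v')"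
      by (cases p, cases q)
    then show ?case
      by (induction h rule: poly_mapping_induct[OF subset_UNIV])
         (auto simp: path_mult_add_right path_mult_single mult.assoc)
  qed (auto simp: path_mult_add_right path_mult_add_left)
qed (auto simp: path_mult_add_left)

locale finite_quiver = fin_digraph G for G :: "('v::finite, 'e) pre_digraph" +
  assumes verts_UNIV: "verts G = UNIV"
begin

definition unit :: "('v, 'e) path \<Rightarrow>\<^sub>0 'k::field" where
  "unit = (\<Sum>v\<in>UNIV. single (v, [], v) 1)"

lemma unit_mult: "path_mult unit f = f"
proof (induction f rule: poly_mapping_induct[OF subset_UNIV])
  case (2 p c)
  then show ?case
    by (cases p rule: prod_cases3) (simp add: unit_def path_mult_sum_left path_mult_single)
qed (auto simp: path_mult_add_right)

lemma mult_unit: "path_mult f unit = f"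
proof (induction f rule: poly_mapping_induct[OF subset_UNIV])
  case (2 p c)
  then show ?case
    by (cases p rule: prod_cases3) (simp add: unit_def path_mult_sum_right path_mult_single)
qed (auto simp: path_mult_add_left)

lemma path_Nil: "(v, [], v) \<in> paths G"
  by (simp add: paths_def awalk_Nil_iff verts_UNIV)

lemma path_append: "(u, p, v) \<in> paths G \<Longrightarrow> (v, q, w) \<in> paths G \<Longrightarrow> (u, p @ q, w) \<in> paths G"
  by (auto simp: paths_def)

lemma path_snoc_iff:
  "(u, p @ [a], v) \<in> paths G \<longleftrightarrow> (u, p, tail G a) \<in> paths G \<and> a \<in> arcs G \<and> v = head G a"
  by (auto simp: paths_def awalk_Cons_iff awalk_Nil_iff verts_UNIV)

lemma path_Cons_iff:
  "(u, a # p, v) \<in> paths G \<longleftrightarrow> (head G a, p, v) \<in> paths G \<and> a \<in> arcs G \<and> u = tail G a"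
  by (auto simp: paths_def awalk_Cons_iff)

lemma path_Nil_iff: "(u, [], v) \<in> paths G \<longleftrightarrow> u = v"
  by (auto simp: paths_def awalk_Nil_iff verts_UNIV)

lemma path_mult_keys: "keys f \<subseteq> paths G \<Longrightarrow> keys g \<subseteq> paths G \<Longrightarrow> keys (path_mult f g) \<subseteq> paths G"
  unfolding path_mult_lext
  by (intro lext_mono) (auto dest!: subsetD intro: path_append split: if_splits)

lemma keys_unit: "keys unit \<subseteq> paths G"
  unfolding unit_def by (rule keys_sum_subset) (auto simp: path_Nil)

abbreviation PA :: "(('v, 'e) path \<Rightarrow>\<^sub>0 'k::field, 'k, 'v) graded_algebra" where
  "PA \<equiv> path_algebra G"

lemma PA_simps [simp]:
  "carrier PA = {f. keys f \<subseteq> paths G}" "mult PA = path_mult" "one PA = unit" "zero PA = 0"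
  "add PA = (+)" "emb PA c = scale c unit" "idem PA v = single (v, [], v) 1"
  "hpart PA d = {f. keys f \<subseteq> {(u, p, v) \<in> paths G. length p = d}}"
  by (auto simp: path_algebra_def verts_UNIV unit_def scale_sum)

lemma ring_PA: "ring (PA :: (('v, 'e) path \<Rightarrow>\<^sub>0 'k::field, 'k, 'v) graded_algebra)"
proof (rule ringI)
  show "abelian_group (PA :: (('v, 'e) path \<Rightarrow>\<^sub>0 'k::field, 'k, 'v) graded_algebra)"
  proof (rule abelian_groupI)
    fix x :: "('v, 'e) path \<Rightarrow>\<^sub>0 'k" assume "x \<in> carrier PA"
    then show "\<exists>y\<in>carrier PA. y \<oplus>\<^bsub>PA\<^esub> x = \<zero>\<^bsub>PA\<^esub>"
      by (intro bexI[of _ "- x"]) auto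
  qed (auto simp: algebra_simps dest: keys_add[THEN subsetD])
  show "monoid (PA :: (('v, 'e) path \<Rightarrow>\<^sub>0 'k::field, 'k, 'v) graded_algebra)"
    by (rule monoidI)
      (auto simp: path_mult_assoc unit_mult mult_unit dest: path_mult_keys[THEN subsetD] keys_unit[THEN subsetD])
qed (auto simp: path_mult_add_left path_mult_add_right)

end

section \<open>Normal forms\<close>

text \<open>
  The setting of the double of a quiver, without the distinction between original and added arcs:
  \<open>opp\<close> exchanges \<open>a\<close> and \<open>a\<^sup>*\<close>, the weights \<open>eps\<close> are the signs in the relations, and \<open>b i\<close> is the leading arc at
  the black vertex \<open>i\<close>. The assumption \<open>no_overlap\<close> says that the last arc of a leading monomial is never
  the first arc of one; the whole argument rests on it.
\<close>

locale involutive_quiver = finite_quiver G for G :: "('v::finite, 'e) pre_digraph" +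
  fixes opp :: "'e \<Rightarrow> 'e" and eps :: "'e \<Rightarrow> 'k::field" and J :: "'v set" and b :: "'v \<Rightarrow> 'e"
  assumes opp_arc: "c \<in> arcs G \<Longrightarrow> opp c \<in> arcs G"
    and tail_opp: "c \<in> arcs G \<Longrightarrow> tail G (opp c) = head G c"
    and head_opp: "c \<in> arcs G \<Longrightarrow> head G (opp c) = tail G c"
    and opp_opp: "opp (opp c) = c"
    and eps_nonzero: "eps c \<noteq> 0"
    and b_arc: "i \<notin> J \<Longrightarrow> b i \<in> arcs G"
    and tail_b: "i \<notin> J \<Longrightarrow> tail G (b i) = i"
    and no_overlap: "i \<notin> J \<Longrightarrow> j \<notin> J \<Longrightarrow> b i \<noteq> opp (b j)"
begin

definition relation :: "('v, 'e) path \<Rightarrow>\<^sub>0 'k" where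
  "relation = (\<Sum>c | c \<in> arcs G \<and> tail G c \<notin> J. single (tail G c, [c, opp c], tail G c) (eps c))"

text \<open>
  The leading monomials, written in the order of travel.
\<close>

definition forbidden :: "'e \<Rightarrow> 'e \<Rightarrow> bool" where
  "forbidden a c \<longleftrightarrow> (\<exists>i. i \<notin> J \<and> a = b i \<and> c = opp (b i))"

definition normal :: "'e list \<Rightarrow> bool" where
  "normal p \<longleftrightarrow> successively (\<lambda>a c. \<not> forbidden a c) p"

definition normal_paths :: "'v \<Rightarrow> 'v \<Rightarrow> nat \<Rightarrow> ('v, 'e) path set" where
  "normal_paths u v d = {(u, p, v) | p. (u, p, v) \<in> paths G \<and> normal p \<and> length p = d}"

definition all_normal :: "('v, 'e) path set" where
  "all_normal = {(u, p, v) \<in> paths G. normal p}"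

lemma normal_Nil [simp]: "normal []"
  by (simp add: normal_def)

lemma normal_snoc: "normal (p @ [a]) \<longleftrightarrow> normal p \<and> (p = [] \<or> \<not> forbidden (last p) a)"
  by (auto simp: normal_def successively_append_iff)

lemma normal_Cons: "normal (a # p) \<longleftrightarrow> normal p \<and> (p = [] \<or> \<not> forbidden a (hd p))"
  by (auto simp: normal_def successively_Cons)

lemma in_normal_paths:
  "(u', p, v') \<in> normal_paths u v d
    \<longleftrightarrow> u' = u \<and> v' = v \<and> (u, p, v) \<in> paths G \<and> normal p \<and> length p = d"
  by (auto simp: normal_paths_def)

lemma in_all_normal: "(u, p, v) \<in> all_normal \<longleftrightarrow> (u, p, v) \<in> paths G \<and> normal p"
  by (simp add: all_normal_def)

lemma normal_paths_all: "normal_paths u v d \<subseteq> all_normal"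
  by (auto simp: normal_paths_def all_normal_def)

lemma all_normal_paths: "all_normal \<subseteq> paths G"
  by (auto simp: all_normal_def)

lemma not_forbidden_b: "i \<notin> J \<Longrightarrow> \<not> forbidden a (b i)"
  using no_overlap by (auto simp: forbidden_def)

lemma forbidden_opp: "forbidden a (opp c) \<longleftrightarrow> (\<exists>i. i \<notin> J \<and> c = b i \<and> a = c)"
  unfolding forbidden_def by (metis opp_opp)

definition snoc :: "'e \<Rightarrow> (('v, 'e) path \<Rightarrow>\<^sub>0 'k) \<Rightarrow> (('v, 'e) path \<Rightarrow>\<^sub>0 'k)" where
  "snoc a = lext (\<lambda>(u, p, v). single (u, p @ [a], head G a) 1)"

text \<open>
  The normal form of a normal path \<open>p\<close> followed by an arc \<open>a\<close>. If a leading monomial arises at the end of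
  the path, it is replaced by the other terms \<open>c\<close>, \<open>opp c\<close> of its relation. First \<open>c\<close> is appended to the
  shorter path \<open>butlast p\<close>, which may need further replacements. Appending \<open>opp c\<close> afterwards needs none,
  since a normal path that \<open>opp c\<close> prolongs to a forbidden one ends with \<open>c\<close> and \<open>c\<close> is a leading arc, whereas
  the leading arc has been left out. Hence the length of the path decreases in the
  recursion.
\<close>

function append_nf :: "'v \<Rightarrow> 'e list \<Rightarrow> 'e \<Rightarrow> ('v, 'e) path \<Rightarrow>\<^sub>0 'k" where
  "append_nf u p a =
    (if p \<noteq> [] \<and> forbidden (last p) a
     then scale (- inverse (eps (last p)))
       (\<Sum>c | c \<in> arcs G \<and> tail G c = tail G (last p) \<and> c \<noteq> last p.
         scale (eps c) (snoc (opp c) (append_nf u (butlast p) c)))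
     else single (u, p @ [a], head G a) 1)"
  by pat_completeness auto
termination by (relation "measure (\<lambda>(u, p, a). length p)") auto

declare append_nf.simps [simp del]

lemma append_nf_normal:
  "p = [] \<or> \<not> forbidden (last p) a \<Longrightarrow> append_nf u p a = single (u, p @ [a], head G a) 1"
  by (subst append_nf.simps) auto

lemma append_nf_forbidden:
  "i \<notin> J \<Longrightarrow> append_nf u (p @ [b i]) (opp (b i)) = scale (- inverse (eps (b i)))
     (\<Sum>c | c \<in> arcs G \<and> tail G c = i \<and> c \<noteq> b i. scale (eps c) (snoc (opp c) (append_nf u p c)))"
  by (subst append_nf.simps) (auto simp: forbidden_def tail_b)

lemma append_nf_cases:
  obtains "p = [] \<or> \<not> forbidden (last p) a"
  | i q where "i \<notin> J" "p = q @ [b i]" "a = opp (b i)"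
  by (cases p rule: rev_cases) (auto simp: forbidden_def)

lemma append_nf_keys:
  assumes "(u, p, tail G a) \<in> paths G" "normal p" "a \<in> arcs G"
  shows "keys (append_nf u p a) \<subseteq> normal_paths u (head G a) (Suc (length p))"
  using assms
proof (induction "length p" arbitrary: p a rule: less_induct)
  case less
  show ?case
  proof (cases p a rule: append_nf_cases)
    case 1
    then show ?thesis
      using less.prems by (auto simp: append_nf_normal in_normal_paths path_snoc_iff normal_snoc)
  next
    case (2 i q)
    have q: "(u, q, i) \<in> paths G" "normal q"
      using less.prems 2 by (auto simp: path_snoc_iff normal_snoc tail_b)
    have "keys (snoc (opp c) (append_nf u q c)) \<subseteq> normal_paths u (head G a) (Suc (length p))"
      if c: "c \<in> arcs G" "tail G c = i" "c \<noteq> b i" for c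
      unfolding snoc_def
    proof (rule lext_mono)
      fix x assume "x \<in> keys (append_nf u q c)"
      then have "x \<in> normal_paths u (head G c) (length p)"
        using less.hyps[of q c] q c 2 by auto
      then obtain r where r: "x = (u, r, head G c)" "(u, r, head G c) \<in> paths G" "normal r"
          "length r = length p"
        by (auto simp: normal_paths_def)
      \<comment> \<open>Only \<open>c = b i\<close> could make \<open>opp c\<close> the end of a leading monomial.\<close>
      have "\<not> forbidden (last r) (opp c)"
        using c tail_b by (auto simp: forbidden_opp)
      then show "keys (case x of (u, p, v) \<Rightarrow> single (u, p @ [opp c], head G (opp c)) 1)
          \<subseteq> normal_paths u (head G a) (Suc (length p))"
        using r c 2 by (auto simp: in_normal_paths path_snoc_iff normal_snoc opp_arc tail_opp
            head_opp b_arc tail_b)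
    qed
    then show ?thesis
      unfolding 2(2,3) append_nf_forbidden[OF 2(1)] unfolding 2(2,3)[symmetric]
      by (intro order_trans[OF keys_scale] keys_sum_subset) auto
  qed
qed

abbreviation "e v \<equiv> single (v, [], v) (1::'k)"

text \<open>
  A word acts on combinations of normal paths by appending its arcs one by one; the normal form of a
  path is its action on the trivial path at its starting point.
\<close>

definition step :: "'e \<Rightarrow> (('v, 'e) path \<Rightarrow>\<^sub>0 'k) \<Rightarrow> (('v, 'e) path \<Rightarrow>\<^sub>0 'k)" where
  "step a = lext (\<lambda>(u, p, v). if v = tail G a then append_nf u p a else 0)"

definition steps :: "'e list \<Rightarrow> (('v, 'e) path \<Rightarrow>\<^sub>0 'k) \<Rightarrow> (('v, 'e) path \<Rightarrow>\<^sub>0 'k)" where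
  "steps p f = foldl (\<lambda>g a. step a g) f p"

definition nf :: "(('v, 'e) path \<Rightarrow>\<^sub>0 'k) \<Rightarrow> (('v, 'e) path \<Rightarrow>\<^sub>0 'k)" where
  "nf = lext (\<lambda>(u, p, v). steps p (e u))"

lemma steps_simps [simp]: "steps [] f = f" "steps (p @ q) f = steps q (steps p f)"
    "steps [a] f = step a f" "steps [a, c] f = step c (step a f)"
  by (simp_all add: steps_def)

lemma steps_linear:
  "steps p 0 = 0" "steps p (f + g) = steps p f + steps p g" "steps p (scale c f) = scale c (steps p f)"
  by (induction p rule: rev_induct) (simp_all add: step_def lext_add lext_scale)

lemma nf_linear [simp]: "nf 0 = 0" "nf (f + g) = nf f + nf g" "nf (f - g) = nf f - nf g"
  "nf (scale c f) = scale c (nf f)" "nf (- f) = - nf f"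
  by (simp_all add: nf_def lext_add lext_diff lext_scale)

lemma step_keys:
  assumes "keys f \<subseteq> normal_paths u v d" "tail G a = v" "a \<in> arcs G"
  shows "keys (step a f) \<subseteq> normal_paths u (head G a) (Suc d)"
  unfolding step_def
proof (rule lext_mono)
  fix x assume "x \<in> keys f"
  then obtain p where "x = (u, p, v)" "(u, p, v) \<in> paths G" "normal p" "length p = d"
    using assms by (auto simp: normal_paths_def)
  then show "keys (case x of (u, p, v) \<Rightarrow> if v = tail G a then append_nf u p a else 0)
      \<subseteq> normal_paths u (head G a) (Suc d)"
    using assms append_nf_keys[of u p a] by auto
qed

lemma steps_keys:
  assumes "(u, p, v) \<in> paths G"
  shows "keys (steps p (e u)) \<subseteq> normal_paths u v (length p)"
  using assms
proof (induction p arbitrary: v rule: rev_induct)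
  case Nil
  then show ?case by (auto simp: in_normal_paths path_Nil_iff)
next
  case (snoc a p)
  then show ?case
    using step_keys[of "steps p (e u)" u "tail G a" "length p" a] by (auto simp: path_snoc_iff)
qed

lemma nf_mem:
  assumes "keys f \<subseteq> paths G"
    and "\<And>u p v. (u, p, v) \<in> keys f \<Longrightarrow> normal_paths u v (length p) \<subseteq> S"
  shows "keys (nf f) \<subseteq> S"
  unfolding nf_def
proof (rule lext_mono)
  fix x assume x: "x \<in> keys f"
  obtain u p v where "x = (u, p, v)" by (cases x rule: prod_cases3)
  then show "keys (case x of (u, p, v) \<Rightarrow> steps p (e u)) \<subseteq> S"
    using steps_keys[of u p v] assms(1) assms(2)[of u p v] x by auto
qed

lemma nf_keys: "keys f \<subseteq> paths G \<Longrightarrow> keys (nf f) \<subseteq> all_normal"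
  by (rule nf_mem) (auto simp: normal_paths_all[THEN subsetD])

lemma steps_normal: "(u, p, v) \<in> paths G \<Longrightarrow> normal p \<Longrightarrow> steps p (e u) = single (u, p, v) 1"
proof (induction p arbitrary: v rule: rev_induct)
  case (snoc a p)
  then have "steps p (e u) = single (u, p, tail G a) 1"
    by (auto simp: path_snoc_iff normal_snoc)
  then show ?case
    using snoc.prems by (auto simp: step_def append_nf_normal normal_snoc path_snoc_iff)
qed (auto simp: path_Nil_iff)

lemma nf_normal: "keys f \<subseteq> all_normal \<Longrightarrow> nf f = f"
  unfolding nf_def by (rule lext_id) (auto simp: steps_normal all_normal_def)

text \<open>
  The action of the path algebra on combinations of normal paths. By \<open>nf_mult\<close> the map \<open>nf\<close> turns left
  multiplication into this action.
\<close>

definition act :: "(('v, 'e) path \<Rightarrow>\<^sub>0 'k) \<Rightarrow> (('v, 'e) path \<Rightarrow>\<^sub>0 'k) \<Rightarrow> (('v, 'e) path \<Rightarrow>\<^sub>0 'k)" where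
  "act x g = lext (\<lambda>(u, p, v). steps p (path_mult (e u) g)) x"

lemma act_add: "act (x + y) g = act x g + act y g"
  by (simp add: act_def lext_add)

lemma act_add_right: "act x (g + h) = act x g + act x h"
  by (induction x rule: poly_mapping_induct[OF subset_UNIV])
    (auto simp: act_def lext_add path_mult_add_right steps_linear scale_add algebra_simps)

lemma act_zero [simp]: "act 0 g = 0" "act x 0 = 0"
  using act_add_right[of x 0 0] by (auto simp: act_def)

lemma idem_mult_ending:
  assumes "\<And>w p v'. (w, p, v') \<in> keys g \<Longrightarrow> v' = v"
  shows "path_mult (e u) g = (if u = v then g else 0)"
proof -
  have "path_mult (e u) g = lext (concat_path (u, [], u)) g"
    by (simp add: path_mult_lext)
  also have "\<dots> = lext (\<lambda>p. if u = v then single p 1 else 0) g"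
    using assms by (intro lext_cong) fastforce
  also have "\<dots> = (if u = v then g else 0)"
    by (cases "u = v") (simp_all add: lext_id, simp add: lext_def)
  finally show ?thesis .
qed

lemma nf_mult:
  assumes "keys x \<subseteq> paths G" "keys f \<subseteq> paths G"
  shows "nf (path_mult x f) = act x (nf f)"
  using assms(1)
proof (induction x rule: poly_mapping_induct)
  case (single p c)
  obtain u p' v where p: "p = (u, p', v)" by (cases p rule: prod_cases3)
  show ?case using assms(2)
  proof (induction f rule: poly_mapping_induct)
    case (single q d)
    obtain u' q' v' where q: "q = (u', q', v')" by (cases q rule: prod_cases3)
    have "path_mult (e u) (steps q' (e u')) = (if u = v' then steps q' (e u') else 0)"
      using steps_keys[of u' q' v'] single q by (intro idem_mult_ending) (auto simp: normal_paths_def)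
    then show ?case
      by (auto simp: p q path_mult_single nf_def act_def path_mult_scale steps_linear)
  qed (auto simp: path_mult_add_right act_add_right)
qed (auto simp: path_mult_add_left act_add)

lemma step_opp:
  assumes c: "c \<in> arcs G" "tail G c \<notin> J \<Longrightarrow> c \<noteq> b (tail G c)"
    and f: "keys f \<subseteq> normal_paths u (head G c) d"
  shows "step (opp c) f = snoc (opp c) f"
  unfolding step_def snoc_def
proof (rule lext_cong)
  fix x assume "x \<in> keys f"
  then obtain p where "x = (u, p, head G c)"
    using f by (auto simp: normal_paths_def)
  moreover have "\<not> forbidden (last p) (opp c)"
    using c tail_b by (auto simp: forbidden_opp)
  ultimately show "(case x of (u, p, v) \<Rightarrow> if v = tail G (opp c) then append_nf u p (opp c) else 0)
      = (case x of (u, p, v) \<Rightarrow> single (u, p @ [opp c], head G (opp c)) 1)"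
    using c by (auto simp: tail_opp append_nf_normal)
qed

text \<open>
  Appending \<open>opp (b i)\<close> after \<open>b i\<close> has been defined as minus the sum of the other terms of the relation, so
  the relation acts by zero.
\<close>

lemma relation_act:
  assumes "keys g \<subseteq> all_normal"
  shows "act relation g = 0"
  using assms
proof (induction g rule: poly_mapping_induct)
  case (single x k)
  obtain u p i where x: "x = (u, p, i)" and p: "(u, p, i) \<in> paths G" "normal p"
    using single by (auto simp: all_normal_def)
  let ?S = "{c \<in> arcs G. tail G c = i}"
  have "act relation (single x k) = (\<Sum>c | c \<in> arcs G \<and> tail G c \<notin> J.
      if tail G c = i then scale k (scale (eps c) (step (opp c) (append_nf u p c))) else 0)"
    unfolding act_def relation_def lext_sum
    by (intro sum.cong) (auto simp: x path_mult_single step_def lext_scale mult.commute)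
  also have "\<dots> = 0"
  proof (cases "i \<in> J")
    case False
    let ?T = "{c. c \<in> arcs G \<and> tail G c = i \<and> c \<noteq> b i}"
    have T: "?S = insert (b i) ?T" "finite ?T" "b i \<notin> ?T"
      using False b_arc tail_b by auto
    have "step (opp (b i)) (append_nf u p (b i)) = append_nf u (p @ [b i]) (opp (b i))"
      using False by (simp add: append_nf_normal not_forbidden_b step_def tail_opp b_arc)
    then have eq: "scale (eps (b i)) (step (opp (b i)) (append_nf u p (b i)))
        = - (\<Sum>c\<in>?T. scale (eps c) (snoc (opp c) (append_nf u p c)))"
      using False by (simp add: append_nf_forbidden eps_nonzero)
    have "step (opp c) (append_nf u p c) = snoc (opp c) (append_nf u p c)" if "c \<in> ?T" for c
      using that append_nf_keys[of u p c] p by (intro step_opp) auto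
    then have "(\<Sum>c\<in>?T. scale (eps c) (step (opp c) (append_nf u p c)))
        = (\<Sum>c\<in>?T. scale (eps c) (snoc (opp c) (append_nf u p c)))"
      by (intro sum.cong) auto
    with eq T have 0: "(\<Sum>c\<in>?S. scale (eps c) (step (opp c) (append_nf u p c))) = 0"
      by simp
    have "(\<Sum>c | c \<in> arcs G \<and> tail G c \<notin> J.
        if tail G c = i then scale k (scale (eps c) (step (opp c) (append_nf u p c))) else 0)
      = (\<Sum>c\<in>?S. scale k (scale (eps c) (step (opp c) (append_nf u p c))))"
      using False by (intro sum.mono_neutral_cong_right) auto
    also have "\<dots> = scale k (\<Sum>c\<in>?S. scale (eps c) (step (opp c) (append_nf u p c)))"
      by (simp only: scale_sum)
    finally show ?thesis using 0 by simp
  qed (auto intro: sum.neutral)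
  finally show ?case .
qed (auto simp: act_add_right)

abbreviation "A \<equiv> (PA :: (('v, 'e) path \<Rightarrow>\<^sub>0 'k, 'k, 'v) graded_algebra)"

definition rel_ideal :: "(('v, 'e) path \<Rightarrow>\<^sub>0 'k) set" where
  "rel_ideal = Idl\<^bsub>A\<^esub> {relation}"

lemma relation_keys: "keys relation \<subseteq> {(u, p, v) \<in> paths G. length p = 2}"
  unfolding relation_def
  by (rule keys_sum_subset)
    (auto simp: path_Cons_iff path_Nil_iff opp_arc tail_opp head_opp split: if_splits)

lemma relation_carrier: "keys relation \<subseteq> paths G"
  using relation_keys by auto

lemma ideal_rel_ideal: "ideal rel_ideal A"
  unfolding rel_ideal_def
  using relation_carrier by (intro ring.genideal_ideal[OF ring_PA]) auto

lemma relation_in_ideal: "relation \<in> rel_ideal"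
  unfolding rel_ideal_def
  using ring.genideal_self[OF ring_PA, of "{relation}"] relation_carrier by auto

lemma rel_ideal_zero: "0 \<in> rel_ideal"
  using additive_subgroup.zero_closed[OF ideal.axioms(1)[OF ideal_rel_ideal]] by simp

lemma rel_ideal_add: "f \<in> rel_ideal \<Longrightarrow> g \<in> rel_ideal \<Longrightarrow> f + g \<in> rel_ideal"
  using additive_subgroup.a_closed[OF ideal.axioms(1)[OF ideal_rel_ideal]] by simp

lemma rel_ideal_left: "f \<in> rel_ideal \<Longrightarrow> keys x \<subseteq> paths G \<Longrightarrow> path_mult x f \<in> rel_ideal"
  using ideal.I_l_closed[OF ideal_rel_ideal] by simp

lemma rel_ideal_right: "f \<in> rel_ideal \<Longrightarrow> keys x \<subseteq> paths G \<Longrightarrow> path_mult f x \<in> rel_ideal"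
  using ideal.I_r_closed[OF ideal_rel_ideal] by simp

lemma rel_ideal_scale: "f \<in> rel_ideal \<Longrightarrow> scale c f \<in> rel_ideal"
  using rel_ideal_left[of f "scale c unit"] keys_scale[of c unit] keys_unit
  by (force simp: path_mult_scale unit_mult)

lemma rel_ideal_diff: "f \<in> rel_ideal \<Longrightarrow> g \<in> rel_ideal \<Longrightarrow> f - g \<in> rel_ideal"
  using rel_ideal_add[of f "- g"] rel_ideal_scale[of g "-1"] by simp

lemma rel_ideal_sum: "(\<And>x. x \<in> S \<Longrightarrow> f x \<in> rel_ideal) \<Longrightarrow> sum f S \<in> rel_ideal"
  by (induction S rule: infinite_finite_induct) (auto simp: rel_ideal_zero rel_ideal_add)

lemma rel_ideal_lext:
  assumes "\<And>p. p \<in> keys f \<Longrightarrow> F p - H p \<in> rel_ideal"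
  shows "lext F f - lext H f \<in> rel_ideal"
proof -
  have "lext F f - lext H f = (\<Sum>p\<in>keys f. scale (lookup f p) (F p - H p))"
    unfolding lext_def sum_subtractf[symmetric]
    by (intro sum.cong refl poly_mapping_eqI) (simp add: lookup_minus algebra_simps)
  then show ?thesis using assms by (simp add: rel_ideal_sum rel_ideal_scale)
qed

text \<open>
  The kernel of \<open>nf\<close> is visibly only a left ideal. The elements \<open>x\<close> such that \<open>nf\<close> vanishes on \<open>x y\<close> for all
  \<open>y\<close> form a two-sided ideal, which contains the relation because the relation acts by zero.
\<close>

lemma nf_rel_ideal:
  assumes "f \<in> rel_ideal"
  shows "nf f = 0"
proof -
  let ?K = "{x. keys x \<subseteq> paths G \<and> (\<forall>y. keys y \<subseteq> paths G \<longrightarrow> nf (path_mult x y) = 0)}"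
  have "ideal ?K A"
  proof (rule idealI[OF ring_PA])
    show "subgroup ?K (add_monoid A)"
    proof (rule group.subgroupI[OF abelian_group.a_group[OF ring.is_abelian_group[OF ring_PA]]])
      fix x assume x: "x \<in> ?K"
      then have "inv\<^bsub>add_monoid A\<^esub> x = - x"
        by (intro group.inv_equality[OF abelian_group.a_group[OF ring.is_abelian_group[OF ring_PA]]])
          auto
      then show "inv\<^bsub>add_monoid A\<^esub> x \<in> ?K" using x by auto
    qed (auto simp: path_mult_add_left dest: keys_add[THEN subsetD] intro!: exI[of _ 0])
  next
    fix a x assume a: "a \<in> ?K" and x: "x \<in> carrier A"
    have "nf (path_mult x (path_mult a y)) = 0" if "keys y \<subseteq> paths G" for y
      using nf_mult[of x "path_mult a y"] a x that by (simp add: path_mult_keys)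
    then show "x \<otimes>\<^bsub>A\<^esub> a \<in> ?K"
      using a x by (simp add: path_mult_assoc path_mult_keys)
    have "nf (path_mult a (path_mult x y)) = 0" if "keys y \<subseteq> paths G" for y
      using a x that by (simp add: path_mult_keys)
    then show "a \<otimes>\<^bsub>A\<^esub> x \<in> ?K"
      using a x by (simp add: path_mult_assoc path_mult_keys)
  qed
  moreover have "{relation} \<subseteq> ?K"
    using relation_carrier by (auto simp: nf_mult relation_act nf_keys)
  ultimately have "rel_ideal \<subseteq> ?K"
    unfolding rel_ideal_def by (rule ring.genideal_minimal[OF ring_PA])
  then have "nf (path_mult f unit) = 0"
    using assms keys_unit by blast
  then show ?thesis by (simp add: mult_unit)
qed

lemma snoc_mult:
  assumes "\<And>w p v'. (w, p, v') \<in> keys f \<Longrightarrow> v' = tail G a"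
  shows "snoc a f = path_mult (arrow G a) f"
  using assms unfolding snoc_def arrow_def path_mult_lext
  by (auto intro!: lext_cong)

lemma arrow_keys: "a \<in> arcs G \<Longrightarrow> keys (arrow G a :: _ \<Rightarrow>\<^sub>0 'k) \<subseteq> paths G"
  by (simp add: arrow_def path_Cons_iff path_Nil_iff)

text \<open>
  One replacement step changes an element by a multiple of the relation; the induction covers the
  replacements that are nested in it.
\<close>

lemma append_nf_rel:
  assumes "(u, p, tail G a) \<in> paths G" "normal p" "a \<in> arcs G"
  shows "single (u, p @ [a], head G a) 1 - append_nf u p a \<in> rel_ideal"
  using assms
proof (induction "length p" arbitrary: p a rule: less_induct)
  case less
  show ?case
  proof (cases p a rule: append_nf_cases)
    case 1
    then show ?thesis by (simp add: append_nf_normal rel_ideal_zero)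
  next
    case (2 i q)
    let ?T = "{c. c \<in> arcs G \<and> tail G c = i \<and> c \<noteq> b i}"
    let ?w = "\<lambda>c. single (u, q @ [c, opp c], i) (1::'k)"
    have q: "(u, q, i) \<in> paths G" "normal q"
      using less.prems 2 by (auto simp: path_snoc_iff normal_snoc tail_b)
    have rest: "?w c - snoc (opp c) (append_nf u q c) \<in> rel_ideal" if c: "c \<in> ?T" for c
    proof -
      have "single (u, q @ [c], head G c) 1 - append_nf u q c \<in> rel_ideal"
        using less.hyps[of q c] q c 2 by auto
      then have "path_mult (arrow G (opp c)) (single (u, q @ [c], head G c) 1 - append_nf u q c)
          \<in> rel_ideal"
        using c by (intro rel_ideal_left) (auto simp: arrow_keys opp_arc)
      moreover have "snoc (opp c) (append_nf u q c) = path_mult (arrow G (opp c)) (append_nf u q c)"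
        using append_nf_keys[of u q c] q c by (intro snoc_mult) (auto simp: normal_paths_def tail_opp)
      ultimately show ?thesis
        using c by (simp add: path_mult_diff_right arrow_def path_mult_single tail_opp head_opp)
    qed
    \<comment> \<open>Multiplying by a path that ends at \<open>i\<close> selects the component of the relation at \<open>i\<close>.\<close>
    have "path_mult relation (single (u, q, i) 1)
        = (\<Sum>c | c \<in> arcs G \<and> tail G c \<notin> J. if tail G c = i then scale (eps c) (?w c) else 0)"
      unfolding relation_def path_mult_sum_left by (intro sum.cong) (auto simp: path_mult_single)
    also have "\<dots> = (\<Sum>c\<in>insert (b i) ?T. scale (eps c) (?w c))"
      using 2 b_arc tail_b by (intro sum.mono_neutral_cong_right) auto
    also have "\<dots> = scale (eps (b i)) (?w (b i)) + (\<Sum>c\<in>?T. scale (eps c) (?w c))"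
      by (subst sum.insert) auto
    finally have r: "scale (eps (b i)) (?w (b i)) + (\<Sum>c\<in>?T. scale (eps c) (?w c)) \<in> rel_ideal"
      using rel_ideal_right[OF relation_in_ideal, of "single (u, q, i) 1"] q by simp
    have "(\<Sum>c\<in>?T. scale (eps c) (?w c - snoc (opp c) (append_nf u q c))) \<in> rel_ideal"
      by (intro rel_ideal_sum rel_ideal_scale rest)
    from rel_ideal_scale[OF rel_ideal_diff[OF r this], of "inverse (eps (b i))"]
    have "?w (b i) - append_nf u p a \<in> rel_ideal"
      unfolding 2(2,3) append_nf_forbidden[OF 2(1)]
      by (simp add: scale_add sum_subtractf scale_sum sum_negf eps_nonzero algebra_simps
          scale_add[of _ _ "- _", simplified])
    then show ?thesis using 2 by (simp add: head_opp b_arc tail_b)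
  qed
qed

lemma step_rel:
  assumes "keys f \<subseteq> normal_paths u (tail G a) d" "a \<in> arcs G"
  shows "path_mult (arrow G a) f - step a f \<in> rel_ideal"
proof -
  have "path_mult (arrow G a) f = snoc a f"
    using assms by (intro snoc_mult[symmetric]) (auto simp: normal_paths_def)
  moreover have "snoc a f - step a f \<in> rel_ideal"
    unfolding snoc_def step_def
    using assms by (intro rel_ideal_lext) (fastforce simp: normal_paths_def intro!: append_nf_rel)
  ultimately show ?thesis by simp
qed

lemma steps_rel: "(u, p, v) \<in> paths G \<Longrightarrow> single (u, p, v) 1 - steps p (e u) \<in> rel_ideal"
proof (induction p arbitrary: v rule: rev_induct)
  case (snoc a p)
  let ?s = "single (u, p, tail G a) (1::'k)"
  have p: "(u, p, tail G a) \<in> paths G" "a \<in> arcs G" "v = head G a"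
    using snoc.prems by (auto simp: path_snoc_iff)
  have "path_mult (arrow G a) (?s - steps p (e u)) \<in> rel_ideal"
    using p snoc.IH by (intro rel_ideal_left) (auto simp: arrow_keys)
  from rel_ideal_add[OF this step_rel[OF steps_keys[OF p(1)] p(2)]]
  show ?case
    using p by (simp add: path_mult_diff_right arrow_def path_mult_single)
qed (auto simp: path_Nil_iff rel_ideal_zero)

lemma nf_rel: "keys f \<subseteq> paths G \<Longrightarrow> f - nf f \<in> rel_ideal"
proof -
  assume f: "keys f \<subseteq> paths G"
  have "lext (\<lambda>p. single p 1) f - nf f \<in> rel_ideal"
    unfolding nf_def using f by (intro rel_ideal_lext) (auto intro!: steps_rel)
  then show ?thesis by (simp add: lext_id)
qed

lemma rel_ideal_iff: "keys f \<subseteq> paths G \<Longrightarrow> f \<in> rel_ideal \<longleftrightarrow> nf f = 0"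
  using nf_rel_ideal nf_rel[of f] by auto

end

section \<open>Graded left modules and their bar cochains\<close>

locale graded_ring = ring A for A :: "('a, 'k::field, 'v) graded_algebra" (structure) +
  assumes emb_closed [simp, intro]: "emb A c \<in> carrier A"
    and emb_central: "x \<in> carrier A \<Longrightarrow> x \<otimes> emb A c = emb A c \<otimes> x"
    and hpart_closed: "x \<in> hpart A d \<Longrightarrow> x \<in> carrier A"
    and hpart_zero: "\<zero> \<in> hpart A d"
    and hpart_add: "x \<in> hpart A d \<Longrightarrow> y \<in> hpart A d \<Longrightarrow> x \<oplus> y \<in> hpart A d"
    and hpart_minus: "x \<in> hpart A d \<Longrightarrow> \<ominus> x \<in> hpart A d"
    and hpart_mult: "x \<in> hpart A d \<Longrightarrow> y \<in> hpart A e \<Longrightarrow> x \<otimes> y \<in> hpart A (d + e)"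

locale graded_left_module = graded_ring A + M: abelian_group M
  for A :: "('a, 'k::field, 'v) graded_algebra" (structure)
    and M :: "('a, 'm) graded_module" (structure) +
  assumes smult_closed [simp, intro]: "a \<in> carrier A \<Longrightarrow> x \<in> carrier M \<Longrightarrow> a \<odot>\<^bsub>M\<^esub> x \<in> carrier M"
    and smult_add_right: "a \<in> carrier A \<Longrightarrow> x \<in> carrier M \<Longrightarrow> y \<in> carrier M \<Longrightarrow>
      a \<odot>\<^bsub>M\<^esub> (x \<oplus>\<^bsub>M\<^esub> y) = a \<odot>\<^bsub>M\<^esub> x \<oplus>\<^bsub>M\<^esub> a \<odot>\<^bsub>M\<^esub> y"
    and smult_add_left: "a \<in> carrier A \<Longrightarrow> a' \<in> carrier A \<Longrightarrow> x \<in> carrier M \<Longrightarrow>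
      (a \<oplus>\<^bsub>A\<^esub> a') \<odot>\<^bsub>M\<^esub> x = a \<odot>\<^bsub>M\<^esub> x \<oplus>\<^bsub>M\<^esub> a' \<odot>\<^bsub>M\<^esub> x"
    and smult_assoc: "a \<in> carrier A \<Longrightarrow> a' \<in> carrier A \<Longrightarrow> x \<in> carrier M \<Longrightarrow>
      (a \<otimes>\<^bsub>A\<^esub> a') \<odot>\<^bsub>M\<^esub> x = a \<odot>\<^bsub>M\<^esub> (a' \<odot>\<^bsub>M\<^esub> x)"
    and mpart_closed: "x \<in> mpart M d \<Longrightarrow> x \<in> carrier M"
    and mpart_zero: "\<zero>\<^bsub>M\<^esub> \<in> mpart M d"
    and mpart_add: "x \<in> mpart M d \<Longrightarrow> y \<in> mpart M d \<Longrightarrow> x \<oplus>\<^bsub>M\<^esub> y \<in> mpart M d"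
    and mpart_minus: "x \<in> mpart M d \<Longrightarrow> \<ominus>\<^bsub>M\<^esub> x \<in> mpart M d"
    and mpart_smult: "a \<in> hpart A d \<Longrightarrow> x \<in> mpart M e \<Longrightarrow> a \<odot>\<^bsub>M\<^esub> x \<in> mpart M (d + e)"

definition sgn_add :: "('m, 'x) ring_scheme \<Rightarrow> nat \<Rightarrow> 'm \<Rightarrow> 'm" where
  "sgn_add N n x = (if even n then x else \<ominus>\<^bsub>N\<^esub> x)"

text \<open>
  Internal degrees of cochains are integers, so the components of a module are needed in all integer
  degrees.
\<close>

definition int_part :: "('a, 'm) graded_module \<Rightarrow> int \<Rightarrow> 'm set" where
  "int_part N s = (if 0 \<le> s then mpart N (nat s) else {\<zero>\<^bsub>N\<^esub>})"

context abelian_group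
begin

lemma add_pow_sgn: "x \<in> carrier G \<Longrightarrow> add_pow G ((- 1 :: int) ^ n) x = sgn_add G n x"
  using add.int_pow_1[of x] add.int_pow_neg[of x 1] by (cases "even n") (simp_all add: sgn_add_def)

lemma sgn_add_closed [simp, intro]: "x \<in> carrier G \<Longrightarrow> sgn_add G n x \<in> carrier G"
  by (simp add: sgn_add_def)

lemma sgn_add_add:
  "x \<in> carrier G \<Longrightarrow> y \<in> carrier G \<Longrightarrow> sgn_add G n (x \<oplus> y) = sgn_add G n x \<oplus> sgn_add G n y"
  by (simp add: sgn_add_def minus_add)

lemma sgn_add_zero [simp]: "sgn_add G n \<zero> = \<zero>"
  by (simp add: sgn_add_def)

lemma sgn_add_comm: "x \<in> carrier G \<Longrightarrow> sgn_add G n (sgn_add G m x) = sgn_add G (n + m) x"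
  by (simp add: sgn_add_def)

lemma sgn_add_twice [simp]: "x \<in> carrier G \<Longrightarrow> sgn_add G n (sgn_add G n x) = x"
  by (simp add: sgn_add_def)

lemma sgn_add_Suc: "x \<in> carrier G \<Longrightarrow> sgn_add G (Suc n) x = \<ominus> sgn_add G n x"
  by (simp add: sgn_add_def)

lemma sgn_add_swap:
  "x \<in> carrier G \<Longrightarrow> sgn_add G n (sgn_add G m x) = sgn_add G m (sgn_add G n x)"
  by (simp add: sgn_add_comm add.commute)

lemma sgn_add_finsum:
  assumes "f \<in> I \<rightarrow> carrier G"
  shows "sgn_add G n (\<Oplus>i\<in>I. f i) = (\<Oplus>i\<in>I. sgn_add G n (f i))"
  using assms
proof (induction I rule: infinite_finite_induct)
  case (insert x F)
  then show ?case by (simp add: sgn_add_add Pi_iff)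
qed simp_all

end

context graded_left_module
begin

lemma smult_zero_right [simp]: "a \<in> carrier A \<Longrightarrow> a \<odot>\<^bsub>M\<^esub> \<zero>\<^bsub>M\<^esub> = \<zero>\<^bsub>M\<^esub>"
  using smult_add_right[of a "\<zero>\<^bsub>M\<^esub>" "\<zero>\<^bsub>M\<^esub>"] M.add.l_cancel_one by fastforce

lemma smult_minus_right:
  "a \<in> carrier A \<Longrightarrow> x \<in> carrier M \<Longrightarrow> a \<odot>\<^bsub>M\<^esub> (\<ominus>\<^bsub>M\<^esub> x) = \<ominus>\<^bsub>M\<^esub> (a \<odot>\<^bsub>M\<^esub> x)"
  by (rule M.minus_equality[symmetric]) (simp_all add: smult_add_right[symmetric] M.l_neg)

lemma smult_sgn:
  "a \<in> carrier A \<Longrightarrow> x \<in> carrier M \<Longrightarrow> a \<odot>\<^bsub>M\<^esub> sgn_add M n x = sgn_add M n (a \<odot>\<^bsub>M\<^esub> x)"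
  by (simp add: sgn_add_def smult_minus_right)

lemma smult_finsum:
  "a \<in> carrier A \<Longrightarrow> f \<in> I \<rightarrow> carrier M \<Longrightarrow>
    a \<odot>\<^bsub>M\<^esub> (\<Oplus>\<^bsub>M\<^esub>i\<in>I. f i) = (\<Oplus>\<^bsub>M\<^esub>i\<in>I. a \<odot>\<^bsub>M\<^esub> f i)"
proof (induction I rule: infinite_finite_induct)
  case (insert x F)
  then show ?case by (simp add: smult_add_right Pi_iff)
qed simp_all

lemma int_part_closed: "x \<in> int_part M s \<Longrightarrow> x \<in> carrier M"
  by (auto simp: int_part_def mpart_closed split: if_splits)

lemma int_part_zero: "\<zero>\<^bsub>M\<^esub> \<in> int_part M s"
  by (simp add: int_part_def mpart_zero)

lemma int_part_add: "x \<in> int_part M s \<Longrightarrow> y \<in> int_part M s \<Longrightarrow> x \<oplus>\<^bsub>M\<^esub> y \<in> int_part M s"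
  by (auto simp: int_part_def mpart_add split: if_splits)

lemma int_part_sgn: "x \<in> int_part M s \<Longrightarrow> sgn_add M n x \<in> int_part M s"
  by (auto simp: int_part_def mpart_minus sgn_add_def split: if_splits)

lemma int_part_finsum:
  "(\<And>i. i \<in> I \<Longrightarrow> f i \<in> int_part M s) \<Longrightarrow> (\<Oplus>\<^bsub>M\<^esub>i\<in>I. f i) \<in> int_part M s"
proof (induction I rule: infinite_finite_induct)
  case (insert x F)
  then have "f \<in> F \<rightarrow> carrier M" "f x \<in> carrier M" by (auto intro: int_part_closed)
  then show ?case using insert by (simp add: int_part_add)
qed (simp_all add: int_part_zero)

end

lemma additive_zero:
  assumes "abelian_group M" "abelian_group N"
    and "\<And>x. x \<in> carrier M \<Longrightarrow> \<phi> x \<in> carrier N"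
    and "\<And>x y. x \<in> carrier M \<Longrightarrow> y \<in> carrier M \<Longrightarrow> \<phi> (x \<oplus>\<^bsub>M\<^esub> y) = \<phi> x \<oplus>\<^bsub>N\<^esub> \<phi> y"
  shows "\<phi> \<zero>\<^bsub>M\<^esub> = \<zero>\<^bsub>N\<^esub>"
proof -
  interpret M: abelian_group M by fact
  interpret N: abelian_group N by fact
  have "\<phi> \<zero>\<^bsub>M\<^esub> \<oplus>\<^bsub>N\<^esub> \<phi> \<zero>\<^bsub>M\<^esub> = \<phi> \<zero>\<^bsub>M\<^esub>"
    using assms(4)[of "\<zero>\<^bsub>M\<^esub>" "\<zero>\<^bsub>M\<^esub>"] by simp
  then show ?thesis using assms(3)[of "\<zero>\<^bsub>M\<^esub>"] N.add.l_cancel_one by force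
qed

lemma additive_minus:
  assumes "abelian_group M" "abelian_group N"
    and "\<And>x. x \<in> carrier M \<Longrightarrow> \<phi> x \<in> carrier N"
    and "\<And>x y. x \<in> carrier M \<Longrightarrow> y \<in> carrier M \<Longrightarrow> \<phi> (x \<oplus>\<^bsub>M\<^esub> y) = \<phi> x \<oplus>\<^bsub>N\<^esub> \<phi> y"
    and "x \<in> carrier M"
  shows "\<phi> (\<ominus>\<^bsub>M\<^esub> x) = \<ominus>\<^bsub>N\<^esub> \<phi> x"
proof -
  interpret M: abelian_group M by fact
  interpret N: abelian_group N by fact
  have "\<phi> (\<ominus>\<^bsub>M\<^esub> x) \<oplus>\<^bsub>N\<^esub> \<phi> x = \<zero>\<^bsub>N\<^esub>"
    using assms(4)[of "\<ominus>\<^bsub>M\<^esub> x" x] assms(5) additive_zero[OF assms(1-4)] by (simp add: M.l_neg)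
  then show ?thesis using assms(3,5) N.minus_equality by fastforce
qed

lemma additive_finsum:
  assumes "abelian_group M" "abelian_group N"
    and "\<And>x. x \<in> carrier M \<Longrightarrow> \<phi> x \<in> carrier N"
    and "\<And>x y. x \<in> carrier M \<Longrightarrow> y \<in> carrier M \<Longrightarrow> \<phi> (x \<oplus>\<^bsub>M\<^esub> y) = \<phi> x \<oplus>\<^bsub>N\<^esub> \<phi> y"
    and "f \<in> I \<rightarrow> carrier M"
  shows "\<phi> (\<Oplus>\<^bsub>M\<^esub>i\<in>I. f i) = (\<Oplus>\<^bsub>N\<^esub>i\<in>I. \<phi> (f i))"
proof -
  interpret M: abelian_group M by fact
  interpret N: abelian_group N by fact
  show ?thesis using assms(5)
  proof (induction I rule: infinite_finite_induct)
    case (insert x F)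
    then show ?case using assms(3) by (simp add: assms(4) Pi_iff)
  qed (simp_all add: additive_zero[OF assms(1-4)])
qed

section \<open>The inner part of the bar differential\<close>

text \<open>
  All summands of the bar differential but the last leave the module argument alone. They are split off,
  for a fixed module argument, so that maps between modules only have to be compared with the last one.
\<close>

definition inner_differential ::
  "('a, 'k, 'v) graded_algebra \<Rightarrow> ('a, 'n) graded_module \<Rightarrow> ('a list \<Rightarrow> 'n) \<Rightarrow> 'a list \<Rightarrow> 'n" where
  "inner_differential A N \<phi> as =
    (hd as \<odot>\<^bsub>N\<^esub> \<phi> (tl as))
    \<oplus>\<^bsub>N\<^esub> (\<Oplus>\<^bsub>N\<^esub>i\<in>{..<length as - 1}.
      add_pow N ((-1 :: int) ^ (i + 1)) (\<phi> (take i as @ (as ! i \<otimes>\<^bsub>A\<^esub> as ! (i + 1)) # drop (i + 2) as)))"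

definition fun_on :: "('a, 'k, 'v) graded_algebra \<Rightarrow> ('a, 'n) graded_module \<Rightarrow> nat \<Rightarrow> ('a list \<Rightarrow> 'n) \<Rightarrow> bool"
  where "fun_on A N n \<phi> \<longleftrightarrow> (\<forall>as. length as = n \<and> set as \<subseteq> carrier A \<longrightarrow> \<phi> as \<in> carrier N)"

lemma fun_onD: "fun_on A N n \<phi> \<Longrightarrow> length as = n \<Longrightarrow> set as \<subseteq> carrier A \<Longrightarrow> \<phi> as \<in> carrier N"
  by (simp add: fun_on_def)

context graded_left_module
begin

lemma contract_closed:
  assumes "set as \<subseteq> carrier A" "i < length as - 1"
  shows "set (take i as @ (as ! i \<otimes> as ! (i + 1)) # drop (i + 2) as) \<subseteq> carrier A"
    "length (take i as @ (as ! i \<otimes> as ! (i + 1)) # drop (i + 2) as) = length as - 1"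
  using assms by (auto dest!: in_set_takeD in_set_dropD simp: subset_iff)

lemma hd_tl_closed:
  assumes "set as \<subseteq> carrier A" "length as = Suc n"
  shows "hd as \<in> carrier A" "set (tl as) \<subseteq> carrier A" "length (tl as) = n"
  using assms by (cases as; auto)+

lemma inner_closed [intro]:
  assumes "fun_on A M n \<phi>" "length as = Suc n" "set as \<subseteq> carrier A"
  shows "inner_differential A M \<phi> as \<in> carrier M"
proof -
  have "add_pow M ((-1 :: int) ^ (i + 1)) (\<phi> (take i as @ (as ! i \<otimes> as ! (i + 1)) # drop (i + 2) as)) \<in> carrier M"
    if "i < length as - 1" for i
    using assms contract_closed[of as i] that fun_onD[OF assms(1)] by (simp add: M.add_pow_sgn del: power_Suc)
  then show ?thesis
    using assms hd_tl_closed[of as n] fun_onD[OF assms(1)]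
    by (auto simp: inner_differential_def simp del: power_Suc intro!: M.a_closed M.finsum_closed)
qed

lemma inner_eq:
  assumes "fun_on A M n \<phi>" "length as = Suc n" "set as \<subseteq> carrier A"
  shows "inner_differential A M \<phi> as = (hd as \<odot>\<^bsub>M\<^esub> \<phi> (tl as))
    \<oplus>\<^bsub>M\<^esub> (\<Oplus>\<^bsub>M\<^esub>i\<in>{..<n}.
      sgn_add M (i + 1) (\<phi> (take i as @ (as ! i \<otimes>\<^bsub>A\<^esub> as ! (i + 1)) # drop (i + 2) as)))"
  unfolding inner_differential_def
  using assms contract_closed[of as] fun_onD[OF assms(1)]
  by (auto simp: M.add_pow_sgn simp del: power_Suc intro!: arg_cong2[where f = "add M"] M.finsum_cong')

lemma contract_fun_on:
  assumes "fun_on A M n \<phi>" "length as = Suc n" "set as \<subseteq> carrier A"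
  shows "(\<lambda>i. sgn_add M (i + 1) (\<phi> (take i as @ (as ! i \<otimes>\<^bsub>A\<^esub> as ! (i + 1)) # drop (i + 2) as)))
      \<in> {..<n} \<rightarrow> carrier M"
    "\<phi> (tl as) \<in> carrier M" "hd as \<in> carrier A"
    "\<And>i. i < n \<Longrightarrow> \<phi> (take i as @ (as ! i \<otimes>\<^bsub>A\<^esub> as ! (i + 1)) # drop (i + 2) as) \<in> carrier M"
  using assms contract_closed[of as] hd_tl_closed[of as n] fun_onD[OF assms(1)] by auto

lemma inner_cong:
  assumes "\<And>bs. length bs = n \<Longrightarrow> set bs \<subseteq> carrier A \<Longrightarrow> \<phi> bs = \<psi> bs"
    and "fun_on A M n \<phi>" "length as = Suc n" "set as \<subseteq> carrier A"
  shows "inner_differential A M \<phi> as = inner_differential A M \<psi> as"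
proof -
  have "fun_on A M n \<psi>" using assms(1,2) by (auto simp: fun_on_def)
  then show ?thesis
    using assms contract_closed[of as] hd_tl_closed[of as n] fun_onD[of A M n \<psi>]
    by (auto simp: inner_eq intro!: arg_cong2[where f = "add M"] M.finsum_cong')
qed

lemma inner_add:
  assumes "fun_on A M n \<phi>" "fun_on A M n \<psi>" "length as = Suc n" "set as \<subseteq> carrier A"
  shows "inner_differential A M (\<lambda>bs. \<phi> bs \<oplus>\<^bsub>M\<^esub> \<psi> bs) as
    = inner_differential A M \<phi> as \<oplus>\<^bsub>M\<^esub> inner_differential A M \<psi> as"
proof -
  note 1 = contract_fun_on[OF assms(1,3,4)] and 2 = contract_fun_on[OF assms(2-4)]
  have "fun_on A M n (\<lambda>bs. \<phi> bs \<oplus>\<^bsub>M\<^esub> \<psi> bs)"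
    using assms by (auto simp: fun_on_def)
  moreover have "(\<Oplus>\<^bsub>M\<^esub>i\<in>{..<n}.
      sgn_add M (i + 1) (\<phi> (take i as @ (as ! i \<otimes>\<^bsub>A\<^esub> as ! (i + 1)) # drop (i + 2) as)
        \<oplus>\<^bsub>M\<^esub> \<psi> (take i as @ (as ! i \<otimes>\<^bsub>A\<^esub> as ! (i + 1)) # drop (i + 2) as)))
    = (\<Oplus>\<^bsub>M\<^esub>i\<in>{..<n}.
      sgn_add M (i + 1) (\<phi> (take i as @ (as ! i \<otimes>\<^bsub>A\<^esub> as ! (i + 1)) # drop (i + 2) as))
        \<oplus>\<^bsub>M\<^esub> sgn_add M (i + 1) (\<psi> (take i as @ (as ! i \<otimes>\<^bsub>A\<^esub> as ! (i + 1)) # drop (i + 2) as)))"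
    using 1(4) 2(4) by (intro M.finsum_cong') (auto simp: M.sgn_add_add)
  moreover have "(\<Oplus>\<^bsub>M\<^esub>i\<in>{..<n}.
      sgn_add M (i + 1) (\<phi> (take i as @ (as ! i \<otimes>\<^bsub>A\<^esub> as ! (i + 1)) # drop (i + 2) as))
        \<oplus>\<^bsub>M\<^esub> sgn_add M (i + 1) (\<psi> (take i as @ (as ! i \<otimes>\<^bsub>A\<^esub> as ! (i + 1)) # drop (i + 2) as)))
    = (\<Oplus>\<^bsub>M\<^esub>i\<in>{..<n}. sgn_add M (i + 1) (\<phi> (take i as @ (as ! i \<otimes>\<^bsub>A\<^esub> as ! (i + 1)) # drop (i + 2) as)))
      \<oplus>\<^bsub>M\<^esub> (\<Oplus>\<^bsub>M\<^esub>i\<in>{..<n}. sgn_add M (i + 1) (\<psi> (take i as @ (as ! i \<otimes>\<^bsub>A\<^esub> as ! (i + 1)) # drop (i + 2) as)))"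
    using 1(1) 2(1) by (rule M.finsum_addf)
  ultimately show ?thesis
    using 1 2 assms
    by (simp add: inner_eq smult_add_right M.a_ac M.finsum_closed del: add_Suc_right)
qed

lemma inner_sgn:
  assumes "fun_on A M n \<phi>" "length as = Suc n" "set as \<subseteq> carrier A"
  shows "inner_differential A M (\<lambda>bs. sgn_add M k (\<phi> bs)) as
    = sgn_add M k (inner_differential A M \<phi> as)"
proof -
  note 1 = contract_fun_on[OF assms(1-3)]
  have "fun_on A M n (\<lambda>bs. sgn_add M k (\<phi> bs))"
    using assms by (auto simp: fun_on_def)
  moreover have "(\<Oplus>\<^bsub>M\<^esub>i\<in>{..<n}.
      sgn_add M (i + 1) (sgn_add M k (\<phi> (take i as @ (as ! i \<otimes>\<^bsub>A\<^esub> as ! (i + 1)) # drop (i + 2) as))))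
    = (\<Oplus>\<^bsub>M\<^esub>i\<in>{..<n}.
      sgn_add M k (sgn_add M (i + 1) (\<phi> (take i as @ (as ! i \<otimes>\<^bsub>A\<^esub> as ! (i + 1)) # drop (i + 2) as))))"
    using 1(4) by (intro M.finsum_cong') (auto simp: M.sgn_add_swap)
  ultimately show ?thesis
    using 1 assms
    by (simp add: inner_eq smult_sgn M.sgn_add_add M.sgn_add_finsum M.finsum_closed
        del: add_Suc_right)
qed

lemma inner_zero:
  assumes "length as = Suc n" "set as \<subseteq> carrier A"
  shows "inner_differential A M (\<lambda>_. \<zero>\<^bsub>M\<^esub>) as = \<zero>\<^bsub>M\<^esub>"
proof -
  have "fun_on A M n (\<lambda>_. \<zero>\<^bsub>M\<^esub>)" by (simp add: fun_on_def)
  then show ?thesis using assms hd_tl_closed[of as n] by (simp add: inner_eq M.finsum_zero)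
qed

lemma inner_finsum:
  assumes "\<And>j. j \<in> B \<Longrightarrow> fun_on A M n (\<phi> j)" "length as = Suc n" "set as \<subseteq> carrier A"
  shows "inner_differential A M (\<lambda>bs. \<Oplus>\<^bsub>M\<^esub>j\<in>B. \<phi> j bs) as
    = (\<Oplus>\<^bsub>M\<^esub>j\<in>B. inner_differential A M (\<phi> j) as)"
  using assms(1)
proof (induction B rule: infinite_finite_induct)
  case (insert x F)
  have fin: "(\<Oplus>\<^bsub>M\<^esub>j\<in>insert x F. \<phi> j bs) = \<phi> x bs \<oplus>\<^bsub>M\<^esub> (\<Oplus>\<^bsub>M\<^esub>j\<in>F. \<phi> j bs)"
    if "length bs = n" "set bs \<subseteq> carrier A" for bs
    using insert.hyps that fun_onD[OF insert.prems] by (subst M.finsum_insert) (auto simp: Pi_iff)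
  have F: "fun_on A M n (\<lambda>bs. \<Oplus>\<^bsub>M\<^esub>j\<in>F. \<phi> j bs)"
    using insert by (auto simp: fun_on_def intro!: M.finsum_closed)
  have "inner_differential A M (\<lambda>bs. \<Oplus>\<^bsub>M\<^esub>j\<in>insert x F. \<phi> j bs) as
    = inner_differential A M (\<lambda>bs. \<phi> x bs \<oplus>\<^bsub>M\<^esub> (\<Oplus>\<^bsub>M\<^esub>j\<in>F. \<phi> j bs)) as"
    using assms(2,3) insert.prems by (intro inner_cong[of n, OF fin])
      (auto simp: fun_on_def intro!: M.finsum_closed)
  also have "\<dots> = inner_differential A M (\<phi> x) as \<oplus>\<^bsub>M\<^esub> inner_differential A M (\<lambda>bs. \<Oplus>\<^bsub>M\<^esub>j\<in>F. \<phi> j bs) as"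
    using assms(2,3) insert.prems F by (intro inner_add[of n]) auto
  also have "\<dots> = (\<Oplus>\<^bsub>M\<^esub>j\<in>insert x F. inner_differential A M (\<phi> j) as)"
    using insert assms(2,3) by (subst M.finsum_insert) (auto simp: Pi_iff)
  finally show ?case .
qed (simp_all add: inner_zero[OF assms(2,3)])

text \<open>
  In the cochains constructed below, the last entry of the bar depends on the module argument, as a
  coordinate of it or through a defect. So the contraction that involves this entry is separated from
  those that ignore it.
\<close>

lemma inner_snoc:
  assumes "fun_on A M (Suc n) \<phi>" "length as = Suc n" "set as \<subseteq> carrier A" "x \<in> carrier A"
  shows "inner_differential A M \<phi> (as @ [x]) = inner_differential A M (\<lambda>bs. \<phi> (bs @ [x])) as
    \<oplus>\<^bsub>M\<^esub> sgn_add M (Suc n) (\<phi> (butlast as @ [last as \<otimes> x]))"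
proof -
  let ?t = "\<lambda>as i. take i as @ (as ! i \<otimes>\<^bsub>A\<^esub> as ! (i + 1)) # drop (i + 2) as"
  have ne: "as \<noteq> []" using assms(2) by auto
  have 1: "fun_on A M n (\<lambda>bs. \<phi> (bs @ [x]))"
    using assms by (auto simp: fun_on_def)
  have t: "?t (as @ [x]) i = ?t as i @ [x]" if "i < n" for i
    using that assms(2) by (simp add: nth_append)
  have last: "?t (as @ [x]) n = butlast as @ [last as \<otimes> x]"
    using assms(2) ne by (simp add: nth_append butlast_conv_take last_conv_nth)
  have c: "fun_on A M (Suc n) \<phi>" "length (as @ [x]) = Suc (Suc n)" "set (as @ [x]) \<subseteq> carrier A"
    using assms by auto
  note c' = contract_fun_on[OF c]
  have lc: "sgn_add M (Suc n) (\<phi> (butlast as @ [last as \<otimes> x])) \<in> carrier M"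
    using c'(4)[of n] last by simp
  have "(\<Oplus>\<^bsub>M\<^esub>i\<in>{..<Suc n}. sgn_add M (i + 1) (\<phi> (?t (as @ [x]) i)))
    = sgn_add M (n + 1) (\<phi> (?t (as @ [x]) n)) \<oplus>\<^bsub>M\<^esub> (\<Oplus>\<^bsub>M\<^esub>i\<in>{..<n}. sgn_add M (i + 1) (\<phi> (?t (as @ [x]) i)))"
    unfolding lessThan_Suc using c' by (intro M.finsum_insert) auto
  also have "(\<Oplus>\<^bsub>M\<^esub>i\<in>{..<n}. sgn_add M (i + 1) (\<phi> (?t (as @ [x]) i)))
    = (\<Oplus>\<^bsub>M\<^esub>i\<in>{..<n}. sgn_add M (i + 1) (\<phi> (?t as i @ [x])))"
    using contract_fun_on(1)[OF 1 assms(2,3)] t by (intro M.finsum_cong') auto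
  finally show ?thesis
    using ne lc contract_fun_on[OF 1 assms(2,3)]
    unfolding inner_eq[OF c] inner_eq[OF 1 assms(2,3)] last
    by (simp add: M.a_ac M.finsum_closed)
qed

end

lemma bar_differential_inner:
  assumes "abelian_group N" "f (butlast as) (last as \<odot>\<^bsub>M\<^esub> m) \<in> carrier N"
  shows "bar_differential A M N f as m = inner_differential A N (\<lambda>bs. f bs m) as
    \<oplus>\<^bsub>N\<^esub> sgn_add N (length as) (f (butlast as) (last as \<odot>\<^bsub>M\<^esub> m))"
  unfolding bar_differential_def inner_differential_def
  using abelian_group.add_pow_sgn[OF assms] by simp

section \<open>Cochains\<close>

lemma bar_cochain_closed:
  "f \<in> bar_cochains A M N n d \<Longrightarrow> length as = n \<Longrightarrow> set as \<subseteq> carrier A \<Longrightarrow> m \<in> carrier M \<Longrightarrow>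
    f as m \<in> carrier N"
  by (simp add: bar_cochains_def)

lemma bar_cochain_add:
  "f \<in> bar_cochains A M N n d \<Longrightarrow> length as + 1 + length bs = n \<Longrightarrow> set as \<subseteq> carrier A \<Longrightarrow>
    set bs \<subseteq> carrier A \<Longrightarrow> x \<in> carrier A \<Longrightarrow> y \<in> carrier A \<Longrightarrow> m \<in> carrier M \<Longrightarrow>
    f (as @ (x \<oplus>\<^bsub>A\<^esub> y) # bs) m = f (as @ x # bs) m \<oplus>\<^bsub>N\<^esub> f (as @ y # bs) m"
  by (simp add: bar_cochains_def)

lemma bar_cochain_emb:
  "f \<in> bar_cochains A M N n d \<Longrightarrow> length as + 1 + length bs = n \<Longrightarrow> set as \<subseteq> carrier A \<Longrightarrow>
    set bs \<subseteq> carrier A \<Longrightarrow> x \<in> carrier A \<Longrightarrow> m \<in> carrier M \<Longrightarrow>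
    f (as @ (emb A c \<otimes>\<^bsub>A\<^esub> x) # bs) m = emb A c \<odot>\<^bsub>N\<^esub> f (as @ x # bs) m"
  by (simp add: bar_cochains_def)

lemma bar_cochain_add_module:
  "f \<in> bar_cochains A M N n d \<Longrightarrow> length as = n \<Longrightarrow> set as \<subseteq> carrier A \<Longrightarrow>
    m \<in> carrier M \<Longrightarrow> m' \<in> carrier M \<Longrightarrow> f as (m \<oplus>\<^bsub>M\<^esub> m') = f as m \<oplus>\<^bsub>N\<^esub> f as m'"
  by (simp add: bar_cochains_def)

lemma bar_cochain_emb_module:
  "f \<in> bar_cochains A M N n d \<Longrightarrow> length as = n \<Longrightarrow> set as \<subseteq> carrier A \<Longrightarrow>
    m \<in> carrier M \<Longrightarrow> f as (emb A c \<odot>\<^bsub>M\<^esub> m) = emb A c \<odot>\<^bsub>N\<^esub> f as m"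
  by (simp add: bar_cochains_def)

lemma bar_cochain_degree:
  "f \<in> bar_cochains A M N n d \<Longrightarrow> length as = n \<Longrightarrow> list_all2 (\<lambda>a k. a \<in> hpart A k) as ds \<Longrightarrow>
    m \<in> mpart M e \<Longrightarrow> f as m \<in> int_part N (int (sum_list ds + e) - d)"
  by (auto simp: bar_cochains_def int_part_def Let_def)

lemma bar_cochainI:
  assumes "\<And>as m. length as = n \<Longrightarrow> set as \<subseteq> carrier A \<Longrightarrow> m \<in> carrier M \<Longrightarrow> f as m \<in> carrier N"
    and "\<And>as x y bs m. length as + 1 + length bs = n \<Longrightarrow> set as \<subseteq> carrier A \<Longrightarrow>
      set bs \<subseteq> carrier A \<Longrightarrow> x \<in> carrier A \<Longrightarrow> y \<in> carrier A \<Longrightarrow> m \<in> carrier M \<Longrightarrow>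
      f (as @ (x \<oplus>\<^bsub>A\<^esub> y) # bs) m = f (as @ x # bs) m \<oplus>\<^bsub>N\<^esub> f (as @ y # bs) m"
    and "\<And>as c x bs m. length as + 1 + length bs = n \<Longrightarrow> set as \<subseteq> carrier A \<Longrightarrow>
      set bs \<subseteq> carrier A \<Longrightarrow> x \<in> carrier A \<Longrightarrow> m \<in> carrier M \<Longrightarrow>
      f (as @ (emb A c \<otimes>\<^bsub>A\<^esub> x) # bs) m = emb A c \<odot>\<^bsub>N\<^esub> f (as @ x # bs) m"
    and "\<And>as m m'. length as = n \<Longrightarrow> set as \<subseteq> carrier A \<Longrightarrow>
      m \<in> carrier M \<Longrightarrow> m' \<in> carrier M \<Longrightarrow> f as (m \<oplus>\<^bsub>M\<^esub> m') = f as m \<oplus>\<^bsub>N\<^esub> f as m'"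
    and "\<And>as c m. length as = n \<Longrightarrow> set as \<subseteq> carrier A \<Longrightarrow>
      m \<in> carrier M \<Longrightarrow> f as (emb A c \<odot>\<^bsub>M\<^esub> m) = emb A c \<odot>\<^bsub>N\<^esub> f as m"
    and "\<And>as ds m e. length as = n \<Longrightarrow> list_all2 (\<lambda>a k. a \<in> hpart A k) as ds \<Longrightarrow>
      m \<in> mpart M e \<Longrightarrow> f as m \<in> int_part N (int (sum_list ds + e) - d)"
  shows "f \<in> bar_cochains A M N n d"
  using assms unfolding bar_cochains_def int_part_def Let_def by auto

lemma bar_cochain_fun_on:
  "f \<in> bar_cochains A M N n d \<Longrightarrow> m \<in> carrier M \<Longrightarrow> fun_on A N n (\<lambda>bs. f bs m)"
  by (simp add: fun_on_def bar_cochain_closed)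

lemma (in graded_ring) homogeneous_list_closed:
  "list_all2 (\<lambda>a k. a \<in> hpart A k) as ds \<Longrightarrow> set as \<subseteq> carrier A"
  by (induction rule: list_all2_induct) (auto simp: hpart_closed)

lemma (in abelian_group) add_cancel_middle:
  assumes "i \<in> carrier G" "u \<in> carrier G" "w \<in> carrier G"
  shows "i \<oplus> (u \<oplus> w) \<oplus> \<ominus> u = i \<oplus> w"
proof -
  have "i \<oplus> (u \<oplus> w) \<oplus> \<ominus> u = i \<oplus> w \<oplus> (u \<oplus> \<ominus> u)"
    using assms by (simp add: a_ac)
  then show ?thesis using assms by (simp add: r_neg)
qed

lemma length_append_last: "length as = Suc n \<Longrightarrow> \<exists>bs x. as = bs @ [x] \<and> length bs = n"
  by (cases as rule: rev_cases) auto

lemma bar_differential_eq: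
  assumes "graded_left_module A M" "graded_left_module A N"
    and "\<And>as m. length as = n \<Longrightarrow> set as \<subseteq> carrier A \<Longrightarrow> m \<in> carrier M \<Longrightarrow> f as m \<in> carrier N"
    and "length bs = n" "set bs \<subseteq> carrier A" "a \<in> carrier A" "m \<in> carrier M"
  shows "bar_differential A M N f (bs @ [a]) m = inner_differential A N (\<lambda>cs. f cs m) (bs @ [a])
    \<oplus>\<^bsub>N\<^esub> sgn_add N (Suc n) (f bs (a \<odot>\<^bsub>M\<^esub> m))"
proof -
  interpret M: graded_left_module A M by fact
  interpret N: graded_left_module A N by fact
  show ?thesis
    using assms bar_differential_inner[of N f "bs @ [a]" M m A] N.M.abelian_group_axioms by auto
qed

section \<open>Modules with a dual basis\<close>

text \<open>
  The dual basis criterion for a finitely generated projective graded module: \<open>bas j\<close> are homogeneous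
  generators and the coordinates \<open>crd j\<close> are linear over the algebra.
\<close>

definition dual_basis ::
  "('a, 'k, 'v) graded_algebra \<Rightarrow> ('a, 'f) graded_module \<Rightarrow> 'i set \<Rightarrow> ('i \<Rightarrow> nat) \<Rightarrow> ('i \<Rightarrow> 'f)
    \<Rightarrow> ('i \<Rightarrow> 'f \<Rightarrow> 'a) \<Rightarrow> bool" where
  "dual_basis A F B wt bas crd \<longleftrightarrow> finite B \<and>
    (\<forall>j\<in>B. bas j \<in> mpart F (wt j)) \<and>
    (\<forall>j\<in>B. \<forall>x\<in>carrier F. crd j x \<in> carrier A) \<and>
    (\<forall>j\<in>B. \<forall>x\<in>carrier F. \<forall>y\<in>carrier F. crd j (x \<oplus>\<^bsub>F\<^esub> y) = crd j x \<oplus>\<^bsub>A\<^esub> crd j y) \<and>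
    (\<forall>j\<in>B. \<forall>a\<in>carrier A. \<forall>x\<in>carrier F. crd j (a \<odot>\<^bsub>F\<^esub> x) = a \<otimes>\<^bsub>A\<^esub> crd j x) \<and>
    (\<forall>j\<in>B. \<forall>d. \<forall>x\<in>mpart F d. if wt j \<le> d then crd j x \<in> hpart A (d - wt j) else crd j x = \<zero>\<^bsub>A\<^esub>) \<and>
    (\<forall>x\<in>carrier F. x = (\<Oplus>\<^bsub>F\<^esub>j\<in>B. crd j x \<odot>\<^bsub>F\<^esub> bas j))"

locale projective_module = F: graded_left_module A F + N: graded_left_module A N
  for A :: "('a, 'k::field, 'v) graded_algebra" (structure)
    and F :: "('a, 'f) graded_module" and N :: "('a, 'n) graded_module" +
  fixes B :: "'i set" and wt :: "'i \<Rightarrow> nat" and bas :: "'i \<Rightarrow> 'f" and crd :: "'i \<Rightarrow> 'f \<Rightarrow> 'a"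
  assumes dual_basis: "dual_basis A F B wt bas crd"
begin

lemma bas_mpart: "j \<in> B \<Longrightarrow> bas j \<in> mpart F (wt j)"
  and crd_closed: "j \<in> B \<Longrightarrow> x \<in> carrier F \<Longrightarrow> crd j x \<in> carrier A"
  and crd_add: "j \<in> B \<Longrightarrow> x \<in> carrier F \<Longrightarrow> y \<in> carrier F \<Longrightarrow> crd j (x \<oplus>\<^bsub>F\<^esub> y) = crd j x \<oplus> crd j y"
  and crd_smult: "j \<in> B \<Longrightarrow> a \<in> carrier A \<Longrightarrow> x \<in> carrier F \<Longrightarrow> crd j (a \<odot>\<^bsub>F\<^esub> x) = a \<otimes> crd j x"
  and crd_degree: "j \<in> B \<Longrightarrow> x \<in> mpart F d \<Longrightarrow> wt j \<le> d \<Longrightarrow> crd j x \<in> hpart A (d - wt j)"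
  and crd_low: "j \<in> B \<Longrightarrow> x \<in> mpart F d \<Longrightarrow> \<not> wt j \<le> d \<Longrightarrow> crd j x = \<zero>"
  and basis_expansion: "x \<in> carrier F \<Longrightarrow> (\<Oplus>\<^bsub>F\<^esub>j\<in>B. crd j x \<odot>\<^bsub>F\<^esub> bas j) = x"
  using dual_basis unfolding dual_basis_def by metis+

lemma bas_closed: "j \<in> B \<Longrightarrow> bas j \<in> carrier F"
  using bas_mpart F.mpart_closed by blast

text \<open>
  The contracting homotopy of the cochains on a projective module: up to a sign, the coordinate of the module argument
  is moved into the last slot of the bar.
\<close>

definition lift :: "nat \<Rightarrow> ('a list \<Rightarrow> 'f \<Rightarrow> 'n) \<Rightarrow> 'a list \<Rightarrow> 'f \<Rightarrow> 'n" where
  "lift n f as x = sgn_add N (Suc n) (\<Oplus>\<^bsub>N\<^esub>j\<in>B. f (as @ [crd j x]) (bas j))"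

lemma lift_terms:
  assumes "f \<in> bar_cochains A F N (Suc n) d" "length as = n" "set as \<subseteq> carrier A" "x \<in> carrier F"
  shows "(\<lambda>j. f (as @ [crd j x]) (bas j)) \<in> B \<rightarrow> carrier N"
  using assms by (auto intro!: bar_cochain_closed[OF assms(1)] simp: crd_closed bas_closed)

lemma lift_cochain:
  assumes f: "f \<in> bar_cochains A F N (Suc n) d"
  shows "lift n f \<in> bar_cochains A F N n d"
proof (rule bar_cochainI)
  fix as m assume "length as = n" "set as \<subseteq> carrier A" "m \<in> carrier F"
  then show "lift n f as m \<in> carrier N"
    unfolding lift_def by (intro N.M.sgn_add_closed N.M.finsum_closed lift_terms[OF f])
next
  fix as x y bs m
  assume *: "length as + 1 + length bs = n" "set as \<subseteq> carrier A" "set bs \<subseteq> carrier A"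
    "x \<in> carrier A" "y \<in> carrier A" "m \<in> carrier F"
  have t: "(\<lambda>j. f ((as @ z # bs) @ [crd j m]) (bas j)) \<in> B \<rightarrow> carrier N" if "z \<in> carrier A" for z
    using * that by (intro lift_terms[OF f]) auto
  have "(\<Oplus>\<^bsub>N\<^esub>j\<in>B. f ((as @ (x \<oplus> y) # bs) @ [crd j m]) (bas j))
    = (\<Oplus>\<^bsub>N\<^esub>j\<in>B. f ((as @ x # bs) @ [crd j m]) (bas j) \<oplus>\<^bsub>N\<^esub> f ((as @ y # bs) @ [crd j m]) (bas j))"
    using * t by (intro N.M.finsum_cong')
      (auto simp: Pi_iff crd_closed bas_closed intro!: bar_cochain_add[OF f, of _ "_ @ [_]", simplified])
  also have "\<dots> = (\<Oplus>\<^bsub>N\<^esub>j\<in>B. f ((as @ x # bs) @ [crd j m]) (bas j))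
      \<oplus>\<^bsub>N\<^esub> (\<Oplus>\<^bsub>N\<^esub>j\<in>B. f ((as @ y # bs) @ [crd j m]) (bas j))"
    using t * by (intro N.M.finsum_addf) auto
  finally show "lift n f (as @ (x \<oplus> y) # bs) m = lift n f (as @ x # bs) m \<oplus>\<^bsub>N\<^esub> lift n f (as @ y # bs) m"
    unfolding lift_def using t[OF *(4)] t[OF *(5)] by (simp only: N.M.sgn_add_add N.M.finsum_closed)
next
  fix as c x bs m
  assume *: "length as + 1 + length bs = n" "set as \<subseteq> carrier A" "set bs \<subseteq> carrier A"
    "x \<in> carrier A" "m \<in> carrier F"
  have t: "(\<lambda>j. f ((as @ z # bs) @ [crd j m]) (bas j)) \<in> B \<rightarrow> carrier N" if "z \<in> carrier A" for z
    using * that by (intro lift_terms[OF f]) auto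
  have "(\<Oplus>\<^bsub>N\<^esub>j\<in>B. f ((as @ (emb A c \<otimes> x) # bs) @ [crd j m]) (bas j))
    = (\<Oplus>\<^bsub>N\<^esub>j\<in>B. emb A c \<odot>\<^bsub>N\<^esub> f ((as @ x # bs) @ [crd j m]) (bas j))"
    using * t by (intro N.M.finsum_cong')
      (auto simp: Pi_iff crd_closed bas_closed intro!: bar_cochain_emb[OF f, of _ "_ @ [_]", simplified])
  also have "\<dots> = emb A c \<odot>\<^bsub>N\<^esub> (\<Oplus>\<^bsub>N\<^esub>j\<in>B. f ((as @ x # bs) @ [crd j m]) (bas j))"
    using t * by (intro N.smult_finsum[symmetric]) auto
  finally show "lift n f (as @ (emb A c \<otimes> x) # bs) m = emb A c \<odot>\<^bsub>N\<^esub> lift n f (as @ x # bs) m"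
    unfolding lift_def using t[OF *(4)] by (simp only: N.smult_sgn N.M.finsum_closed F.emb_closed)
next
  fix as x y assume *: "length as = n" "set as \<subseteq> carrier A" "x \<in> carrier F" "y \<in> carrier F"
  note t = lift_terms[OF f *(1,2)]
  have "(\<Oplus>\<^bsub>N\<^esub>j\<in>B. f (as @ [crd j (x \<oplus>\<^bsub>F\<^esub> y)]) (bas j))
    = (\<Oplus>\<^bsub>N\<^esub>j\<in>B. f (as @ [crd j x]) (bas j) \<oplus>\<^bsub>N\<^esub> f (as @ [crd j y]) (bas j))"
    using * t[OF *(3)] t[OF *(4)] by (intro N.M.finsum_cong')
      (auto simp: Pi_iff crd_closed bas_closed crd_add intro!: bar_cochain_add[OF f, of _ "[]"])
  also have "\<dots> = (\<Oplus>\<^bsub>N\<^esub>j\<in>B. f (as @ [crd j x]) (bas j)) \<oplus>\<^bsub>N\<^esub> (\<Oplus>\<^bsub>N\<^esub>j\<in>B. f (as @ [crd j y]) (bas j))"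
    using t * by (intro N.M.finsum_addf) auto
  finally show "lift n f as (x \<oplus>\<^bsub>F\<^esub> y) = lift n f as x \<oplus>\<^bsub>N\<^esub> lift n f as y"
    unfolding lift_def using t[OF *(3)] t[OF *(4)] by (simp only: N.M.sgn_add_add N.M.finsum_closed)
next
  fix as c x assume *: "length as = n" "set as \<subseteq> carrier A" "x \<in> carrier F"
  note t = lift_terms[OF f *(1,2)]
  have "(\<Oplus>\<^bsub>N\<^esub>j\<in>B. f (as @ [crd j (emb A c \<odot>\<^bsub>F\<^esub> x)]) (bas j))
    = (\<Oplus>\<^bsub>N\<^esub>j\<in>B. emb A c \<odot>\<^bsub>N\<^esub> f (as @ [crd j x]) (bas j))"
    using * t[OF *(3)] by (intro N.M.finsum_cong')
      (auto simp: Pi_iff crd_closed bas_closed crd_smult intro!: bar_cochain_emb[OF f, of _ "[]"])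
  also have "\<dots> = emb A c \<odot>\<^bsub>N\<^esub> (\<Oplus>\<^bsub>N\<^esub>j\<in>B. f (as @ [crd j x]) (bas j))"
    using t * by (intro N.smult_finsum[symmetric]) auto
  finally show "lift n f as (emb A c \<odot>\<^bsub>F\<^esub> x) = emb A c \<odot>\<^bsub>N\<^esub> lift n f as x"
    unfolding lift_def using t[OF *(3)] by (simp only: N.smult_sgn N.M.finsum_closed F.emb_closed)
next
  fix as ds x e
  assume *: "length as = n" "list_all2 (\<lambda>a k. a \<in> hpart A k) as ds" "x \<in> mpart F e"
  have as: "set as \<subseteq> carrier A" using *(2) F.homogeneous_list_closed by blast
  have "f (as @ [crd j x]) (bas j) \<in> int_part N (int (sum_list ds + e) - d)" if j: "j \<in> B" for j
  proof (cases "wt j \<le> e")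
    case True
    then show ?thesis
      using bar_cochain_degree[OF f, of "as @ [crd j x]" "ds @ [e - wt j]" "bas j" "wt j"] *
        crd_degree[OF j *(3)] bas_mpart[OF j] by (auto simp: list_all2_appendI)
  next
    case False
    have "f (as @ [\<zero>]) (bas j) = \<zero>\<^bsub>N\<^esub>"
      using additive_zero[of A N "\<lambda>y. f (as @ [y]) (bas j)"] bar_cochain_add[OF f, of as "[]" _ _ "bas j"]
        bar_cochain_closed[OF f, of "as @ [_]" "bas j"] *(1) as bas_closed[OF j]
        F.abelian_group_axioms N.M.abelian_group_axioms by auto
    then show ?thesis
      using False crd_low[OF j *(3)] by (simp add: N.int_part_zero)
  qed
  then show "lift n f as x \<in> int_part N (int (sum_list ds + e) - d)"
    unfolding lift_def by (intro N.int_part_sgn N.int_part_finsum)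
qed

text \<open>
  The cocycle condition for \<open>f\<close> on the arguments \<open>as @ [crd j x]\<close> and \<open>bas j\<close> expresses
  \<open>f as (crd j x \<odot> bas j)\<close> by the terms of the differential of \<open>lift n f\<close>; summing over \<open>j\<close> gives \<open>f as x\<close>.
\<close>

lemma lift_differential:
  assumes f: "f \<in> bar_cocycles A F N (Suc n) d"
    and as: "length as = Suc n" "set as \<subseteq> carrier A" and x: "x \<in> carrier F"
  shows "bar_differential A F N (lift n f) as x = f as x"
proof -
  have fc: "f \<in> bar_cochains A F N (Suc n) d" using f by (simp add: bar_cocycles_def)
  obtain bs a where bs: "as = bs @ [a]" "length bs = n" "set bs \<subseteq> carrier A" "a \<in> carrier A"
    using length_append_last[OF as(1)] as(2) by auto
  define T where "T j = inner_differential A N (\<lambda>cs. f (cs @ [crd j x]) (bas j)) as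
      \<oplus>\<^bsub>N\<^esub> sgn_add N (Suc n) (f (bs @ [a \<otimes> crd j x]) (bas j))" for j
  have fo: "fun_on A N n (\<lambda>cs. f (cs @ [crd j x]) (bas j))" if "j \<in> B" for j
    using bar_cochain_closed[OF fc] that x by (auto simp: fun_on_def crd_closed bas_closed)
  have inn: "inner_differential A N (\<lambda>cs. f (cs @ [crd j x]) (bas j)) as \<in> carrier N" if "j \<in> B" for j
    using fo[OF that] as by (rule N.inner_closed)
  have fa: "f (bs @ [a \<otimes> crd j x]) (bas j) \<in> carrier N" if "j \<in> B" for j
    using that x bs by (intro bar_cochain_closed[OF fc]) (auto simp: crd_closed bas_closed)
  have fx: "f as (crd j x \<odot>\<^bsub>F\<^esub> bas j) \<in> carrier N" if "j \<in> B" for j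
    using that x as by (intro bar_cochain_closed[OF fc]) (auto simp: crd_closed bas_closed)
  have T: "T j = sgn_add N (Suc n) (f as (crd j x \<odot>\<^bsub>F\<^esub> bas j))" if j: "j \<in> B" for j
  proof -
    have "\<zero>\<^bsub>N\<^esub> = bar_differential A F N f (as @ [crd j x]) (bas j)"
      using f as x j by (auto simp: bar_cocycles_def crd_closed bas_closed)
    also have "\<dots> = inner_differential A N (\<lambda>cs. f cs (bas j)) (as @ [crd j x])
        \<oplus>\<^bsub>N\<^esub> sgn_add N (Suc (Suc n)) (f as (crd j x \<odot>\<^bsub>F\<^esub> bas j))"
      using as x j bar_cochain_closed[OF fc] crd_closed bas_closed
      by (intro bar_differential_eq[OF F.graded_left_module_axioms N.graded_left_module_axioms]) auto
    also have "inner_differential A N (\<lambda>cs. f cs (bas j)) (as @ [crd j x]) = T j"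
      using N.inner_snoc[OF bar_cochain_fun_on[OF fc] as, of "bas j" "crd j x"] j x bs
      by (simp add: T_def crd_closed bas_closed)
    finally have "T j \<oplus>\<^bsub>N\<^esub> sgn_add N (Suc (Suc n)) (f as (crd j x \<odot>\<^bsub>F\<^esub> bas j)) = \<zero>\<^bsub>N\<^esub>" by simp
    moreover have "T j \<in> carrier N" using j inn fa by (simp add: T_def)
    ultimately have "T j = \<ominus>\<^bsub>N\<^esub> sgn_add N (Suc (Suc n)) (f as (crd j x \<odot>\<^bsub>F\<^esub> bas j))"
      using N.M.minus_equality fx[OF j] by (metis N.M.sgn_add_closed)
    then show ?thesis using fx[OF j] by (simp add: sgn_add_def)
  qed
  have "bar_differential A F N (lift n f) as x = inner_differential A N (\<lambda>cs. lift n f cs x) as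
      \<oplus>\<^bsub>N\<^esub> sgn_add N (Suc n) (lift n f bs (a \<odot>\<^bsub>F\<^esub> x))"
    unfolding bs(1) using bs x bar_cochain_closed[OF lift_cochain[OF fc]]
    by (intro bar_differential_eq[OF F.graded_left_module_axioms N.graded_left_module_axioms]) auto
  also have "inner_differential A N (\<lambda>cs. lift n f cs x) as
      = sgn_add N (Suc n) (inner_differential A N (\<lambda>cs. \<Oplus>\<^bsub>N\<^esub>j\<in>B. f (cs @ [crd j x]) (bas j)) as)"
    unfolding lift_def using lift_terms[OF fc _ _ x] as
    by (intro N.inner_sgn) (auto simp: fun_on_def intro!: N.M.finsum_closed)
  also have "inner_differential A N (\<lambda>cs. \<Oplus>\<^bsub>N\<^esub>j\<in>B. f (cs @ [crd j x]) (bas j)) as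
      = (\<Oplus>\<^bsub>N\<^esub>j\<in>B. inner_differential A N (\<lambda>cs. f (cs @ [crd j x]) (bas j)) as)"
    using fo as by (intro N.inner_finsum) auto
  also have "lift n f bs (a \<odot>\<^bsub>F\<^esub> x)
      = (\<Oplus>\<^bsub>N\<^esub>j\<in>B. sgn_add N (Suc n) (f (bs @ [a \<otimes> crd j x]) (bas j)))"
    using fa bs x unfolding lift_def
    by (subst N.M.sgn_add_finsum) (auto simp: crd_smult intro!: N.M.finsum_cong')
  also have "sgn_add N (Suc n) (\<Oplus>\<^bsub>N\<^esub>j\<in>B. inner_differential A N (\<lambda>cs. f (cs @ [crd j x]) (bas j)) as)
      \<oplus>\<^bsub>N\<^esub> sgn_add N (Suc n) (\<Oplus>\<^bsub>N\<^esub>j\<in>B. sgn_add N (Suc n) (f (bs @ [a \<otimes> crd j x]) (bas j)))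
      = sgn_add N (Suc n) (\<Oplus>\<^bsub>N\<^esub>j\<in>B. T j)"
    unfolding T_def using inn fa
    by (subst N.M.finsum_addf) (auto simp: N.M.sgn_add_add N.M.finsum_closed)
  also have "(\<Oplus>\<^bsub>N\<^esub>j\<in>B. T j) = (\<Oplus>\<^bsub>N\<^esub>j\<in>B. sgn_add N (Suc n) (f as (crd j x \<odot>\<^bsub>F\<^esub> bas j)))"
    using T fx by (intro N.M.finsum_cong') auto
  also have "\<dots> = sgn_add N (Suc n) (\<Oplus>\<^bsub>N\<^esub>j\<in>B. f as (crd j x \<odot>\<^bsub>F\<^esub> bas j))"
    using fx by (intro N.M.sgn_add_finsum[symmetric]) auto
  also have "(\<Oplus>\<^bsub>N\<^esub>j\<in>B. f as (crd j x \<odot>\<^bsub>F\<^esub> bas j)) = f as (\<Oplus>\<^bsub>F\<^esub>j\<in>B. crd j x \<odot>\<^bsub>F\<^esub> bas j)"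
    using as x bar_cochain_closed[OF fc as] bar_cochain_add_module[OF fc as]
      F.M.abelian_group_axioms N.M.abelian_group_axioms
    by (intro additive_finsum[symmetric]) (auto simp: crd_closed bas_closed)
  also have "\<dots> = f as x" using basis_expansion[OF x] by simp
  finally show ?thesis using bar_cochain_closed[OF fc as x] by simp
qed

lemma Ext_projective: "Ext_component_zero A F N (Suc n) d"
  unfolding Ext_component_zero_def
proof
  fix f assume f: "f \<in> bar_cocycles A F N (Suc n) d"
  then have "f \<in> bar_cochains A F N (Suc n) d" by (simp add: bar_cocycles_def)
  then show "f \<in> bar_coboundaries A F N (Suc n) d"
    using lift_cochain lift_differential[OF f] by (auto simp: bar_coboundaries_def intro!: bexI[of _ "lift n f"])
qed

end

section \<open>Vanishing in degree zero\<close>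

text \<open>
  A cocycle of degree zero is a homomorphism. It sends generators of degree \<open>e\<close> into the component of
  degree \<open>e - d\<close>, which is zero when \<open>N\<close> lives in degree zero only.
\<close>

lemma Ext_zero_degree:
  assumes "graded_left_module A M" "graded_left_module A N"
    and B: "\<And>j. j \<in> B \<Longrightarrow> bas j \<in> mpart M e"
    and gen: "\<And>x. x \<in> carrier M \<Longrightarrow>
      \<exists>c. (\<forall>j\<in>B. c j \<in> carrier A) \<and> x = (\<Oplus>\<^bsub>M\<^esub>j\<in>B. c j \<odot>\<^bsub>M\<^esub> bas j)"
    and N: "\<And>s. s \<noteq> 0 \<Longrightarrow> mpart N s = {\<zero>\<^bsub>N\<^esub>}" and d: "d \<noteq> int e"
  shows "Ext_component_zero A M N 0 d"
  unfolding Ext_component_zero_def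
proof
  interpret M: graded_left_module A M by fact
  interpret N: graded_left_module A N by fact
  fix f assume f: "f \<in> bar_cocycles A M N 0 d"
  then have fc: "f \<in> bar_cochains A M N 0 d" by (simp add: bar_cocycles_def)
  have bc: "bas j \<in> carrier M" if "j \<in> B" for j using B[OF that] M.mpart_closed by blast
  have f0: "f [] (bas j) = \<zero>\<^bsub>N\<^esub>" if "j \<in> B" for j
    using bar_cochain_degree[OF fc, of "[]" "[]" "bas j" e] B[OF that] N[of "nat (int e - d)"] d
    by (auto simp: int_part_def split: if_splits)
  have lin: "f [] (a \<odot>\<^bsub>M\<^esub> m) = a \<odot>\<^bsub>N\<^esub> f [] m" if "a \<in> carrier A" "m \<in> carrier M" for a m
  proof -
    have c: "f [] (a \<odot>\<^bsub>M\<^esub> m) \<in> carrier N" "f [] m \<in> carrier N"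
      using that by (auto intro!: bar_cochain_closed[OF fc])
    have "\<zero>\<^bsub>N\<^esub> = bar_differential A M N f [a] m"
      using f that by (simp add: bar_cocycles_def)
    also have "\<dots> = a \<odot>\<^bsub>N\<^esub> f [] m \<oplus>\<^bsub>N\<^esub> \<ominus>\<^bsub>N\<^esub> f [] (a \<odot>\<^bsub>M\<^esub> m)"
      using c that bar_differential_inner[of N f "[a]" M m A] N.M.abelian_group_axioms
      by (simp add: inner_differential_def sgn_add_def)
    finally have "a \<odot>\<^bsub>N\<^esub> f [] m \<oplus>\<^bsub>N\<^esub> \<ominus>\<^bsub>N\<^esub> f [] (a \<odot>\<^bsub>M\<^esub> m) = \<zero>\<^bsub>N\<^esub>" by simp
    then show ?thesis using c that N.M.minus_equality N.M.minus_minus by fastforce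
  qed
  have "f [] m = \<zero>\<^bsub>N\<^esub>" if m: "m \<in> carrier M" for m
  proof -
    obtain c where c: "\<forall>j\<in>B. c j \<in> carrier A" "m = (\<Oplus>\<^bsub>M\<^esub>j\<in>B. c j \<odot>\<^bsub>M\<^esub> bas j)"
      using gen[OF m] by blast
    have "f [] m = (\<Oplus>\<^bsub>N\<^esub>j\<in>B. f [] (c j \<odot>\<^bsub>M\<^esub> bas j))"
      unfolding c(2)
      using c bc bar_cochain_closed[OF fc] bar_cochain_add_module[OF fc]
        M.M.abelian_group_axioms N.M.abelian_group_axioms
      by (intro additive_finsum) auto
    also have "\<dots> = (\<Oplus>\<^bsub>N\<^esub>j\<in>B. \<zero>\<^bsub>N\<^esub>)"
      using c bc lin f0 by (intro N.M.finsum_cong') auto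
    finally show ?thesis by simp
  qed
  then show "f \<in> bar_coboundaries A M N 0 d" using fc by (simp add: bar_coboundaries_def)
qed

section \<open>Dimension shifting\<close>

definition submodule :: "('a, 'm) graded_module \<Rightarrow> 'm set \<Rightarrow> ('a, 'm) graded_module" where
  "submodule F S = F\<lparr>carrier := S, mpart := \<lambda>e. mpart F e \<inter> S\<rparr>"

lemma submodule_simps [simp]:
  "carrier (submodule F S) = S" "add (submodule F S) = add F" "zero (submodule F S) = zero F"
  "smult (submodule F S) = smult F" "mpart (submodule F S) e = mpart F e \<inter> S"
  by (simp_all add: submodule_def)

lemma (in graded_left_module) submodule_module:
  assumes S: "S \<subseteq> carrier M" "\<zero>\<^bsub>M\<^esub> \<in> S"
    and closed: "\<And>x y. x \<in> S \<Longrightarrow> y \<in> S \<Longrightarrow> x \<oplus>\<^bsub>M\<^esub> y \<in> S" "\<And>x. x \<in> S \<Longrightarrow> \<ominus>\<^bsub>M\<^esub> x \<in> S"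
      "\<And>a x. a \<in> carrier A \<Longrightarrow> x \<in> S \<Longrightarrow> a \<odot>\<^bsub>M\<^esub> x \<in> S"
  shows "graded_left_module A (submodule M S)"
proof -
  have ab: "abelian_group (submodule M S)"
  proof (rule abelian_groupI)
    fix x assume "x \<in> carrier (submodule M S)"
    then show "\<exists>y\<in>carrier (submodule M S). y \<oplus>\<^bsub>submodule M S\<^esub> x = \<zero>\<^bsub>submodule M S\<^esub>"
      using S closed M.l_neg[of x] by (intro bexI[of _ "\<ominus>\<^bsub>M\<^esub> x"]) auto
  qed (use S closed in \<open>auto simp: subset_iff M.a_ac\<close>)
  interpret S: abelian_group "submodule M S" by fact
  have minus: "\<ominus>\<^bsub>submodule M S\<^esub> x = \<ominus>\<^bsub>M\<^esub> x" if "x \<in> S" for x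
    using that S closed M.l_neg by (intro S.minus_equality) auto
  show ?thesis
    by (intro graded_left_module.intro graded_ring_axioms ab graded_left_module_axioms.intro)
      (use S closed mpart_add mpart_minus mpart_smult mpart_zero hpart_closed in
        \<open>auto simp: subset_iff smult_add_right smult_add_left smult_assoc minus\<close>)
qed

text \<open>
  An exact sequence of a projective module \<open>F\<close>, its quotient \<open>M\<close> and the kernel \<open>K\<close>. The section \<open>sec\<close> is linear
  over the field; over the algebra it usually is not.
\<close>

locale syzygy = projective_module A F N B wt bas crd + M: graded_left_module A M
  for A :: "('a, 'k::field, 'v) graded_algebra" (structure)
    and F :: "('a, 'f) graded_module" and N :: "('a, 'n) graded_module"
    and B :: "'i set" and wt :: "'i \<Rightarrow> nat" and bas :: "'i \<Rightarrow> 'f" and crd :: "'i \<Rightarrow> 'f \<Rightarrow> 'a"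
    and M :: "('a, 'm) graded_module" +
  fixes prj :: "'f \<Rightarrow> 'm" and sec :: "'m \<Rightarrow> 'f"
  assumes prj_closed: "x \<in> carrier F \<Longrightarrow> prj x \<in> carrier M"
    and prj_add: "x \<in> carrier F \<Longrightarrow> y \<in> carrier F \<Longrightarrow> prj (x \<oplus>\<^bsub>F\<^esub> y) = prj x \<oplus>\<^bsub>M\<^esub> prj y"
    and prj_smult: "a \<in> carrier A \<Longrightarrow> x \<in> carrier F \<Longrightarrow> prj (a \<odot>\<^bsub>F\<^esub> x) = a \<odot>\<^bsub>M\<^esub> prj x"
    and prj_mpart: "x \<in> mpart F e \<Longrightarrow> prj x \<in> mpart M e"
    and sec_closed: "m \<in> carrier M \<Longrightarrow> sec m \<in> carrier F"
    and sec_add: "m \<in> carrier M \<Longrightarrow> m' \<in> carrier M \<Longrightarrow> sec (m \<oplus>\<^bsub>M\<^esub> m') = sec m \<oplus>\<^bsub>F\<^esub> sec m'"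
    and sec_emb: "m \<in> carrier M \<Longrightarrow> sec (emb A c \<odot>\<^bsub>M\<^esub> m) = emb A c \<odot>\<^bsub>F\<^esub> sec m"
    and sec_mpart: "m \<in> mpart M e \<Longrightarrow> sec m \<in> mpart F e"
    and prj_sec: "m \<in> carrier M \<Longrightarrow> prj (sec m) = m"
begin

abbreviation K :: "('a, 'f) graded_module" where
  "K \<equiv> submodule F {x \<in> carrier F. prj x = \<zero>\<^bsub>M\<^esub>}"

lemma K_carrier: "carrier K = {x \<in> carrier F. prj x = \<zero>\<^bsub>M\<^esub>}"
  and K_ops: "add K = add F" "zero K = zero F" "smult K = smult F"
  and K_mpart: "mpart K e = mpart F e \<inter> carrier K"
  by (simp_all add: submodule_def)

lemma K_module: "graded_left_module A K"
  using additive_minus[of F M prj] additive_zero[of F M prj] F.M.abelian_group_axioms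
    M.M.abelian_group_axioms
  by (intro F.submodule_module) (auto simp: prj_add prj_smult prj_closed)

text \<open>
  The failure of the section to be linear over the algebra. It takes values in \<open>K\<close> and is a cocycle in
  the sense of \<open>defect_mult\<close>, hence it carries cochains on \<open>K\<close> to cochains on \<open>M\<close> of one degree more.
\<close>

definition defect :: "'a \<Rightarrow> 'm \<Rightarrow> 'f" where
  "defect a m = a \<odot>\<^bsub>F\<^esub> sec m \<ominus>\<^bsub>F\<^esub> sec (a \<odot>\<^bsub>M\<^esub> m)"

lemma defect_closed_F: "a \<in> carrier A \<Longrightarrow> m \<in> carrier M \<Longrightarrow> defect a m \<in> carrier F"
  by (simp add: defect_def sec_closed)

lemma defect_K: "a \<in> carrier A \<Longrightarrow> m \<in> carrier M \<Longrightarrow> defect a m \<in> carrier K"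
  using additive_minus[of F M prj "sec (a \<odot>\<^bsub>M\<^esub> m)"]
  by (simp add: K_carrier defect_closed_F)
    (simp add: defect_def a_minus_def prj_add prj_smult prj_sec sec_closed prj_closed
      F.M.abelian_group_axioms M.M.abelian_group_axioms M.M.r_neg)

lemma prj_defect: "a \<in> carrier A \<Longrightarrow> m \<in> carrier M \<Longrightarrow> prj (defect a m) = \<zero>\<^bsub>M\<^esub>"
  using defect_K by (simp add: K_carrier)

lemma smult_defect:
  "a \<in> carrier A \<Longrightarrow> m \<in> carrier M \<Longrightarrow> a \<odot>\<^bsub>F\<^esub> sec m = sec (a \<odot>\<^bsub>M\<^esub> m) \<oplus>\<^bsub>F\<^esub> defect a m"
  by (simp add: defect_def a_minus_def sec_closed F.M.a_lcomm F.M.r_neg)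

lemma defect_unique:
  assumes "a \<in> carrier A" "m \<in> carrier M" "y \<in> carrier F"
    and "a \<odot>\<^bsub>F\<^esub> sec m = sec (a \<odot>\<^bsub>M\<^esub> m) \<oplus>\<^bsub>F\<^esub> y"
  shows "defect a m = y"
  using assms by (simp add: defect_def a_minus_def sec_closed F.M.a_ac F.M.r_neg2 F.M.r_neg1 F.M.r_neg)

lemma defect_add_left:
  assumes "a \<in> carrier A" "a' \<in> carrier A" "m \<in> carrier M"
  shows "defect (a \<oplus> a') m = defect a m \<oplus>\<^bsub>F\<^esub> defect a' m"
  using assms smult_defect[of a m] smult_defect[of a' m]
  by (intro defect_unique)
    (simp_all add: defect_closed_F F.smult_add_left M.smult_add_left sec_add sec_closed F.M.a_ac)

lemma defect_add_right:
  assumes "a \<in> carrier A" "m \<in> carrier M" "m' \<in> carrier M"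
  shows "defect a (m \<oplus>\<^bsub>M\<^esub> m') = defect a m \<oplus>\<^bsub>F\<^esub> defect a m'"
  using assms smult_defect[of a m] smult_defect[of a m']
  by (intro defect_unique)
    (simp_all add: defect_closed_F F.smult_add_right M.smult_add_right sec_add sec_closed F.M.a_ac)

lemma defect_emb_left:
  assumes "a \<in> carrier A" "m \<in> carrier M"
  shows "defect (emb A c \<otimes> a) m = emb A c \<odot>\<^bsub>F\<^esub> defect a m"
  using assms smult_defect[of a m]
  by (intro defect_unique)
    (simp_all add: defect_closed_F F.smult_assoc M.smult_assoc sec_emb sec_closed F.smult_add_right)

lemma defect_emb_right:
  assumes "a \<in> carrier A" "m \<in> carrier M"
  shows "defect a (emb A c \<odot>\<^bsub>M\<^esub> m) = emb A c \<odot>\<^bsub>F\<^esub> defect a m"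
proof -
  have "a \<odot>\<^bsub>F\<^esub> (emb A c \<odot>\<^bsub>F\<^esub> sec m) = emb A c \<odot>\<^bsub>F\<^esub> (a \<odot>\<^bsub>F\<^esub> sec m)"
    "a \<odot>\<^bsub>M\<^esub> (emb A c \<odot>\<^bsub>M\<^esub> m) = emb A c \<odot>\<^bsub>M\<^esub> (a \<odot>\<^bsub>M\<^esub> m)"
    using assms by (simp_all add: F.smult_assoc[symmetric] M.smult_assoc[symmetric] F.emb_central sec_closed)
  then show ?thesis
    using assms smult_defect[of a m]
    by (intro defect_unique)
      (simp_all add: defect_closed_F sec_emb sec_closed F.smult_add_right)
qed

lemma defect_mult:
  assumes "a \<in> carrier A" "a' \<in> carrier A" "m \<in> carrier M"
  shows "defect (a \<otimes> a') m = defect a (a' \<odot>\<^bsub>M\<^esub> m) \<oplus>\<^bsub>F\<^esub> a \<odot>\<^bsub>F\<^esub> defect a' m"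
  using assms smult_defect[of a' m] smult_defect[of a "a' \<odot>\<^bsub>M\<^esub> m"]
  by (intro defect_unique)
    (simp_all add: defect_closed_F F.smult_assoc M.smult_assoc sec_closed F.smult_add_right F.M.a_ac)

lemma defect_mpart: "a \<in> hpart A k \<Longrightarrow> m \<in> mpart M e \<Longrightarrow> defect a m \<in> mpart K (k + e)"
  using defect_K[of a m] F.hpart_closed[of a k] M.mpart_closed[of m e]
  by (auto simp: K_mpart defect_def a_minus_def
      intro!: F.mpart_add F.mpart_minus F.mpart_smult sec_mpart M.mpart_smult)

lemma K_closed: "x \<in> carrier K \<Longrightarrow> x \<in> carrier F"
  by (simp add: K_carrier)

lemma restrict_cochain:
  "g \<in> bar_cochains A F N n d \<Longrightarrow> g \<in> bar_cochains A K N n d"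
  using K_closed
  by (intro bar_cochainI)
    (auto simp: K_ops K_mpart bar_cochain_closed bar_cochain_add bar_cochain_emb
      bar_cochain_add_module bar_cochain_emb_module
      bar_cochain_degree[unfolded of_nat_add])

lemma pullback_cochain:
  "f \<in> bar_cochains A M N n d \<Longrightarrow> (\<lambda>as x. f as (prj x)) \<in> bar_cochains A F N n d"
  by (intro bar_cochainI)
    (auto simp: prj_closed prj_add prj_smult prj_mpart bar_cochain_closed bar_cochain_add
      bar_cochain_emb bar_cochain_add_module bar_cochain_emb_module
      bar_cochain_degree[unfolded of_nat_add])

lemma section_cochain:
  "g \<in> bar_cochains A F N n d \<Longrightarrow> (\<lambda>as m. g as (sec m)) \<in> bar_cochains A M N n d"
  by (intro bar_cochainI)
    (auto simp: sec_closed sec_add sec_emb sec_mpart bar_cochain_closed bar_cochain_add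
      bar_cochain_emb bar_cochain_add_module bar_cochain_emb_module
      bar_cochain_degree[unfolded of_nat_add])

lemma pullback_cocycle:
  assumes f: "f \<in> bar_cocycles A M N n d"
  shows "(\<lambda>as x. f as (prj x)) \<in> bar_cocycles A F N n d"
proof -
  have "bar_differential A F N (\<lambda>as x. f as (prj x)) as x = bar_differential A M N f as (prj x)"
    if as: "length as = n + 1" "set as \<subseteq> carrier A" and "x \<in> carrier F" for as x
  proof -
    have "last as \<in> carrier A" using as by (cases as rule: rev_cases) auto
    then show ?thesis using that unfolding bar_differential_def by (simp add: prj_smult)
  qed
  then show ?thesis
    using f pullback_cochain unfolding bar_cocycles_def by (auto simp: prj_closed)
qed

definition defect_cochain :: "('a list \<Rightarrow> 'f \<Rightarrow> 'n) \<Rightarrow> 'a list \<Rightarrow> 'm \<Rightarrow> 'n" where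
  "defect_cochain h as m = h (butlast as) (defect (last as) m)"

lemma defect_cochain_cochain:
  assumes h: "h \<in> bar_cochains A K N n d"
  shows "defect_cochain h \<in> bar_cochains A M N (Suc n) d"
proof (rule bar_cochainI)
  fix as m assume "length as = Suc n" "set as \<subseteq> carrier A" "m \<in> carrier M"
  then show "defect_cochain h as m \<in> carrier N"
    using length_append_last[of as n]
    by (auto simp: defect_cochain_def defect_closed_F prj_defect intro!: bar_cochain_closed[OF h])
next
  fix as x y bs m
  assume *: "length as + 1 + length bs = Suc n" "set as \<subseteq> carrier A" "set bs \<subseteq> carrier A"
    "x \<in> carrier A" "y \<in> carrier A" "m \<in> carrier M"
  show "defect_cochain h (as @ (x \<oplus> y) # bs) m
    = defect_cochain h (as @ x # bs) m \<oplus>\<^bsub>N\<^esub> defect_cochain h (as @ y # bs) m"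
  proof (cases bs rule: rev_cases)
    case Nil
    then show ?thesis
      using * bar_cochain_add_module[OF h, of as "defect x m" "defect y m"]
      by (simp add: defect_cochain_def defect_add_left defect_closed_F prj_defect K_ops)
  next
    case (snoc cs z)
    then show ?thesis
      using * bar_cochain_add[OF h, of as cs x y "defect z m"]
      by (simp add: defect_cochain_def defect_closed_F prj_defect butlast_append)
  qed
next
  fix as c x bs m
  assume *: "length as + 1 + length bs = Suc n" "set as \<subseteq> carrier A" "set bs \<subseteq> carrier A"
    "x \<in> carrier A" "m \<in> carrier M"
  show "defect_cochain h (as @ (emb A c \<otimes> x) # bs) m = emb A c \<odot>\<^bsub>N\<^esub> defect_cochain h (as @ x # bs) m"
  proof (cases bs rule: rev_cases)
    case Nil
    then show ?thesis
      using * bar_cochain_emb_module[OF h, of as "defect x m" c]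
      by (simp add: defect_cochain_def defect_emb_left defect_closed_F prj_defect K_ops)
  next
    case (snoc cs z)
    then show ?thesis
      using * bar_cochain_emb[OF h, of as cs x "defect z m"]
      by (simp add: defect_cochain_def defect_closed_F prj_defect butlast_append)
  qed
next
  fix as m m' assume *: "length as = Suc n" "set as \<subseteq> carrier A" "m \<in> carrier M" "m' \<in> carrier M"
  obtain bs z where "as = bs @ [z]" "length bs = n" using length_append_last[OF *(1)] by blast
  then show "defect_cochain h as (m \<oplus>\<^bsub>M\<^esub> m') = defect_cochain h as m \<oplus>\<^bsub>N\<^esub> defect_cochain h as m'"
    using * bar_cochain_add_module[OF h, of bs "defect z m" "defect z m'"]
    by (simp add: defect_cochain_def defect_add_right defect_closed_F prj_defect K_ops)
next
  fix as c m assume *: "length as = Suc n" "set as \<subseteq> carrier A" "m \<in> carrier M"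
  obtain bs z where "as = bs @ [z]" "length bs = n" using length_append_last[OF *(1)] by blast
  then show "defect_cochain h as (emb A c \<odot>\<^bsub>M\<^esub> m) = emb A c \<odot>\<^bsub>N\<^esub> defect_cochain h as m"
    using * bar_cochain_emb_module[OF h, of bs "defect z m" c]
    by (simp add: defect_cochain_def defect_emb_right defect_closed_F prj_defect K_ops)
next
  fix as ds m e
  assume *: "length as = Suc n" "list_all2 (\<lambda>a k. a \<in> hpart A k) as ds" "m \<in> mpart M e"
  obtain bs z where bs: "as = bs @ [z]" "length bs = n" using length_append_last[OF *(1)] by blast
  have "length ds = Suc n" using *(1,2) by (simp add: list_all2_lengthD)
  then obtain ds' k where ds: "ds = ds' @ [k]" "length ds' = n" using length_append_last by blast
  have "list_all2 (\<lambda>a k. a \<in> hpart A k) bs ds'" "z \<in> hpart A k"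
    using *(2) bs ds by (auto simp: list_all2_append)
  then show "defect_cochain h as m \<in> int_part N (int (sum_list ds + e) - d)"
    using bar_cochain_degree[OF h, of bs ds' "defect z m" "k + e"] defect_mpart[of z k m e] *(3) bs ds
    by (simp add: defect_cochain_def algebra_simps)
qed

text \<open>
  The two differentials differ only in their last summands, where \<open>sec (a \<odot> m)\<close> takes the place of
  \<open>a \<odot> sec m\<close>.
\<close>

lemma section_differential:
  assumes g: "g \<in> bar_cochains A F N n d"
    and bs: "length bs = n" "set bs \<subseteq> carrier A" and a: "a \<in> carrier A" and m: "m \<in> carrier M"
  shows "bar_differential A M N (\<lambda>as m. g as (sec m)) (bs @ [a]) m
    = bar_differential A F N g (bs @ [a]) (sec m) \<oplus>\<^bsub>N\<^esub> sgn_add N n (g bs (defect a m))"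
proof -
  have c: "g bs (sec (a \<odot>\<^bsub>M\<^esub> m)) \<in> carrier N" "g bs (defect a m) \<in> carrier N"
    using bs a m by (auto intro!: bar_cochain_closed[OF g] simp: sec_closed defect_closed_F)
  have i: "inner_differential A N (\<lambda>cs. g cs (sec m)) (bs @ [a]) \<in> carrier N"
    using bs a m bar_cochain_closed[OF g] by (intro N.inner_closed[of n]) (auto simp: fun_on_def sec_closed)
  have "bar_differential A M N (\<lambda>as m. g as (sec m)) (bs @ [a]) m
    = inner_differential A N (\<lambda>cs. g cs (sec m)) (bs @ [a])
      \<oplus>\<^bsub>N\<^esub> sgn_add N (Suc n) (g bs (sec (a \<odot>\<^bsub>M\<^esub> m)))"
    using bs a m bar_cochain_closed[OF g] sec_closed
    by (intro bar_differential_eq[OF M.graded_left_module_axioms N.graded_left_module_axioms]) auto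
  moreover have "bar_differential A F N g (bs @ [a]) (sec m)
    = inner_differential A N (\<lambda>cs. g cs (sec m)) (bs @ [a])
      \<oplus>\<^bsub>N\<^esub> sgn_add N (Suc n) (g bs (a \<odot>\<^bsub>F\<^esub> sec m))"
    using bs a m bar_cochain_closed[OF g] sec_closed
    by (intro bar_differential_eq[OF F.graded_left_module_axioms N.graded_left_module_axioms]) auto
  moreover have "g bs (a \<odot>\<^bsub>F\<^esub> sec m) = g bs (sec (a \<odot>\<^bsub>M\<^esub> m)) \<oplus>\<^bsub>N\<^esub> g bs (defect a m)"
    using bs a m bar_cochain_add_module[OF g, of bs]
    by (simp add: smult_defect sec_closed defect_closed_F)
  ultimately show ?thesis
    using c i by (simp add: N.M.sgn_add_add N.M.sgn_add_Suc N.M.a_assoc N.M.l_neg)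
qed

text \<open>
  By \<open>defect_mult\<close> the contraction of the last two entries yields one term that cancels the last summand
  and another that is the last summand of the differential on \<open>K\<close>.
\<close>

lemma defect_differential:
  assumes h: "h \<in> bar_cochains A K N n d"
    and bs: "length bs = Suc n" "set bs \<subseteq> carrier A" and a: "a \<in> carrier A" and m: "m \<in> carrier M"
  shows "bar_differential A M N (defect_cochain h) (bs @ [a]) m
    = bar_differential A K N h bs (defect a m)"
proof -
  obtain cs z where cs: "bs = cs @ [z]" "length cs = n" "set cs \<subseteq> carrier A" "z \<in> carrier A"
    using length_append_last[OF bs(1)] bs(2) by auto
  have H: "defect_cochain h \<in> bar_cochains A M N (Suc n) d"
    using h by (rule defect_cochain_cochain)
  have c: "h cs (defect z (a \<odot>\<^bsub>M\<^esub> m)) \<in> carrier N" "h cs (z \<odot>\<^bsub>K\<^esub> defect a m) \<in> carrier N"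
  proof -
    show "h cs (defect z (a \<odot>\<^bsub>M\<^esub> m)) \<in> carrier N"
      using cs a m by (intro bar_cochain_closed[OF h]) (auto simp: defect_closed_F prj_defect)
    have "z \<odot>\<^bsub>F\<^esub> defect a m \<in> carrier K"
      using cs a m defect_K[of a m] by (auto simp: K_carrier prj_smult)
    then show "h cs (z \<odot>\<^bsub>K\<^esub> defect a m) \<in> carrier N"
      using cs by (intro bar_cochain_closed[OF h]) (auto simp: K_ops)
  qed
  have zK: "z \<odot>\<^bsub>F\<^esub> defect a m \<in> carrier K"
    using cs a m defect_K[of a m] by (auto simp: K_carrier prj_smult)
  have fo: "fun_on A N n (\<lambda>ds. h ds (defect a m))"
    using bar_cochain_fun_on[OF h] defect_K a m by blast
  have i: "inner_differential A N (\<lambda>ds. h ds (defect a m)) bs \<in> carrier N"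
    using fo bs by (rule N.inner_closed)
  have "bar_differential A M N (defect_cochain h) (bs @ [a]) m
    = inner_differential A N (\<lambda>ds. defect_cochain h ds m) (bs @ [a])
      \<oplus>\<^bsub>N\<^esub> sgn_add N (Suc (Suc n)) (defect_cochain h bs (a \<odot>\<^bsub>M\<^esub> m))"
    using bs a m bar_cochain_closed[OF H]
    by (intro bar_differential_eq[OF M.graded_left_module_axioms N.graded_left_module_axioms]) auto
  also have "inner_differential A N (\<lambda>ds. defect_cochain h ds m) (bs @ [a])
    = inner_differential A N (\<lambda>ds. h ds (defect a m)) bs
      \<oplus>\<^bsub>N\<^esub> sgn_add N (Suc n) (h cs (defect (z \<otimes> a) m))"
    using N.inner_snoc[OF bar_cochain_fun_on[OF H m] bs a] cs by (simp add: defect_cochain_def)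
  also have "h cs (defect (z \<otimes> a) m) = h cs (defect z (a \<odot>\<^bsub>M\<^esub> m)) \<oplus>\<^bsub>N\<^esub> h cs (z \<odot>\<^bsub>K\<^esub> defect a m)"
    using cs a m bar_cochain_add_module[OF h, of cs "defect z (a \<odot>\<^bsub>M\<^esub> m)" "z \<odot>\<^bsub>F\<^esub> defect a m"] zK
    by (simp add: defect_mult defect_closed_F prj_defect K_ops)
  also have "inner_differential A N (\<lambda>ds. h ds (defect a m)) bs
      \<oplus>\<^bsub>N\<^esub> sgn_add N (Suc n) (h cs (defect z (a \<odot>\<^bsub>M\<^esub> m)) \<oplus>\<^bsub>N\<^esub> h cs (z \<odot>\<^bsub>K\<^esub> defect a m))
      \<oplus>\<^bsub>N\<^esub> sgn_add N (Suc (Suc n)) (defect_cochain h bs (a \<odot>\<^bsub>M\<^esub> m))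
    = inner_differential A N (\<lambda>ds. h ds (defect a m)) bs \<oplus>\<^bsub>N\<^esub> sgn_add N (Suc n) (h cs (z \<odot>\<^bsub>K\<^esub> defect a m))"
    using c i cs N.M.sgn_add_closed[of _ "Suc n"]
    by (simp add: defect_cochain_def N.M.sgn_add_add N.M.sgn_add_Suc[of _ "Suc n"] N.M.add_cancel_middle)
  also have "\<dots> = bar_differential A K N h bs (defect a m)"
    using bar_differential_inner[of N h bs K "defect a m" A] c cs N.M.abelian_group_axioms
    by simp
  finally show ?thesis .
qed

text \<open>
  Pulled back to \<open>F\<close>, a cocycle \<open>f\<close> on \<open>M\<close> becomes the coboundary of a cochain \<open>g\<close>, whose restriction to
  \<open>K\<close> is a cocycle. If that is the coboundary of \<open>h\<close>, then \<open>f\<close> is the coboundary of the composite of \<open>g\<close>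
  with the section plus the sign \<open>(-1)\<^sup>n\<^sup>+\<^sup>1\<close> times the cochain that \<open>h\<close> induces through the defect: the error
  terms \<open>g bs (defect a m)\<close> of the two parts cancel.
\<close>

theorem Ext_shift:
  assumes K: "Ext_component_zero A K N n d"
  shows "Ext_component_zero A M N (Suc n) d"
  unfolding Ext_component_zero_def
proof
  fix f assume f: "f \<in> bar_cocycles A M N (Suc n) d"
  then have fc: "f \<in> bar_cochains A M N (Suc n) d" by (simp add: bar_cocycles_def)
  define f' where "f' = (\<lambda>as x. f as (prj x))"
  have f': "f' \<in> bar_cocycles A F N (Suc n) d"
    unfolding f'_def using f by (rule pullback_cocycle)
  define g where "g = lift n f'"
  have g: "g \<in> bar_cochains A F N n d"
    using f' unfolding g_def bar_cocycles_def by (auto intro: lift_cochain)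
  have dg: "bar_differential A F N g as x = f as (prj x)"
    if "length as = Suc n" "set as \<subseteq> carrier A" "x \<in> carrier F" for as x
    using lift_differential[OF f' that] by (simp add: g_def f'_def)
  have "bar_differential A K N g as x = \<zero>\<^bsub>N\<^esub>"
    if "length as = n + 1" "set as \<subseteq> carrier A" "x \<in> carrier K" for as x
  proof -
    have "bar_differential A K N g as x = bar_differential A F N g as x"
      by (simp add: bar_differential_def K_ops)
    also have "\<dots> = f as \<zero>\<^bsub>M\<^esub>"
      using dg[of as x] that by (simp add: K_carrier)
    also have "\<dots> = \<zero>\<^bsub>N\<^esub>"
      using that bar_cochain_closed[OF fc, of as] bar_cochain_add_module[OF fc, of as]
        M.M.abelian_group_axioms N.M.abelian_group_axioms
      by (intro additive_zero) auto
    finally show ?thesis .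
  qed
  then have "g \<in> bar_cocycles A K N n d"
    using restrict_cochain[OF g] by (simp add: bar_cocycles_def)
  then have gb: "g \<in> bar_coboundaries A K N n d"
    using K by (auto simp: Ext_component_zero_def)
  have sg: "(\<lambda>as m. g as (sec m)) \<in> bar_cochains A M N n d"
    using g by (rule section_cochain)
  have ds: "bar_differential A M N (\<lambda>as m. g as (sec m)) (bs @ [a]) m
      = f (bs @ [a]) m \<oplus>\<^bsub>N\<^esub> sgn_add N n (g bs (defect a m))"
    if "length bs = n" "set bs \<subseteq> carrier A" "a \<in> carrier A" "m \<in> carrier M" for bs a m
    using section_differential[OF g that] dg[of "bs @ [a]" "sec m"] that by (simp add: sec_closed prj_sec)
  show "f \<in> bar_coboundaries A M N (Suc n) d"
  proof (cases n)
    case 0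
    have "f as m = bar_differential A M N (\<lambda>as m. g as (sec m)) as m"
      if as: "length as = Suc 0" "set as \<subseteq> carrier A" and m: "m \<in> carrier M" for as m
    proof -
      obtain a where a: "as = [a]" "a \<in> carrier A" using as by (cases as) auto
      have "g [] (defect a m) = \<zero>\<^bsub>N\<^esub>"
        using gb 0 defect_K[OF a(2) m] by (simp add: bar_coboundaries_def)
      then show ?thesis
        using ds[of "[]" a m] a m 0 bar_cochain_closed[OF fc, of "[a]" m] by simp
    qed
    then show ?thesis
      using sg fc 0 by (auto simp: bar_coboundaries_def)
  next
    case (Suc k)
    obtain h where h: "h \<in> bar_cochains A K N k d"
      and dh: "\<And>as x. length as = n \<Longrightarrow> set as \<subseteq> carrier A \<Longrightarrow> x \<in> carrier K \<Longrightarrow>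
        g as x = bar_differential A K N h as x"
      using gb Suc by (auto simp: bar_coboundaries_def)
    define G where "G as m = g as (sec m) \<oplus>\<^bsub>N\<^esub> sgn_add N (Suc n) (defect_cochain h as m)" for as m
    have H: "defect_cochain h \<in> bar_cochains A M N n d"
      using defect_cochain_cochain[OF h] Suc by simp
    have G: "G \<in> bar_cochains A M N n d"
    proof (rule bar_cochainI)
      fix as ds m e
      assume "length as = n" "list_all2 (\<lambda>a k. a \<in> hpart A k) as ds" "m \<in> mpart M e"
      then show "G as m \<in> int_part N (int (sum_list ds + e) - d)"
        unfolding G_def using bar_cochain_degree[OF sg] bar_cochain_degree[OF H]
        by (intro N.int_part_add N.int_part_sgn) auto
    qed (simp_all add: G_def bar_cochain_closed[OF sg] bar_cochain_closed[OF H]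
        bar_cochain_add[OF sg] bar_cochain_add[OF H] bar_cochain_emb[OF sg] bar_cochain_emb[OF H]
        bar_cochain_add_module[OF sg] bar_cochain_add_module[OF H]
        bar_cochain_emb_module[OF sg] bar_cochain_emb_module[OF H]
        N.M.sgn_add_add N.M.a_ac N.smult_sgn N.smult_add_right)
    have "f as m = bar_differential A M N G as m"
      if as: "length as = Suc n" "set as \<subseteq> carrier A" and m: "m \<in> carrier M" for as m
    proof -
      obtain bs a where bs: "as = bs @ [a]" "length bs = n" "set bs \<subseteq> carrier A" "a \<in> carrier A"
        using length_append_last[OF as(1)] as(2) by auto
      let ?s = "\<lambda>as m. g as (sec m)" and ?H = "defect_cochain h"
      have gc: "g bs (defect a m) \<in> carrier N"
        using bs m by (intro bar_cochain_closed[OF g]) (auto simp: defect_closed_F)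
      have c: "?s bs (a \<odot>\<^bsub>M\<^esub> m) \<in> carrier N" "?H bs (a \<odot>\<^bsub>M\<^esub> m) \<in> carrier N"
        using bs m bar_cochain_closed[OF sg] bar_cochain_closed[OF H] by auto
      have i: "inner_differential A N (\<lambda>cs. ?s cs m) as \<in> carrier N"
        "inner_differential A N (\<lambda>cs. ?H cs m) as \<in> carrier N"
        using bar_cochain_fun_on[OF sg m] bar_cochain_fun_on[OF H m] as N.inner_closed by auto
      have Hfo: "fun_on A N n (\<lambda>cs. sgn_add N (Suc n) (?H cs m))"
        using bar_cochain_fun_on[OF H m] by (auto simp: fun_on_def)
      have "bar_differential A M N G as m = inner_differential A N (\<lambda>cs. G cs m) as
          \<oplus>\<^bsub>N\<^esub> sgn_add N (Suc n) (G bs (a \<odot>\<^bsub>M\<^esub> m))"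
        unfolding bs(1) using bs m bar_cochain_closed[OF G]
        by (intro bar_differential_eq[OF M.graded_left_module_axioms N.graded_left_module_axioms]) auto
      also have "inner_differential A N (\<lambda>cs. G cs m) as
          = inner_differential A N (\<lambda>cs. ?s cs m) as
            \<oplus>\<^bsub>N\<^esub> sgn_add N (Suc n) (inner_differential A N (\<lambda>cs. ?H cs m) as)"
        unfolding G_def
        by (simp only: N.inner_add[OF bar_cochain_fun_on[OF sg m] Hfo as]
            N.inner_sgn[OF bar_cochain_fun_on[OF H m] as])
      also have "\<dots> \<oplus>\<^bsub>N\<^esub> sgn_add N (Suc n) (G bs (a \<odot>\<^bsub>M\<^esub> m))
        = bar_differential A M N ?s as m \<oplus>\<^bsub>N\<^esub> sgn_add N (Suc n) (bar_differential A M N ?H as m)"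
      proof -
        have "bar_differential A M N ?s as m = inner_differential A N (\<lambda>cs. ?s cs m) as
            \<oplus>\<^bsub>N\<^esub> sgn_add N (Suc n) (?s bs (a \<odot>\<^bsub>M\<^esub> m))"
          "bar_differential A M N ?H as m = inner_differential A N (\<lambda>cs. ?H cs m) as
            \<oplus>\<^bsub>N\<^esub> sgn_add N (Suc n) (?H bs (a \<odot>\<^bsub>M\<^esub> m))"
          unfolding bs(1) using bs m bar_cochain_closed[OF sg] bar_cochain_closed[OF H]
          by (intro bar_differential_eq[OF M.graded_left_module_axioms N.graded_left_module_axioms]; auto)+
        then show ?thesis
          using c i by (simp add: G_def N.M.sgn_add_add N.M.a_ac)
      qed
      also have "bar_differential A M N ?H as m = g bs (defect a m)"
      proof -
        have "bar_differential A M N ?H as m = bar_differential A K N h bs (defect a m)"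
          unfolding bs(1) using bs m Suc by (intro defect_differential[OF h]) auto
        also have "\<dots> = g bs (defect a m)"
          using dh[OF bs(2,3) defect_K[OF bs(4) m]] by (rule sym)
        finally show ?thesis .
      qed
      also have "bar_differential A M N ?s as m = f as m \<oplus>\<^bsub>N\<^esub> sgn_add N n (g bs (defect a m))"
        unfolding bs(1) using ds bs m by blast
      finally show ?thesis
        using gc bar_cochain_closed[OF fc as m] by (simp add: N.M.sgn_add_Suc N.M.a_assoc N.M.r_neg)
    qed
    then show ?thesis
      using G fc by (auto simp: bar_coboundaries_def)
  qed
qed

end

section \<open>Projective modules of columns\<close>

definition regular_module :: "('a, 'k, 'v) graded_algebra \<Rightarrow> ('a, 'a) graded_module" where
  "regular_module A =
    \<lparr> carrier = carrier A, mult = mult A, one = one A, zero = zero A, add = add A,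
      smult = mult A, mpart = hpart A \<rparr>"

text \<open>
  The direct sum of the left ideals \<open>A \<epsilon>\<^sub>i\<close>, as columns that vanish off the index set. The generators have
  degree 1, so the grading is shifted by one.
\<close>

definition column_module ::
  "('a, 'k, 'v) graded_algebra \<Rightarrow> 'i set \<Rightarrow> ('i \<Rightarrow> 'a) \<Rightarrow> ('a, 'i \<Rightarrow> 'a) graded_module" where
  "column_module A S \<epsilon> =
    (let C = {y. \<forall>i. if i \<in> S then y i \<in> carrier A \<and> y i \<otimes>\<^bsub>A\<^esub> \<epsilon> i = y i else y i = \<zero>\<^bsub>A\<^esub>} in
    \<lparr> carrier = C, mult = (\<lambda>x y i. x i \<otimes>\<^bsub>A\<^esub> y i), one = \<epsilon>, zero = (\<lambda>_. \<zero>\<^bsub>A\<^esub>),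
      add = (\<lambda>x y i. x i \<oplus>\<^bsub>A\<^esub> y i), smult = (\<lambda>a y i. a \<otimes>\<^bsub>A\<^esub> y i),
      mpart = (\<lambda>d. {y \<in> C. \<forall>i\<in>S. case d of 0 \<Rightarrow> y i = \<zero>\<^bsub>A\<^esub> | Suc e \<Rightarrow> y i \<in> hpart A e}) \<rparr>)"

lemma regular_module_simps [simp]:
  "carrier (regular_module A) = carrier A" "zero (regular_module A) = zero A"
  "add (regular_module A) = add A" "smult (regular_module A) = mult A"
  "mpart (regular_module A) = hpart A"
  by (simp_all add: regular_module_def)

lemma column_module_simps [simp]:
  "zero (column_module A S \<epsilon>) = (\<lambda>_. \<zero>\<^bsub>A\<^esub>)"
  "add (column_module A S \<epsilon>) = (\<lambda>x y i. x i \<oplus>\<^bsub>A\<^esub> y i)"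
  "smult (column_module A S \<epsilon>) = (\<lambda>a y i. a \<otimes>\<^bsub>A\<^esub> y i)"
  by (simp_all add: column_module_def Let_def)

lemma column_carrier: "y \<in> carrier (column_module A S \<epsilon>) \<longleftrightarrow>
    (\<forall>i. if i \<in> S then y i \<in> carrier A \<and> y i \<otimes>\<^bsub>A\<^esub> \<epsilon> i = y i else y i = \<zero>\<^bsub>A\<^esub>)"
  by (simp add: column_module_def Let_def)

lemma column_mpart: "y \<in> mpart (column_module A S \<epsilon>) d \<longleftrightarrow> y \<in> carrier (column_module A S \<epsilon>) \<and>
    (\<forall>i\<in>S. case d of 0 \<Rightarrow> y i = \<zero>\<^bsub>A\<^esub> | Suc e \<Rightarrow> y i \<in> hpart A e)"
  by (simp add: column_module_def Let_def)

context graded_ring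
begin

lemma regular_module: "graded_left_module A (regular_module A)"
proof -
  have ab: "abelian_group (regular_module A)"
  proof (rule abelian_groupI)
    fix x assume "x \<in> carrier (regular_module A)"
    then show "\<exists>y\<in>carrier (regular_module A). y \<oplus>\<^bsub>regular_module A\<^esub> x = \<zero>\<^bsub>regular_module A\<^esub>"
      using l_neg[of x] by (intro bexI[of _ "\<ominus> x"]) auto
  qed (auto simp: a_ac)
  interpret R: abelian_group "regular_module A" by fact
  have minus: "\<ominus>\<^bsub>regular_module A\<^esub> x = \<ominus> x" if "x \<in> carrier A" for x
    using that l_neg by (intro R.minus_equality) auto
  show ?thesis
    by (intro graded_left_module.intro graded_ring_axioms ab graded_left_module_axioms.intro)
      (auto simp: r_distr l_distr m_assoc hpart_closed hpart_zero hpart_add hpart_minus hpart_mult minus)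
qed

lemma regular_dual_basis:
  assumes "\<one> \<in> hpart A 0"
  shows "dual_basis A (regular_module A) {()} (\<lambda>_. 0) (\<lambda>_. \<one>) (\<lambda>_ x. x)"
proof -
  interpret R: graded_left_module A "regular_module A" by (rule regular_module)
  show ?thesis using assms by (simp add: dual_basis_def)
qed

lemma column_apply:
  "y \<in> carrier (column_module A S \<epsilon>) \<Longrightarrow> y i \<in> carrier A"
  by (metis column_carrier zero_closed)

lemma column_module:
  assumes \<epsilon>: "\<And>i. i \<in> S \<Longrightarrow> \<epsilon> i \<in> carrier A"
  shows "graded_left_module A (column_module A S \<epsilon>)"
proof -
  let ?F = "column_module A S \<epsilon>"
  have neg: "(\<lambda>i. \<ominus> x i) \<in> carrier ?F" if "x \<in> carrier ?F" for x
    using that \<epsilon> by (auto simp: column_carrier l_minus split: if_splits)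
  have ab: "abelian_group ?F"
  proof (rule abelian_groupI)
    fix x assume x: "x \<in> carrier ?F"
    show "\<exists>y\<in>carrier ?F. y \<oplus>\<^bsub>?F\<^esub> x = \<zero>\<^bsub>?F\<^esub>"
      using neg[OF x] column_apply[OF x] by (intro bexI[of _ "\<lambda>i. \<ominus> x i"]) (auto simp: l_neg)
  next
    fix x y assume "x \<in> carrier ?F" "y \<in> carrier ?F"
    then show "x \<oplus>\<^bsub>?F\<^esub> y \<in> carrier ?F"
      using \<epsilon> by (auto simp: column_carrier l_distr split: if_splits)
  next
    show "\<zero>\<^bsub>?F\<^esub> \<in> carrier ?F" using \<epsilon> by (simp add: column_carrier)
  qed (auto simp: fun_eq_iff a_ac simp: column_apply)
  interpret F: abelian_group ?F by fact
  have minus: "\<ominus>\<^bsub>?F\<^esub> x = (\<lambda>i. \<ominus> x i)" if "x \<in> carrier ?F" for x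
    using that neg column_apply[OF that] by (intro F.minus_equality) (auto simp: l_neg)
  have closed: "a \<odot>\<^bsub>?F\<^esub> x \<in> carrier ?F" if "a \<in> carrier A" "x \<in> carrier ?F" for a x
    using that \<epsilon> by (auto simp: column_carrier m_assoc split: if_splits)
  show ?thesis
  proof (intro graded_left_module.intro graded_ring_axioms ab graded_left_module_axioms.intro)
    fix x y d assume "x \<in> mpart ?F d" "y \<in> mpart ?F d"
    then show "x \<oplus>\<^bsub>?F\<^esub> y \<in> mpart ?F d"
      using F.a_closed[of x y] by (auto simp: column_mpart hpart_add split: nat.splits)
  next
    fix x d assume "x \<in> mpart ?F d"
    then show "\<ominus>\<^bsub>?F\<^esub> x \<in> mpart ?F d"
      using F.a_inv_closed[of x] by (auto simp: column_mpart hpart_minus minus split: nat.splits)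
  next
    fix a x d e assume "a \<in> hpart A d" "x \<in> mpart ?F e"
    then show "a \<odot>\<^bsub>?F\<^esub> x \<in> mpart ?F (d + e)"
      using closed[of a x] hpart_closed[of a d]
      by (cases e) (auto simp: column_mpart hpart_mult hpart_zero split: nat.splits)
  next
    fix d show "\<zero>\<^bsub>?F\<^esub> \<in> mpart ?F d"
      using F.zero_closed by (auto simp: column_mpart hpart_zero split: nat.splits)
  qed (use closed in \<open>auto simp: column_mpart fun_eq_iff r_distr l_distr m_assoc simp: column_apply\<close>)
qed

lemma column_finsum:
  assumes "\<And>i. i \<in> S \<Longrightarrow> \<epsilon> i \<in> carrier A" "f \<in> B \<rightarrow> carrier (column_module A S \<epsilon>)"
  shows "(\<Oplus>\<^bsub>column_module A S \<epsilon>\<^esub>j\<in>B. f j) i = (\<Oplus>j\<in>B. f j i)"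
proof -
  interpret F: graded_left_module A "column_module A S \<epsilon>" using assms(1) by (rule column_module)
  show ?thesis
    using assms(2) F.M.abelian_group_axioms abelian_group_axioms
    by (intro additive_finsum[of "column_module A S \<epsilon>" A "\<lambda>y. y i"]) (auto simp: column_apply)
qed

lemma column_dual_basis:
  assumes S: "finite S" and \<epsilon>: "\<And>i. i \<in> S \<Longrightarrow> \<epsilon> i \<in> hpart A 0"
    "\<And>i. i \<in> S \<Longrightarrow> \<epsilon> i \<otimes> \<epsilon> i = \<epsilon> i"
  shows "dual_basis A (column_module A S \<epsilon>) S (\<lambda>_. 1) (\<lambda>j i. if i = j then \<epsilon> j else \<zero>) (\<lambda>j y. y j)"
proof -
  let ?F = "column_module A S \<epsilon>" and ?b = "\<lambda>j i. if i = j then \<epsilon> j else \<zero>"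
  have \<epsilon>c: "\<epsilon> i \<in> carrier A" if "i \<in> S" for i using that \<epsilon>(1) hpart_closed by blast
  interpret F: graded_left_module A ?F using \<epsilon>c by (rule column_module)
  have b: "?b j \<in> carrier ?F" if "j \<in> S" for j
    using that \<epsilon>c \<epsilon>(2) by (auto simp: column_carrier)
  have "(\<Oplus>\<^bsub>?F\<^esub>j\<in>S. y j \<odot>\<^bsub>?F\<^esub> ?b j) i = y i" if y: "y \<in> carrier ?F" for y i
  proof -
    have c: "(\<lambda>j. y j \<odot>\<^bsub>?F\<^esub> ?b j) \<in> S \<rightarrow> carrier ?F"
      using y b by (intro funcsetI F.smult_closed) (auto simp: column_apply)
    have "(\<Oplus>\<^bsub>?F\<^esub>j\<in>S. y j \<odot>\<^bsub>?F\<^esub> ?b j) i = (\<Oplus>j\<in>S. (y j \<odot>\<^bsub>?F\<^esub> ?b j) i)"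
      using c \<epsilon>c by (intro column_finsum) auto
    also have "\<dots> = (\<Oplus>j\<in>S. if i = j then y j else \<zero>)"
      using y \<epsilon>c by (intro finsum_cong') (auto simp: column_carrier split: if_splits)
    also have "\<dots> = y i"
    proof (cases "i \<in> S")
      case True
      then show ?thesis using S y column_apply[OF y] by (intro finsum_singleton) auto
    next
      case False
      then have "(\<Oplus>j\<in>S. if i = j then y j else \<zero>) = (\<Oplus>j\<in>S. \<zero>)"
        by (intro finsum_cong') auto
      then show ?thesis using False y by (simp add: column_carrier finsum_zero)
    qed
    finally show ?thesis .
  qed
  then have exp: "\<forall>x\<in>carrier ?F. x = (\<Oplus>\<^bsub>?F\<^esub>j\<in>S. x j \<odot>\<^bsub>?F\<^esub> ?b j)"
    by (intro ballI ext) (rule sym)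
  have 1: "?b j \<in> mpart ?F 1" if "j \<in> S" for j
    using that b[OF that] \<epsilon>(1) hpart_zero by (auto simp: column_mpart)
  have 2: "if 1 \<le> d then x j \<in> hpart A (d - 1) else x j = \<zero>" if "j \<in> S" "x \<in> mpart ?F d" for j x d
    using that by (cases d) (auto simp: column_mpart)
  show ?thesis
    unfolding dual_basis_def
    by (intro conjI ballI allI S 1 2 exp[rule_format] column_apply) simp_all
qed

end

section \<open>Quotients of graded algebras\<close>

lemma graded_quotient_simps:
  "carrier (graded_quotient A I) = (\<lambda>x. I +>\<^bsub>A\<^esub> x) ` carrier A"
  "emb (graded_quotient A I) c = I +>\<^bsub>A\<^esub> emb A c"
  "idem (graded_quotient A I) v = I +>\<^bsub>A\<^esub> idem A v"
  "hpart (graded_quotient A I) d = (\<lambda>x. I +>\<^bsub>A\<^esub> x) ` hpart A d"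
  by (auto simp: graded_quotient_def FactRing_def A_RCOSETS_def')

lemma graded_quotient_ring:
  assumes "ideal I A"
  shows "ring (graded_quotient A I)" "(\<lambda>x. I +>\<^bsub>A\<^esub> x) \<in> ring_hom A (graded_quotient A I)"
proof -
  interpret I: ideal I A by fact
  interpret Q: ring "A Quot I" by (rule I.quotient_is_ring)
  have ops: "carrier (graded_quotient A I) = carrier (A Quot I)"
    "mult (graded_quotient A I) = mult (A Quot I)" "one (graded_quotient A I) = one (A Quot I)"
    "zero (graded_quotient A I) = zero (A Quot I)" "add (graded_quotient A I) = add (A Quot I)"
    by (simp_all add: graded_quotient_def)
  have "abelian_group (graded_quotient A I)"
  proof (rule abelian_groupI)
    fix x assume "x \<in> carrier (graded_quotient A I)"
    then show "\<exists>y\<in>carrier (graded_quotient A I). y \<oplus>\<^bsub>graded_quotient A I\<^esub> x = \<zero>\<^bsub>graded_quotient A I\<^esub>"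
      unfolding ops using Q.l_neg by (intro bexI[of _ "\<ominus>\<^bsub>A Quot I\<^esub> x"]) auto
  qed (simp_all only: ops Q.a_closed Q.zero_closed Q.a_ac Q.l_zero Q.r_zero)
  moreover have "monoid (graded_quotient A I)"
    by (rule monoidI) (simp_all only: ops Q.m_closed Q.one_closed Q.m_assoc Q.l_one Q.r_one)
  ultimately show "ring (graded_quotient A I)"
    by (rule ringI) (simp_all only: ops Q.l_distr Q.r_distr)
  show "(\<lambda>x. I +>\<^bsub>A\<^esub> x) \<in> ring_hom A (graded_quotient A I)"
    using I.rcos_ring_hom by (simp add: ring_hom_def graded_quotient_def)
qed

lemma graded_quotient_zero: "ideal I A \<Longrightarrow> zero (graded_quotient A I) = I +>\<^bsub>A\<^esub> \<zero>\<^bsub>A\<^esub>"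
  using ring_hom_zero[OF graded_quotient_ring(2) _ graded_quotient_ring(1)] ideal.axioms(2)
  by fastforce

lemma graded_quotient_eq:
  "ideal I A \<Longrightarrow> x \<in> carrier A \<Longrightarrow> y \<in> carrier A \<Longrightarrow>
    I +>\<^bsub>A\<^esub> x = I +>\<^bsub>A\<^esub> y \<longleftrightarrow> x \<ominus>\<^bsub>A\<^esub> y \<in> I"
  using ring.quotient_eq_iff_same_a_r_cos[of A I x y] ideal.axioms(2) by blast

section \<open>The quotient by the relations\<close>

context involutive_quiver
begin

abbreviation "P \<equiv> graded_quotient A rel_ideal"

text \<open>
  Cosets \<open>q x\<close> are handled through their unique normal representatives.
\<close>

definition q :: "(('v, 'e) path \<Rightarrow>\<^sub>0 'k) \<Rightarrow> (('v, 'e) path \<Rightarrow>\<^sub>0 'k) set" where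
  "q x = rel_ideal +>\<^bsub>A\<^esub> x"

definition rep :: "(('v, 'e) path \<Rightarrow>\<^sub>0 'k) set \<Rightarrow> (('v, 'e) path \<Rightarrow>\<^sub>0 'k)" where
  "rep X = nf (SOME x. keys x \<subseteq> paths G \<and> q x = X)"

definition long_paths :: "nat \<Rightarrow> ('v, 'e) path set" where
  "long_paths d = {(u, p, v) \<in> paths G. length p = d}"

lemma ring_P: "ring P"
  using graded_quotient_ring(1)[OF ideal_rel_ideal] .

sublocale P: ring P by (rule ring_P)

lemma q_hom: "q \<in> ring_hom A P"
  using graded_quotient_ring(2)[OF ideal_rel_ideal] by (simp add: q_def[abs_def])

lemma q_closed [simp, intro]: "keys x \<subseteq> paths G \<Longrightarrow> q x \<in> carrier P"
  using ring_hom_closed[OF q_hom, of x] by simp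

lemma q_add: "keys x \<subseteq> paths G \<Longrightarrow> keys y \<subseteq> paths G \<Longrightarrow> q (x + y) = q x \<oplus>\<^bsub>P\<^esub> q y"
  using ring_hom_add[OF q_hom, of x y] by simp

lemma q_mult: "keys x \<subseteq> paths G \<Longrightarrow> keys y \<subseteq> paths G \<Longrightarrow> q (path_mult x y) = q x \<otimes>\<^bsub>P\<^esub> q y"
  using ring_hom_mult[OF q_hom, of x y] by simp

lemma q_one: "\<one>\<^bsub>P\<^esub> = q unit"
  using ring_hom_one[OF q_hom] by simp

lemma q_zero: "\<zero>\<^bsub>P\<^esub> = q 0"
  using graded_quotient_zero[OF ideal_rel_ideal] by (simp add: q_def)

lemma q_minus: "keys x \<subseteq> paths G \<Longrightarrow> \<ominus>\<^bsub>P\<^esub> q x = q (- x)"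
  using q_add[of "- x" x] by (intro P.minus_equality) (auto simp: q_zero)

lemma q_eq: "keys x \<subseteq> paths G \<Longrightarrow> keys y \<subseteq> paths G \<Longrightarrow> q x = q y \<longleftrightarrow> nf x = nf y"
proof -
  assume x: "keys x \<subseteq> paths G" and y: "keys y \<subseteq> paths G"
  interpret A: ring A by (rule ring_PA)
  have "x \<ominus>\<^bsub>A\<^esub> y = x - y"
    using x y A.minus_equality[of "- y" y] by (simp add: a_minus_def)
  then show ?thesis
    using x y graded_quotient_eq[OF ideal_rel_ideal, of x y] rel_ideal_iff[OF keys_diff_subset[OF x y]]
    by (simp add: q_def)
qed

lemma nf_paths: "keys x \<subseteq> paths G \<Longrightarrow> keys (nf x) \<subseteq> paths G"
  using nf_keys all_normal_paths by blast

lemma q_nf: "keys x \<subseteq> paths G \<Longrightarrow> q (nf x) = q x"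
  by (simp add: q_eq nf_paths nf_normal nf_keys)

lemma q_sum: "(\<And>i. i \<in> S \<Longrightarrow> keys (f i) \<subseteq> paths G) \<Longrightarrow> q (sum f S) = (\<Oplus>\<^bsub>P\<^esub>i\<in>S. q (f i))"
proof (induction S rule: infinite_finite_induct)
  case (insert i F)
  then show ?case by (simp add: q_add keys_sum_subset Pi_iff)
qed (simp_all add: q_zero[symmetric])

lemma carrier_P: "carrier P = q ` {x. keys x \<subseteq> paths G}"
  by (simp add: graded_quotient_simps q_def[abs_def])

lemma rep_q [simp]:
  assumes x: "keys x \<subseteq> paths G"
  shows "rep (q x) = nf x"
proof -
  define y where "y = (SOME y. keys y \<subseteq> paths G \<and> q y = q x)"
  have "keys y \<subseteq> paths G \<and> q y = q x"
    unfolding y_def by (rule someI[of "\<lambda>y. keys y \<subseteq> paths G \<and> q y = q x" x]) (simp add: x)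
  then show ?thesis using x q_eq[of y x] by (simp add: rep_def y_def)
qed

lemma rep_q_normal: "keys x \<subseteq> all_normal \<Longrightarrow> rep (q x) = x"
  using all_normal_paths by (subst rep_q) (auto simp: nf_normal)

lemma rep_keys: "X \<in> carrier P \<Longrightarrow> keys (rep X) \<subseteq> all_normal"
  by (auto simp: carrier_P nf_keys[THEN subsetD])

lemma rep_paths: "X \<in> carrier P \<Longrightarrow> keys (rep X) \<subseteq> paths G"
  using rep_keys all_normal_paths by blast

lemma q_rep [simp]: "X \<in> carrier P \<Longrightarrow> q (rep X) = X"
  by (auto simp: carrier_P q_nf)

lemma rep_inject: "X \<in> carrier P \<Longrightarrow> Y \<in> carrier P \<Longrightarrow> rep X = rep Y \<Longrightarrow> X = Y"
  by (metis q_rep)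

lemma rep_add: "X \<in> carrier P \<Longrightarrow> Y \<in> carrier P \<Longrightarrow> rep (X \<oplus>\<^bsub>P\<^esub> Y) = rep X + rep Y"
  by (auto simp: carrier_P q_add[symmetric] keys_add_subset)

lemma rep_minus: "X \<in> carrier P \<Longrightarrow> rep (\<ominus>\<^bsub>P\<^esub> X) = - rep X"
  by (auto simp: carrier_P q_minus)

lemma rep_diff: "X \<in> carrier P \<Longrightarrow> Y \<in> carrier P \<Longrightarrow> rep (X \<ominus>\<^bsub>P\<^esub> Y) = rep X - rep Y"
  by (simp add: a_minus_def rep_add rep_minus)

lemma rep_zero [simp]: "rep \<zero>\<^bsub>P\<^esub> = 0"
  by (simp add: q_zero)

lemma rep_mult: "X \<in> carrier P \<Longrightarrow> Y \<in> carrier P \<Longrightarrow> rep (X \<otimes>\<^bsub>P\<^esub> Y) = nf (path_mult (rep X) (rep Y))"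
  using q_mult[of "rep X" "rep Y"] rep_q[OF path_mult_keys[OF rep_paths rep_paths], of X Y]
  by (simp add: rep_paths)

lemma keys_scale_unit: "keys (scale c unit) \<subseteq> paths G"
  using keys_scale[of c unit] keys_unit by blast

lemma emb_P: "emb P c = q (scale c unit)"
  by (simp add: graded_quotient_simps q_def)

lemma idem_P: "idem P v = q (e v)"
  by (simp add: graded_quotient_simps q_def)

lemma emb_mult: "keys x \<subseteq> paths G \<Longrightarrow> emb P c \<otimes>\<^bsub>P\<^esub> q x = q (scale c x)"
  by (simp add: emb_P q_mult[symmetric] keys_scale_unit path_mult_scale unit_mult)

lemma mult_emb: "keys x \<subseteq> paths G \<Longrightarrow> q x \<otimes>\<^bsub>P\<^esub> emb P c = q (scale c x)"
  by (simp add: emb_P q_mult[symmetric] keys_scale_unit path_mult_scale mult_unit)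

lemma keys_scale_paths: "keys x \<subseteq> S \<Longrightarrow> keys (scale c x) \<subseteq> S"
  using keys_scale[of c x] by blast

lemma rep_emb_mult: "X \<in> carrier P \<Longrightarrow> rep (emb P c \<otimes>\<^bsub>P\<^esub> X) = scale c (rep X)"
  by (auto simp: carrier_P emb_mult keys_scale_paths)

lemma long_paths_subset: "keys (x :: _ \<Rightarrow>\<^sub>0 'k)  \<subseteq> long_paths d \<Longrightarrow> keys x \<subseteq> paths G"
  by (auto simp: long_paths_def)

lemma hpart_P: "hpart P d = q ` {x. keys x \<subseteq> long_paths d}"
  by (simp add: graded_quotient_simps q_def[abs_def] long_paths_def)

lemma nf_long_paths: "keys x \<subseteq> long_paths d \<Longrightarrow> keys (nf x) \<subseteq> long_paths d"
  by (rule nf_mem[OF long_paths_subset]) (auto simp: long_paths_def normal_paths_def)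

lemma hpartI: "keys x \<subseteq> long_paths d \<Longrightarrow> q x \<in> hpart P d"
  by (auto simp: hpart_P)

lemma hpart_iff: "X \<in> hpart P d \<longleftrightarrow> X \<in> carrier P \<and> keys (rep X) \<subseteq> long_paths d"
proof
  assume "X \<in> hpart P d"
  then obtain x where "X = q x" "keys x \<subseteq> long_paths d" by (auto simp: hpart_P)
  then show "X \<in> carrier P \<and> keys (rep X) \<subseteq> long_paths d"
    by (simp add: long_paths_subset nf_long_paths)
next
  assume "X \<in> carrier P \<and> keys (rep X) \<subseteq> long_paths d"
  then show "X \<in> hpart P d" using hpartI[of "rep X" d] by simp
qed

lemma path_mult_long:
  assumes "keys x \<subseteq> long_paths d" "keys y \<subseteq> long_paths d'"
  shows "keys (path_mult x y) \<subseteq> long_paths (d + d')"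
  unfolding path_mult_lext
  using assms by (intro lext_mono) (auto dest!: subsetD intro: path_append simp: long_paths_def split: if_splits)

lemma graded_ring_P: "graded_ring P"
proof (intro graded_ring.intro ring_P graded_ring_axioms.intro)
  fix x c assume "x \<in> carrier P"
  then show "x \<otimes>\<^bsub>P\<^esub> emb P c = emb P c \<otimes>\<^bsub>P\<^esub> x"
    by (auto simp: carrier_P emb_mult mult_emb)
next
  fix x y d d' assume "x \<in> hpart P d" "y \<in> hpart P d'"
  then show "x \<otimes>\<^bsub>P\<^esub> y \<in> hpart P (d + d')"
    by (auto simp: hpart_iff rep_mult path_mult_long nf_long_paths)
qed (auto simp: hpart_iff rep_add rep_minus emb_P keys_scale_unit keys_add_subset
    dest: keys_add[THEN subsetD])

sublocale P: graded_ring P by (rule graded_ring_P)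

lemma idem_hpart: "idem P v \<in> hpart P 0"
  unfolding idem_P by (intro hpartI) (auto simp: long_paths_def path_Nil)

lemma one_hpart: "\<one>\<^bsub>P\<^esub> \<in> hpart P 0"
  unfolding q_one
  by (intro hpartI) (auto simp: unit_def long_paths_def path_Nil dest!: keys_sum[THEN subsetD])

section \<open>The residue module\<close>

definition positive :: "('v, 'e) path set" where
  "positive = {(u, p, v). p \<noteq> []}"

definition deg_zero :: "(('v, 'e) path \<Rightarrow>\<^sub>0 'k) \<Rightarrow> (('v, 'e) path \<Rightarrow>\<^sub>0 'k)" where
  "deg_zero = lext (\<lambda>(u, p, v). if p = [] then single (u, p, v) 1 else 0)"

lemma deg_zero_linear: "deg_zero 0 = 0" "deg_zero (f + g) = deg_zero f + deg_zero g"
  "deg_zero (f - g) = deg_zero f - deg_zero g" "deg_zero (scale c f) = scale c (deg_zero f)"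
  by (simp_all add: deg_zero_def lext_add lext_diff lext_scale)

lemma deg_zero_keys: "keys f \<subseteq> S \<Longrightarrow> keys (deg_zero f) \<subseteq> {(u, p, v) \<in> S. p = []}"
  unfolding deg_zero_def by (rule lext_mono) (auto split: if_splits)

lemma lookup_deg_zero: "lookup (deg_zero f) (u, p, v) = (if p = [] then lookup f (u, p, v) else 0)"
proof (induction f rule: poly_mapping_induct[OF subset_UNIV])
  case (2 x c)
  then show ?case
    by (cases x rule: prod_cases3) (auto simp: deg_zero_def lookup_single when_def)
qed (auto simp: deg_zero_linear lookup_add)

lemma deg_zero_eq_0: "deg_zero f = 0 \<longleftrightarrow> keys f \<subseteq> positive"
proof
  assume "deg_zero f = 0"
  then have "lookup f (u, [], v) = 0" for u v
    using lookup_deg_zero[of f u "[]" v] by simp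
  then show "keys f \<subseteq> positive" by (auto simp: positive_def in_keys_iff)
next
  assume "keys f \<subseteq> positive"
  then have "lookup f (u, [], v) = 0" for u v
    by (auto simp: positive_def in_keys_iff)
  then show "deg_zero f = 0"
    by (intro poly_mapping_eqI) (metis lookup_deg_zero lookup_zero surj_pair)
qed

lemma nf_positive: "keys x \<subseteq> paths G \<Longrightarrow> keys x \<subseteq> positive \<Longrightarrow> keys (nf x) \<subseteq> positive"
  by (rule nf_mem) (auto simp: positive_def normal_paths_def)

lemma positive_part_P: "positive_part P = {X \<in> carrier P. keys (rep X) \<subseteq> positive}" (is "_ = ?S")
proof
  show "positive_part P \<subseteq> ?S"
  proof
    fix X assume "X \<in> positive_part P"
    then show "X \<in> ?S"
      unfolding positive_part_def
    proof (induction rule: generate.induct)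
      case (incl h)
      then show ?case by (auto simp: hpart_iff long_paths_def positive_def)
    next
      case (inv h)
      then obtain d where h: "h \<in> carrier P" "keys (rep h) \<subseteq> long_paths d" "d > 0"
        by (auto simp: hpart_iff)
      have "inv\<^bsub>add_monoid P\<^esub> h = \<ominus>\<^bsub>P\<^esub> h" by (simp add: a_inv_def)
      then show ?case using h by (auto simp: rep_minus long_paths_def positive_def)
    qed (auto simp: rep_add dest!: keys_add[THEN subsetD])
  qed
  have "q x \<in> generate (add_monoid P) (\<Union>d\<in>{0<..}. hpart P d)"
    if "keys x \<subseteq> paths G \<inter> positive" for x
  proof -
    have "keys x \<subseteq> paths G \<and> q x \<in> generate (add_monoid P) (\<Union>d\<in>{0<..}. hpart P d)"
      using that
    proof (induction x rule: poly_mapping_induct)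
      case zero
      then show ?case using generate.one[of "add_monoid P"] by (simp add: q_zero)
    next
      case (single x c)
      obtain u p v where x: "x = (u, p, v)" by (cases x rule: prod_cases3)
      then have "q (single x c) \<in> hpart P (length p)"
        using single by (intro hpartI) (auto simp: long_paths_def)
      then show ?case
        using single x by (auto simp: positive_def intro!: generate.incl)
    next
      case (add f g)
      then show ?case
        using generate.eng[of "q f" "add_monoid P" _ "q g"] by (simp add: q_add keys_add_subset)
    qed
    then show ?thesis by blast
  qed
  note gen = this
  show "?S \<subseteq> positive_part P"
  proof
    fix X assume "X \<in> ?S"
    then show "X \<in> positive_part P"
      using gen[of "rep X"] rep_paths[of X] by (simp add: positive_part_def)
  qed
qed

lemma path_mult_positive:
  assumes "keys x \<subseteq> positive \<or> keys y \<subseteq> positive"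
  shows "keys (path_mult x y) \<subseteq> positive"
  unfolding path_mult_lext
  using assms by (intro lext_mono) (fastforce simp: positive_def split: if_splits)

lemma ideal_positive_part: "ideal (positive_part P) P"
proof (rule idealI[OF ring_P])
  show "subgroup (positive_part P) (add_monoid P)"
    unfolding positive_part_P
  proof (rule group.subgroupI[OF P.a_group])
    have "\<zero>\<^bsub>P\<^esub> \<in> {X \<in> carrier P. keys (rep X) \<subseteq> positive}" by simp
    then show "{X \<in> carrier P. keys (rep X) \<subseteq> positive} \<noteq> {}" by blast
  next
    fix X Y
    assume "X \<in> {X \<in> carrier P. keys (rep X) \<subseteq> positive}" "Y \<in> {X \<in> carrier P. keys (rep X) \<subseteq> positive}"
    then show "X \<otimes>\<^bsub>add_monoid P\<^esub> Y \<in> {X \<in> carrier P. keys (rep X) \<subseteq> positive}"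
      by (simp add: rep_add keys_add_subset)
  next
    fix X assume X: "X \<in> {X \<in> carrier P. keys (rep X) \<subseteq> positive}"
    have "inv\<^bsub>add_monoid P\<^esub> X = \<ominus>\<^bsub>P\<^esub> X" by (simp add: a_inv_def)
    then show "inv\<^bsub>add_monoid P\<^esub> X \<in> {X \<in> carrier P. keys (rep X) \<subseteq> positive}"
      using X by (simp add: rep_minus)
  qed auto
next
  fix X Y assume "X \<in> positive_part P" "Y \<in> carrier P"
  then show "Y \<otimes>\<^bsub>P\<^esub> X \<in> positive_part P" "X \<otimes>\<^bsub>P\<^esub> Y \<in> positive_part P"
    unfolding positive_part_P
    by (simp_all add: rep_mult nf_positive path_mult_positive path_mult_keys rep_paths)
qed

abbreviation "R \<equiv> graded_quotient P (positive_part P)"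
abbreviation "RM \<equiv> residue_module P"

definition r where "r X = positive_part P +>\<^bsub>P\<^esub> X"

sublocale R: ring R by (rule graded_quotient_ring(1)[OF ideal_positive_part])

lemma r_hom: "r \<in> ring_hom P R"
  using graded_quotient_ring(2)[OF ideal_positive_part] by (simp add: r_def[abs_def])

lemma carrier_R: "carrier R = r ` carrier P"
  by (simp add: graded_quotient_simps(1)[of P] r_def[abs_def])

lemma r_add: "X \<in> carrier P \<Longrightarrow> Y \<in> carrier P \<Longrightarrow> r (X \<oplus>\<^bsub>P\<^esub> Y) = r X \<oplus>\<^bsub>R\<^esub> r Y"
  by (rule ring_hom_add[OF r_hom])

lemma r_mult: "X \<in> carrier P \<Longrightarrow> Y \<in> carrier P \<Longrightarrow> r (X \<otimes>\<^bsub>P\<^esub> Y) = r X \<otimes>\<^bsub>R\<^esub> r Y"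
  by (rule ring_hom_mult[OF r_hom])

lemma r_zero: "\<zero>\<^bsub>R\<^esub> = r \<zero>\<^bsub>P\<^esub>"
  using graded_quotient_zero[OF ideal_positive_part] by (simp add: r_def)

lemma r_closed: "X \<in> carrier P \<Longrightarrow> r X \<in> carrier R"
  by (simp add: carrier_R)

lemma r_minus: "X \<in> carrier P \<Longrightarrow> \<ominus>\<^bsub>R\<^esub> r X = r (\<ominus>\<^bsub>P\<^esub> X)"
  by (intro R.minus_equality) (auto simp: r_add[symmetric] P.l_neg r_zero r_closed)

lemma r_eq:
  assumes "X \<in> carrier P" "Y \<in> carrier P"
  shows "r X = r Y \<longleftrightarrow> deg_zero (rep X) = deg_zero (rep Y)"
proof -
  have "r X = r Y \<longleftrightarrow> keys (rep X - rep Y) \<subseteq> positive"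
    using graded_quotient_eq[OF ideal_positive_part assms] assms
    by (simp add: r_def positive_part_P rep_diff)
  then show ?thesis by (simp add: deg_zero_eq_0[symmetric] deg_zero_linear)
qed

lemma RM_simps [simp]:
  "carrier RM = carrier R" "zero RM = zero R" "add RM = add R"
  "smult RM a x = r a \<otimes>\<^bsub>R\<^esub> x" "mpart RM d = r ` hpart P d"
  by (simp_all add: residue_module_def Let_def r_def[abs_def] graded_quotient_simps(4)[of P])

lemma RM_module: "graded_left_module P RM"
proof -
  have ab: "abelian_group RM"
  proof (rule abelian_groupI)
    fix x assume "x \<in> carrier RM"
    then show "\<exists>y\<in>carrier RM. y \<oplus>\<^bsub>RM\<^esub> x = \<zero>\<^bsub>RM\<^esub>"
      using R.l_neg by (intro bexI[of _ "\<ominus>\<^bsub>R\<^esub> x"]) auto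
  qed (auto simp: R.a_ac)
  interpret RM: abelian_group RM by fact
  have minus: "\<ominus>\<^bsub>RM\<^esub> x = \<ominus>\<^bsub>R\<^esub> x" if "x \<in> carrier R" for x
    using that R.l_neg by (intro RM.minus_equality) auto
  show ?thesis
  proof (intro graded_left_module.intro graded_ring_P ab graded_left_module_axioms.intro)
    fix x y d assume "x \<in> mpart RM d" "y \<in> mpart RM d"
    then show "x \<oplus>\<^bsub>RM\<^esub> y \<in> mpart RM d"
      by (auto simp: P.hpart_closed r_add[symmetric] P.hpart_add)
  next
    fix x d assume "x \<in> mpart RM d"
    then show "\<ominus>\<^bsub>RM\<^esub> x \<in> mpart RM d"
      by (auto simp: minus P.hpart_closed r_minus P.hpart_minus r_closed)
  next
    fix a x d e assume "a \<in> hpart P d" "x \<in> mpart RM e"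
    then show "a \<odot>\<^bsub>RM\<^esub> x \<in> mpart RM (d + e)"
      by (auto simp: P.hpart_closed r_mult[symmetric] P.hpart_mult)
  qed (auto simp: r_closed r_add r_mult R.r_distr R.l_distr R.m_assoc P.hpart_closed r_zero P.hpart_zero)
qed

lemma RM_mpart: "s \<noteq> 0 \<Longrightarrow> mpart RM s = {\<zero>\<^bsub>RM\<^esub>}"
proof -
  assume s: "s \<noteq> 0"
  have "r X = r \<zero>\<^bsub>P\<^esub>" if "X \<in> hpart P s" for X
  proof -
    have "deg_zero (rep X) = 0"
      using that s by (subst deg_zero_eq_0) (auto simp: hpart_iff long_paths_def positive_def)
    then show ?thesis using that P.hpart_closed[of X s] by (simp add: r_eq deg_zero_def)
  qed
  then have "r ` hpart P s = (\<lambda>_. r \<zero>\<^bsub>P\<^esub>) ` hpart P s" by (rule image_cong[OF refl])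
  also have "\<dots> = {r \<zero>\<^bsub>P\<^esub>}" using P.hpart_zero by blast
  finally show ?thesis by (simp add: r_zero)
qed

text \<open>
  The degree-zero part of the normal representative does not depend on the chosen preimage in the
  algebra, by \<open>r_eq\<close>.
\<close>

definition sec_zero :: "(('v, 'e) path \<Rightarrow>\<^sub>0 'k) set set \<Rightarrow> (('v, 'e) path \<Rightarrow>\<^sub>0 'k) set" where
  "sec_zero Z = q (deg_zero (rep (SOME X. X \<in> carrier P \<and> r X = Z)))"

lemma sec_zero_r:
  assumes X: "X \<in> carrier P"
  shows "sec_zero (r X) = q (deg_zero (rep X))"
proof -
  define Y where "Y = (SOME Y. Y \<in> carrier P \<and> r Y = r X)"
  have "Y \<in> carrier P \<and> r Y = r X"
    unfolding Y_def by (rule someI[of "\<lambda>Y. Y \<in> carrier P \<and> r Y = r X" X]) (simp add: X)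
  then show ?thesis using X r_eq[of Y X] by (simp add: sec_zero_def Y_def)
qed

lemma deg_zero_normal: "X \<in> carrier P \<Longrightarrow> keys (deg_zero (rep X)) \<subseteq> all_normal"
  using deg_zero_keys[OF rep_keys] by blast

lemma deg_zero_rep_paths: "X \<in> carrier P \<Longrightarrow> keys (deg_zero (rep X)) \<subseteq> paths G"
  using deg_zero_normal all_normal_paths by blast

lemma deg_zero_idem: "deg_zero (deg_zero f) = deg_zero f"
  by (intro poly_mapping_eqI) (metis lookup_deg_zero surj_pair)

lemma syzygy_residue:
  "syzygy P (regular_module P) RM {()} (\<lambda>_. 0) (\<lambda>_. \<one>\<^bsub>P\<^esub>) (\<lambda>_ x. x) RM r sec_zero"
proof -
  interpret reg: graded_left_module P "regular_module P" by (rule P.regular_module)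
  interpret RM: graded_left_module P RM by (rule RM_module)
  show ?thesis
  proof (unfold_locales)
    show "dual_basis P (regular_module P) {()} (\<lambda>_. 0) (\<lambda>_. \<one>\<^bsub>P\<^esub>) (\<lambda>_ x. x)"
      using one_hpart by (rule P.regular_dual_basis)
  next
    fix m assume "m \<in> carrier RM"
    then show "sec_zero m \<in> carrier (regular_module P)"
      by (auto simp: carrier_R sec_zero_r deg_zero_rep_paths)
  next
    fix m m' assume "m \<in> carrier RM" "m' \<in> carrier RM"
    then show "sec_zero (m \<oplus>\<^bsub>RM\<^esub> m') = sec_zero m \<oplus>\<^bsub>regular_module P\<^esub> sec_zero m'"
      by (auto simp: carrier_R r_add[symmetric] sec_zero_r deg_zero_linear rep_add q_add deg_zero_rep_paths)
  next
    fix m c assume "m \<in> carrier RM"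
    then show "sec_zero (emb P c \<odot>\<^bsub>RM\<^esub> m) = emb P c \<odot>\<^bsub>regular_module P\<^esub> sec_zero m"
      by (auto simp: carrier_R r_mult[symmetric] sec_zero_r deg_zero_linear rep_emb_mult emb_mult deg_zero_rep_paths)
  next
    fix m e' assume "m \<in> mpart RM e'"
    then obtain X where X: "m = r X" "X \<in> hpart P e'" by auto
    have "keys (deg_zero (rep X)) \<subseteq> long_paths e'"
      using X deg_zero_keys[of "rep X" "long_paths e'"] by (auto simp: hpart_iff)
    then show "sec_zero m \<in> mpart (regular_module P) e'"
      using X by (auto simp: sec_zero_r P.hpart_closed hpartI)
  next
    fix m assume "m \<in> carrier RM"
    then obtain X where X: "m = r X" "X \<in> carrier P" by (auto simp: carrier_R)
    then have "r (q (deg_zero (rep X))) = r X"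
      by (subst r_eq) (simp_all add: deg_zero_rep_paths deg_zero_normal nf_normal deg_zero_idem)
    then show "r (sec_zero m) = m" using X by (simp add: sec_zero_r)
  qed (auto simp: r_closed r_add r_mult)
qed

section \<open>Stripping the first arc\<close>

text \<open>
  The paths that begin with the arc \<open>c\<close>, without this arc. In a product the first arc of a path is the
  rightmost factor, so this inverts right multiplication by \<open>c\<close>.
\<close>

definition strip :: "'e \<Rightarrow> (('v, 'e) path \<Rightarrow>\<^sub>0 'k) \<Rightarrow> (('v, 'e) path \<Rightarrow>\<^sub>0 'k)" where
  "strip c = lext (\<lambda>(u, p, v). if p \<noteq> [] \<and> hd p = c then single (head G c, tl p, v) 1 else 0)"

definition starting :: "'v \<Rightarrow> ('v, 'e) path set" where
  "starting w = {(u, p, v) \<in> all_normal. u = w}"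

lemma starting_normal: "keys f \<subseteq> starting w \<Longrightarrow> keys f \<subseteq> all_normal"
  by (auto simp: starting_def)

lemma starting_paths: "keys f \<subseteq> starting w \<Longrightarrow> keys f \<subseteq> paths G"
  using starting_normal all_normal_paths by blast

lemma nf_starting: "keys f \<subseteq> starting w \<Longrightarrow> keys (nf f) \<subseteq> starting w"
  using nf_normal[OF starting_normal] by simp

lemma strip_linear: "strip c 0 = 0" "strip c (f + g) = strip c f + strip c g"
  "strip c (f - g) = strip c f - strip c g" "strip c (scale k f) = scale k (strip c f)"
  by (simp_all add: strip_def lext_add lext_diff lext_scale)

lemma strip_starting:
  assumes "keys f \<subseteq> all_normal"
  shows "keys (strip c f) \<subseteq> starting (head G c)"
  unfolding strip_def
proof (rule lext_mono)
  fix x assume x: "x \<in> keys f"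
  obtain u p v where p: "x = (u, p, v)" by (cases x rule: prod_cases3)
  then have "(u, p, v) \<in> paths G" "normal p" using x assms by (auto simp: all_normal_def)
  then show "keys (case x of (u, p, v) \<Rightarrow> if p \<noteq> [] \<and> hd p = c then single (head G c, tl p, v) 1 else 0)
      \<subseteq> starting (head G c)"
    using p by (cases p) (auto simp: starting_def all_normal_def path_Cons_iff normal_Cons)
qed

lemma strip_long:
  assumes "keys f \<subseteq> long_paths (Suc d)"
  shows "keys (strip c f) \<subseteq> long_paths d"
  unfolding strip_def
proof (rule lext_mono)
  fix x assume x: "x \<in> keys f"
  obtain u p v where p: "x = (u, p, v)" by (cases x rule: prod_cases3)
  then have "(u, p, v) \<in> paths G" "length p = Suc d" using x assms by (auto simp: long_paths_def)
  then show "keys (case x of (u, p, v) \<Rightarrow> if p \<noteq> [] \<and> hd p = c then single (head G c, tl p, v) 1 else 0)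
      \<subseteq> long_paths d"
    using p by (cases p) (auto simp: long_paths_def path_Cons_iff)
qed

lemma strip_long_0: "keys f \<subseteq> long_paths 0 \<Longrightarrow> strip c f = 0"
proof -
  assume f: "keys f \<subseteq> long_paths 0"
  have "strip c f = lext (\<lambda>_. 0) f"
    unfolding strip_def using f by (intro lext_cong) (auto simp: long_paths_def)
  then show ?thesis by (simp add: lext_def)
qed

lemma arrow_mult_single: "path_mult (single (u, p, v) c) (arrow G a)
    = (if u = head G a then single (tail G a, a # p, v) c else 0)"
  by (auto simp: arrow_def path_mult_single)

lemma strip_sum:
  assumes "keys f \<subseteq> paths G \<inter> positive"
  shows "(\<Sum>a\<in>arcs G. path_mult (strip a f) (arrow G a)) = f"
  using assms
proof (induction f rule: poly_mapping_induct)
  case (single x c)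
  then obtain u a p v where x: "x = (u, a # p, v)"
    by (auto simp: positive_def) (metis neq_Nil_conv)
  have a: "a \<in> arcs G" "u = tail G a" using single x by (auto simp: path_Cons_iff)
  have "(\<Sum>a'\<in>arcs G. path_mult (strip a' (single x c)) (arrow G a'))
    = (\<Sum>a'\<in>arcs G. if a' = a then single x c else 0)"
    using a by (intro sum.cong) (auto simp: strip_def x path_mult_scale arrow_mult_single)
  then show ?case using a by simp
next
  case (add f g)
  then show ?case by (simp add: strip_linear path_mult_add_left sum.distrib)
qed (simp add: strip_linear)

lemma strip_mult:
  assumes "keys f \<subseteq> starting (head G a)"
  shows "strip c (path_mult f (arrow G a)) = (if c = a then f else 0)"
  using assms
proof (induction f rule: poly_mapping_induct)
  case (single x k)
  then obtain p v where "x = (head G a, p, v)" by (auto simp: starting_def)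
  then show ?case by (auto simp: arrow_mult_single strip_def)
qed (auto simp: strip_linear path_mult_add_left)

lemma lookup_strip:
  assumes "keys f \<subseteq> paths G"
  shows "lookup (strip c f) (head G c, p, v) = lookup f (tail G c, c # p, v)"
  using assms
proof (induction f rule: poly_mapping_induct)
  case (single x k)
  obtain u q v' where x: "x = (u, q, v')" by (cases x rule: prod_cases3)
  show ?case
  proof (cases q)
    case (Cons a q')
    then show ?thesis
      using x single by (auto simp: strip_def lookup_single when_def path_Cons_iff)
  qed (auto simp: x strip_def lookup_single when_def)
qed (auto simp: strip_linear lookup_add)

text \<open>
  Prefixing \<open>a\<close> can only create a leading monomial at the beginning of a path, so only \<open>a = b i\<close> followed
  by \<open>opp (b i)\<close> has to be excluded.
\<close>

lemma mult_arrow_normal: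
  assumes f: "keys f \<subseteq> starting (head G a)" and a: "a \<in> arcs G"
    and free: "\<And>i. i \<notin> J \<Longrightarrow> a = b i \<Longrightarrow> strip (opp (b i)) f = 0"
  shows "keys (path_mult f (arrow G a)) \<subseteq> all_normal"
proof
  fix y assume y: "y \<in> keys (path_mult f (arrow G a))"
  have "path_mult f (arrow G a) = lext (\<lambda>(u, p, v). single (tail G a, a # p, v) 1) f"
    unfolding arrow_def path_mult_lext using f by (intro lext_cong) (auto simp: starting_def)
  then obtain x where x: "x \<in> keys f" "y \<in> keys (case x of (u, p, v) \<Rightarrow> single (tail G a, a # p, v) (1::'k))"
    using y keys_lext[of _ f] by fastforce
  then obtain p v where p: "x = (head G a, p, v)" "(head G a, p, v) \<in> paths G" "normal p"
    using f by (auto simp: starting_def all_normal_def)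
  have y': "y = (tail G a, a # p, v)" using x p by auto
  have "\<not> (p \<noteq> [] \<and> forbidden a (hd p))"
  proof
    assume *: "p \<noteq> [] \<and> forbidden a (hd p)"
    then obtain i where i: "i \<notin> J" "a = b i" "hd p = opp (b i)" by (auto simp: forbidden_def)
    then obtain p' where p': "p = opp (b i) # p'" using * by (cases p) auto
    have "lookup f (head G a, p, v) = lookup (strip (opp (b i)) f) (head G (opp (b i)), p', v)"
      using i a lookup_strip[OF starting_paths[OF f], of "opp (b i)" p' v] by (simp add: p' tail_opp)
    also have "\<dots> = 0" using free[OF i(1,2)] by simp
    finally show False using x p by (simp add: in_keys_iff)
  qed
  then show "y \<in> all_normal"
    using p a by (auto simp: y' all_normal_def path_Cons_iff normal_Cons)
qed

lemma mult_idem: "path_mult f (e w) = lext (\<lambda>(u, p, v). if u = w then single (u, p, v) 1 else 0) f"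
proof (induction f rule: poly_mapping_induct[OF subset_UNIV])
  case (2 x c)
  then show ?case by (cases x rule: prod_cases3) (auto simp: path_mult_single)
qed (auto simp: path_mult_add_left lext_add)

lemma mult_idem_starting: "keys f \<subseteq> starting w \<Longrightarrow> path_mult f (e w) = f"
  unfolding mult_idem by (rule lext_id) (auto simp: starting_def)

lemma idem_fixed_iff:
  assumes X: "X \<in> carrier P"
  shows "X \<otimes>\<^bsub>P\<^esub> idem P w = X \<longleftrightarrow> keys (rep X) \<subseteq> starting w"
proof -
  have ew: "keys (e w) \<subseteq> paths G" by (simp add: path_Nil)
  have k: "keys (path_mult (rep X) (e w)) \<subseteq> starting w"
    unfolding mult_idem using rep_keys[OF X] by (intro lext_mono) (auto simp: starting_def split: if_splits)
  have "X \<otimes>\<^bsub>P\<^esub> idem P w = q (path_mult (rep X) (e w))"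
    using X ew by (simp add: idem_P q_mult rep_paths)
  then have "rep (X \<otimes>\<^bsub>P\<^esub> idem P w) = path_mult (rep X) (e w)"
    using rep_q_normal[OF starting_normal[OF k]] by simp
  moreover have "X \<otimes>\<^bsub>P\<^esub> idem P w \<in> carrier P"
    using X q_closed[OF ew] by (simp add: idem_P)
  ultimately have "X \<otimes>\<^bsub>P\<^esub> idem P w = X \<longleftrightarrow> path_mult (rep X) (e w) = rep X"
    using X rep_inject by metis
  then show ?thesis using k mult_idem_starting by metis
qed

section \<open>The syzygies of the ideal of positive degree\<close>

definition pos_module where
  "pos_module = submodule (regular_module P) {x \<in> carrier (regular_module P). r x = \<zero>\<^bsub>RM\<^esub>}"

lemma r_zero_iff: "X \<in> carrier P \<Longrightarrow> r X = \<zero>\<^bsub>R\<^esub> \<longleftrightarrow> keys (rep X) \<subseteq> positive"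
  by (simp add: r_zero r_eq deg_zero_linear deg_zero_eq_0)

lemma pos_module_simps:
  "carrier pos_module = {X \<in> carrier P. keys (rep X) \<subseteq> positive}" "add pos_module = add P"
  "zero pos_module = zero P" "smult pos_module = mult P"
  "mpart pos_module d = hpart P d \<inter> {X \<in> carrier P. keys (rep X) \<subseteq> positive}"
  by (simp_all add: pos_module_def r_zero_iff cong: conj_cong)

lemma pos_module: "graded_left_module P pos_module"
  unfolding pos_module_def using syzygy.K_module[OF syzygy_residue] by simp

abbreviation "col \<equiv> column_module P (arcs G) (\<lambda>a. idem P (head G a))"

lemma col_module: "graded_left_module P col"
  using idem_hpart P.hpart_closed by (intro P.column_module) blast

lemma col_iff: "y \<in> carrier col \<longleftrightarrow>
    (\<forall>a. if a \<in> arcs G then y a \<in> carrier P \<and> keys (rep (y a)) \<subseteq> starting (head G a) else y a = \<zero>\<^bsub>P\<^esub>)"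
  unfolding column_carrier using idem_fixed_iff by metis

lemma col_apply: "y \<in> carrier col \<Longrightarrow> y a \<in> carrier P"
  by (rule P.column_apply)

lemma arrow_closed: "a \<in> arcs G \<Longrightarrow> q (arrow G a) \<in> carrier P"
  using arrow_keys[of a] by (intro q_closed)

lemma arrow_hpart: "a \<in> arcs G \<Longrightarrow> q (arrow G a) \<in> hpart P 1"
  by (intro hpartI) (auto simp: arrow_def long_paths_def path_Cons_iff path_Nil_iff)

text \<open>
  A column stands for coefficients of the arcs. The section collects the paths by their first
  arc.
\<close>

definition prj_col :: "('e \<Rightarrow> (('v, 'e) path \<Rightarrow>\<^sub>0 'k) set) \<Rightarrow> (('v, 'e) path \<Rightarrow>\<^sub>0 'k) set" where
  "prj_col y = (\<Oplus>\<^bsub>P\<^esub>a\<in>arcs G. y a \<otimes>\<^bsub>P\<^esub> q (arrow G a))"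

definition sec_col :: "(('v, 'e) path \<Rightarrow>\<^sub>0 'k) set \<Rightarrow> 'e \<Rightarrow> (('v, 'e) path \<Rightarrow>\<^sub>0 'k) set" where
  "sec_col X = (\<lambda>a. if a \<in> arcs G then q (strip a (rep X)) else \<zero>\<^bsub>P\<^esub>)"

lemma prj_col_q:
  assumes "\<And>a. a \<in> arcs G \<Longrightarrow> keys (f a) \<subseteq> paths G" "\<And>a. a \<in> arcs G \<Longrightarrow> y a = q (f a)"
  shows "prj_col y = q (\<Sum>a\<in>arcs G. path_mult (f a) (arrow G a))"
proof -
  have "prj_col y = (\<Oplus>\<^bsub>P\<^esub>a\<in>arcs G. q (path_mult (f a) (arrow G a)))"
    unfolding prj_col_def
    by (rule P.finsum_cong') (simp_all add: Pi_iff path_mult_keys arrow_keys q_mult assms)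
  then show ?thesis by (simp add: q_sum path_mult_keys arrow_keys assms)
qed

lemma prj_col_rep:
  "y \<in> carrier col \<Longrightarrow> prj_col y = q (\<Sum>a\<in>arcs G. path_mult (rep (y a)) (arrow G a))"
  by (rule prj_col_q) (simp_all add: rep_paths col_apply)

lemma prj_col_closed: "y \<in> carrier col \<Longrightarrow> prj_col y \<in> carrier P"
  unfolding prj_col_def by (rule P.finsum_closed) (simp add: Pi_iff col_apply arrow_closed)

lemma prj_col_add:
  assumes "x \<in> carrier col" "y \<in> carrier col"
  shows "prj_col (x \<oplus>\<^bsub>col\<^esub> y) = prj_col x \<oplus>\<^bsub>P\<^esub> prj_col y"
proof -
  have t: "(\<lambda>a. x a \<otimes>\<^bsub>P\<^esub> q (arrow G a)) \<in> arcs G \<rightarrow> carrier P" "(\<lambda>a. y a \<otimes>\<^bsub>P\<^esub> q (arrow G a)) \<in> arcs G \<rightarrow> carrier P"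
    by (simp_all add: Pi_iff assms col_apply arrow_closed)
  have "prj_col (x \<oplus>\<^bsub>col\<^esub> y) = (\<Oplus>\<^bsub>P\<^esub>a\<in>arcs G. x a \<otimes>\<^bsub>P\<^esub> q (arrow G a) \<oplus>\<^bsub>P\<^esub> y a \<otimes>\<^bsub>P\<^esub> q (arrow G a))"
    unfolding prj_col_def
    by (rule P.finsum_cong') (simp_all add: Pi_iff assms col_apply arrow_closed P.l_distr)
  then show ?thesis using P.finsum_addf[OF t] by (simp add: prj_col_def)
qed

lemma prj_col_smult:
  assumes "X \<in> carrier P" "y \<in> carrier col"
  shows "prj_col (X \<odot>\<^bsub>col\<^esub> y) = X \<otimes>\<^bsub>P\<^esub> prj_col y"
proof -
  have t: "(\<lambda>a. y a \<otimes>\<^bsub>P\<^esub> q (arrow G a)) \<in> arcs G \<rightarrow> carrier P"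
    by (simp_all add: Pi_iff assms col_apply arrow_closed)
  have "prj_col (X \<odot>\<^bsub>col\<^esub> y) = (\<Oplus>\<^bsub>P\<^esub>a\<in>arcs G. X \<otimes>\<^bsub>P\<^esub> (y a \<otimes>\<^bsub>P\<^esub> q (arrow G a)))"
    unfolding prj_col_def
    by (rule P.finsum_cong') (simp_all add: Pi_iff assms col_apply arrow_closed P.m_assoc)
  then show ?thesis using P.finsum_rdistr[OF _ assms(1) t] by (simp add: prj_col_def)
qed

lemma sum_arrow_positive:
  "keys (\<Sum>a\<in>arcs G. path_mult (f a) (arrow G a)) \<subseteq> positive"
  by (intro keys_sum_subset path_mult_positive disjI2) (auto simp: arrow_def positive_def)

lemma sum_arrow_paths:
  "(\<And>a. a \<in> arcs G \<Longrightarrow> keys (f a) \<subseteq> paths G) \<Longrightarrow>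
    keys (\<Sum>a\<in>arcs G. path_mult (f a :: _ \<Rightarrow>\<^sub>0 'k) (arrow G a)) \<subseteq> paths G"
  by (intro keys_sum_subset path_mult_keys arrow_keys)

lemma prj_col_pos: "y \<in> carrier col \<Longrightarrow> prj_col y \<in> carrier pos_module"
  using prj_col_closed[of y] sum_arrow_paths[of "\<lambda>a. rep (y a)"]
  by (simp add: col_apply pos_module_simps prj_col_rep rep_paths nf_positive sum_arrow_positive)

lemma prj_col_mpart: "y \<in> mpart col d \<Longrightarrow> prj_col y \<in> mpart pos_module d"
proof -
  assume y: "y \<in> mpart col d"
  then have c: "y \<in> carrier col" by (simp add: column_mpart)
  have "keys (path_mult (rep (y a)) (arrow G a)) \<subseteq> long_paths d" if "a \<in> arcs G" for a
  proof (cases d)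
    case 0
    then have "y a = \<zero>\<^bsub>P\<^esub>" using y that by (simp add: column_mpart)
    then show ?thesis by simp
  next
    case (Suc k)
    then have "keys (rep (y a)) \<subseteq> long_paths k" "keys (arrow G a :: _ \<Rightarrow>\<^sub>0 'k) \<subseteq> long_paths 1"
      using y that by (auto simp: column_mpart hpart_iff arrow_def long_paths_def path_Cons_iff path_Nil_iff)
    then show ?thesis using path_mult_long Suc by force
  qed
  then have "prj_col y \<in> hpart P d"
    unfolding prj_col_rep[OF c] by (intro hpartI keys_sum_subset)
  then show ?thesis using prj_col_pos[OF c] by (simp add: pos_module_simps)
qed

lemma sec_col_closed: "X \<in> carrier P \<Longrightarrow> sec_col X \<in> carrier col"
  using strip_starting[OF rep_keys] starting_paths[OF strip_starting[OF rep_keys]]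
  by (simp add: col_iff sec_col_def nf_starting)

lemma strip_rep_paths: "X \<in> carrier P \<Longrightarrow> keys (strip a (rep X)) \<subseteq> paths G"
  using starting_paths[OF strip_starting[OF rep_keys]] .

lemma prj_sec_col: "X \<in> carrier pos_module \<Longrightarrow> prj_col (sec_col X) = X"
proof -
  assume X: "X \<in> carrier pos_module"
  then have "prj_col (sec_col X) = q (\<Sum>a\<in>arcs G. path_mult (strip a (rep X)) (arrow G a))"
    by (intro prj_col_q) (simp_all add: pos_module_simps strip_rep_paths sec_col_def)
  also have "\<dots> = X"
    using X rep_paths[of X] by (subst strip_sum) (simp_all add: pos_module_simps)
  finally show ?thesis .
qed

lemma syzygy_pos:
  "syzygy P col RM (arcs G) (\<lambda>_. 1) (\<lambda>j i. if i = j then idem P (head G j) else \<zero>\<^bsub>P\<^esub>)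
    (\<lambda>j y. y j) pos_module prj_col sec_col"
proof -
  interpret C: graded_left_module P col by (rule col_module)
  interpret RM: graded_left_module P RM by (rule RM_module)
  interpret M: graded_left_module P pos_module by (rule pos_module)
  have idem: "idem P v \<otimes>\<^bsub>P\<^esub> idem P v = idem P v" for v
    unfolding idem_P by (subst q_mult[symmetric]) (simp_all add: path_Nil path_mult_single)
  show ?thesis
  proof (unfold_locales)
    show "dual_basis P col (arcs G) (\<lambda>_. 1) (\<lambda>j i. if i = j then idem P (head G j) else \<zero>\<^bsub>P\<^esub>) (\<lambda>j y. y j)"
      using idem_hpart idem by (intro P.column_dual_basis) auto
  next
    fix x assume "x \<in> carrier col" then show "prj_col x \<in> carrier pos_module" by (rule prj_col_pos)
  next
    fix x y assume "x \<in> carrier col" "y \<in> carrier col"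
    then show "prj_col (x \<oplus>\<^bsub>col\<^esub> y) = prj_col x \<oplus>\<^bsub>pos_module\<^esub> prj_col y"
      unfolding pos_module_simps by (rule prj_col_add)
  next
    fix X y assume "X \<in> carrier P" "y \<in> carrier col"
    then show "prj_col (X \<odot>\<^bsub>col\<^esub> y) = X \<odot>\<^bsub>pos_module\<^esub> prj_col y"
      unfolding pos_module_simps by (rule prj_col_smult)
  next
    fix x d assume "x \<in> mpart col d" then show "prj_col x \<in> mpart pos_module d" by (rule prj_col_mpart)
  next
    fix m assume "m \<in> carrier pos_module"
    then show "sec_col m \<in> carrier col" by (simp add: pos_module_simps sec_col_closed)
  next
    fix m m' assume "m \<in> carrier pos_module" "m' \<in> carrier pos_module"
    then show "sec_col (m \<oplus>\<^bsub>pos_module\<^esub> m') = sec_col m \<oplus>\<^bsub>col\<^esub> sec_col m'"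
      by (simp add: fun_eq_iff pos_module_simps sec_col_def rep_add strip_linear q_add strip_rep_paths)
  next
    fix m c assume "m \<in> carrier pos_module"
    then show "sec_col (emb P c \<odot>\<^bsub>pos_module\<^esub> m) = emb P c \<odot>\<^bsub>col\<^esub> sec_col m"
      by (simp add: fun_eq_iff pos_module_simps sec_col_def rep_emb_mult strip_linear emb_mult strip_rep_paths)
  next
    fix m d assume m: "m \<in> mpart pos_module d"
    then have c: "m \<in> carrier P" and h: "keys (rep m) \<subseteq> long_paths d"
      by (auto simp: pos_module_simps hpart_iff)
    show "sec_col m \<in> mpart col d"
      unfolding column_mpart
    proof (intro conjI ballI sec_col_closed[OF c])
      fix i assume "i \<in> arcs G"
      then show "case d of 0 \<Rightarrow> sec_col m i = \<zero>\<^bsub>P\<^esub> | Suc k \<Rightarrow> sec_col m i \<in> hpart P k"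
        using h by (cases d) (simp_all add: sec_col_def strip_long_0 q_zero strip_long hpartI)
    qed
  next
    fix m assume "m \<in> carrier pos_module" then show "prj_col (sec_col m) = m" by (rule prj_sec_col)
  qed
qed

definition rel_module where
  "rel_module = submodule col {y \<in> carrier col. prj_col y = \<zero>\<^bsub>pos_module\<^esub>}"

lemma rel_module_simps:
  "carrier rel_module = {y \<in> carrier col. prj_col y = \<zero>\<^bsub>P\<^esub>}" "add rel_module = add col"
  "zero rel_module = zero col" "smult rel_module = smult col"
  "mpart rel_module d = mpart col d \<inter> {y \<in> carrier col. prj_col y = \<zero>\<^bsub>P\<^esub>}"
  by (simp_all add: rel_module_def pos_module_simps)

lemma rel_module: "graded_left_module P rel_module"
  unfolding rel_module_def using syzygy.K_module[OF syzygy_pos] by simp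

text \<open>
  The syzygy that comes from the relation at \<open>i\<close>, and the coordinate with respect to it: it is read off at
  the leading arc, from the paths that continue with \<open>opp (b i)\<close>.
\<close>

definition rel_col :: "'v \<Rightarrow> 'e \<Rightarrow> (('v, 'e) path \<Rightarrow>\<^sub>0 'k) set" where
  "rel_col i a = (if a \<in> arcs G \<and> tail G a = i then q (scale (eps a) (arrow G (opp a))) else \<zero>\<^bsub>P\<^esub>)"

definition rel_crd :: "'v \<Rightarrow> ('e \<Rightarrow> (('v, 'e) path \<Rightarrow>\<^sub>0 'k) set) \<Rightarrow> (('v, 'e) path \<Rightarrow>\<^sub>0 'k) set" where
  "rel_crd i y = q (scale (inverse (eps (b i))) (strip (opp (b i)) (rep (y (b i)))))"

lemma scaled_arrow_long: "a \<in> arcs G \<Longrightarrow> keys (scale c (arrow G (opp a))) \<subseteq> long_paths 1"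
  by (intro keys_scale_paths) (auto simp: arrow_def long_paths_def path_Cons_iff path_Nil_iff opp_arc)

lemma scaled_arrow_paths: "a \<in> arcs G \<Longrightarrow> keys (scale (c :: 'k) (arrow G (opp a))) \<subseteq> paths G"
  by (rule long_paths_subset[OF scaled_arrow_long])

lemma scaled_arrow_starting: "a \<in> arcs G \<Longrightarrow> keys (scale c (arrow G (opp a))) \<subseteq> starting (head G a)"
  by (intro keys_scale_paths)
    (auto simp: arrow_def starting_def all_normal_def path_Cons_iff path_Nil_iff opp_arc tail_opp normal_Cons)

lemma rel_col_closed: "rel_col i \<in> carrier col"
  using nf_starting[OF scaled_arrow_starting] by (simp add: col_iff rel_col_def scaled_arrow_paths)

text \<open>
  The column of \<open>i\<close> is sent to the component of the relation at \<open>i\<close>.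
\<close>

lemma prj_rel_col: "i \<notin> J \<Longrightarrow> prj_col (rel_col i) = \<zero>\<^bsub>P\<^esub>"
proof -
  assume i: "i \<notin> J"
  let ?f = "\<lambda>a. if tail G a = i then scale (eps a) (arrow G (opp a)) else 0"
  have "prj_col (rel_col i) = q (\<Sum>a\<in>arcs G. path_mult (?f a) (arrow G a))"
    by (intro prj_col_q) (auto simp: rel_col_def q_zero scaled_arrow_paths[THEN subsetD])
  also have "(\<Sum>a\<in>arcs G. path_mult (?f a) (arrow G a)) = path_mult relation (e i)"
    unfolding relation_def path_mult_sum_left
    using i by (intro sum.mono_neutral_cong_right)
      (auto simp: path_mult_single arrow_def path_mult_scale tail_opp head_opp split: if_splits)
  also have "q \<dots> = \<zero>\<^bsub>P\<^esub>"
    using rel_ideal_right[OF relation_in_ideal, of "e i"] relation_carrier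
    by (simp add: q_zero q_eq path_Nil path_mult_keys nf_rel_ideal)
  finally show ?thesis .
qed

lemma rel_col_mpart: "i \<notin> J \<Longrightarrow> rel_col i \<in> mpart rel_module 2"
proof -
  assume i: "i \<notin> J"
  have "rel_col i a \<in> hpart P 1" for a
    using hpartI[OF scaled_arrow_long] P.hpart_zero by (simp add: rel_col_def)
  then show ?thesis
    using rel_col_closed prj_rel_col[OF i]
    by (auto simp: rel_module_simps column_mpart numeral_2_eq_2)
qed

lemma rel_crd_starting:
  assumes "i \<notin> J" "y (b i) \<in> carrier P"
  shows "keys (scale (inverse (eps (b i))) (strip (opp (b i)) (rep (y (b i))))) \<subseteq> starting i"
  using strip_starting[OF rep_keys[OF assms(2)], of "opp (b i)"] assms
  by (intro keys_scale_paths) (simp add: head_opp b_arc tail_b)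

lemma rel_crd_closed: "i \<notin> J \<Longrightarrow> y (b i) \<in> carrier P \<Longrightarrow> rel_crd i y \<in> carrier P"
  unfolding rel_crd_def using starting_paths[OF rel_crd_starting] by blast

text \<open>
  By \<open>no_overlap\<close> the arc \<open>opp (b i)\<close> is not the beginning of a leading monomial. So it can be prefixed to
  normal paths without any replacement, and nothing is lost by it.
\<close>

lemma leading_mult:
  assumes i: "i \<notin> J" and f: "keys f \<subseteq> starting i"
  shows "keys (path_mult f (scale c (arrow G (opp (b i))))) \<subseteq> all_normal"
    "strip (opp (b i)) (path_mult f (scale c (arrow G (opp (b i))))) = scale c f"
proof -
  have h: "head G (opp (b i)) = i" using i by (simp add: head_opp b_arc tail_b)
  have "keys (path_mult f (arrow G (opp (b i)))) \<subseteq> all_normal"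
  proof (rule mult_arrow_normal)
    show "strip (opp (b j)) f = 0" if "j \<notin> J" "opp (b i) = b j" for j
      using that i no_overlap[of j i] by simp
  qed (use f h i in \<open>simp_all add: opp_arc b_arc\<close>)
  then show "keys (path_mult f (scale c (arrow G (opp (b i))))) \<subseteq> all_normal"
    by (simp add: path_mult_scale keys_scale_paths)
  show "strip (opp (b i)) (path_mult f (scale c (arrow G (opp (b i))))) = scale c f"
    using f h by (simp add: path_mult_scale strip_linear strip_mult)
qed

text \<open>
  Subtract from a syzygy \<open>y\<close> the combination \<open>s\<close> of the columns \<open>rel_col i\<close> with the coordinates of \<open>y\<close> as
  coefficients. The remainder \<open>z\<close> has no path at \<open>b i\<close> that begins with \<open>opp (b i)\<close>, so all products of its
  entries with the arcs are normal. Their sum is zero in the quotient, hence zero, and each entry of \<open>z\<close>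
  can be recovered from it by stripping the arc.
\<close>

lemma rel_expansion:
  assumes y: "y \<in> carrier rel_module"
  shows "(\<Oplus>\<^bsub>col\<^esub>i\<in>-J. rel_crd i y \<odot>\<^bsub>col\<^esub> rel_col i) = y"
proof -
  interpret C: graded_left_module P col by (rule col_module)
  have yc: "y \<in> carrier col" and y0: "prj_col y = \<zero>\<^bsub>P\<^esub>" using y by (simp_all add: rel_module_simps)
  have ya: "y a \<in> carrier P" for a using yc by (rule col_apply)
  have crd: "rel_crd i y \<in> carrier P" if "i \<notin> J" for i using that ya by (rule rel_crd_closed)
  define s where "s = (\<Oplus>\<^bsub>col\<^esub>i\<in>-J. rel_crd i y \<odot>\<^bsub>col\<^esub> rel_col i)"
  have t: "(\<lambda>i. rel_crd i y \<odot>\<^bsub>col\<^esub> rel_col i) \<in> -J \<rightarrow> carrier col"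
    using crd rel_col_closed by (intro funcsetI C.smult_closed) auto
  have sc: "s \<in> carrier col" unfolding s_def using t by (rule C.M.finsum_closed)
  have "prj_col s = (\<Oplus>\<^bsub>P\<^esub>i\<in>-J. prj_col (rel_crd i y \<odot>\<^bsub>col\<^esub> rel_col i))"
    unfolding s_def
    by (rule additive_finsum[OF C.M.abelian_group_axioms P.abelian_group_axioms prj_col_closed prj_col_add t])
  also have "\<dots> = (\<Oplus>\<^bsub>P\<^esub>i\<in>-J. \<zero>\<^bsub>P\<^esub>)"
    using crd prj_col_smult[OF crd rel_col_closed]
    by (intro P.finsum_cong') (auto simp: prj_rel_col)
  finally have s0: "prj_col s = \<zero>\<^bsub>P\<^esub>" by simp
  define z where "z = y \<ominus>\<^bsub>col\<^esub> s"
  have zc: "z \<in> carrier col" unfolding z_def using yc sc by simp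
  have yz: "y = z \<oplus>\<^bsub>col\<^esub> s"
    unfolding z_def a_minus_def using yc sc C.M.l_neg[OF sc] by (simp only: C.M.a_assoc C.M.a_inv_closed C.M.r_zero)
  have z0: "prj_col z = \<zero>\<^bsub>P\<^esub>"
    using prj_col_add[OF zc sc] y0 s0 prj_col_closed[OF zc] yz by simp
  have za: "z a \<in> carrier P" for a using zc by (rule col_apply)
  have sa: "s a \<in> carrier P" for a using sc by (rule col_apply)
  have zfrom: "keys (rep (z a)) \<subseteq> starting (head G a)" if "a \<in> arcs G" for a
    using zc that by (metis col_iff)
  have free: "strip (opp (b i)) (rep (z (b i))) = 0" if i: "i \<notin> J" for i
  proof -
    let ?g = "scale (inverse (eps (b i))) (strip (opp (b i)) (rep (y (b i))))"
    have g: "keys ?g \<subseteq> starting i" using i ya by (rule rel_crd_starting)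
    have "s (b i) = (\<Oplus>\<^bsub>P\<^esub>j\<in>-J. (rel_crd j y \<odot>\<^bsub>col\<^esub> rel_col j) (b i))"
      unfolding s_def using t idem_hpart P.hpart_closed by (intro P.column_finsum) blast+
    also have "\<dots> = (\<Oplus>\<^bsub>P\<^esub>j\<in>-J. if i = j then rel_crd j y \<otimes>\<^bsub>P\<^esub> q (scale (eps (b i)) (arrow G (opp (b i)))) else \<zero>\<^bsub>P\<^esub>)"
      using i crd scaled_arrow_paths[OF b_arc[OF i]]
      by (intro P.finsum_cong') (auto simp: rel_col_def b_arc tail_b)
    also have "\<dots> = rel_crd i y \<otimes>\<^bsub>P\<^esub> q (scale (eps (b i)) (arrow G (opp (b i))))"
      using i crd scaled_arrow_paths[OF b_arc[OF i]] by (intro P.finsum_singleton) auto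
    also have "\<dots> = q (path_mult ?g (scale (eps (b i)) (arrow G (opp (b i)))))"
      unfolding rel_crd_def using starting_paths[OF g] scaled_arrow_paths[OF b_arc[OF i]] by (simp add: q_mult)
    finally have "rep (s (b i)) = path_mult ?g (scale (eps (b i)) (arrow G (opp (b i))))"
      using rep_q_normal[OF leading_mult(1)[OF i g]] by simp
    then have "strip (opp (b i)) (rep (s (b i))) = strip (opp (b i)) (rep (y (b i)))"
      using leading_mult(2)[OF i g, of "eps (b i)"] by (simp add: eps_nonzero)
    moreover have "rep (y (b i)) = rep (z (b i)) + rep (s (b i))"
      using rep_add[OF za sa] yz by simp
    ultimately show ?thesis by (simp add: strip_linear)
  qed
  let ?S = "\<Sum>a\<in>arcs G. path_mult (rep (z a)) (arrow G a)"
  have "keys ?S \<subseteq> all_normal"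
    using zfrom free by (intro keys_sum_subset mult_arrow_normal) auto
  moreover have "nf ?S = 0"
    using z0 prj_col_rep[OF zc] sum_arrow_paths[of "\<lambda>a. rep (z a)"] za
    by (simp add: q_zero q_eq rep_paths)
  ultimately have S: "?S = 0" by (simp add: nf_normal)
  have "rep (z c) = 0" if c: "c \<in> arcs G" for c
  proof -
    have "strip c ?S = (\<Sum>a\<in>arcs G. strip c (path_mult (rep (z a)) (arrow G a)))"
      by (simp add: strip_def lext_sum)
    also have "\<dots> = (\<Sum>a\<in>arcs G. if c = a then rep (z a) else 0)"
      using zfrom by (intro sum.cong) (auto simp: strip_mult)
    also have "\<dots> = rep (z c)" using c by simp
    finally show ?thesis using S by (simp add: strip_linear)
  qed
  then have "z c = \<zero>\<^bsub>P\<^esub>" if "c \<in> arcs G" for c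
    using that q_rep[OF za[of c]] by (simp add: q_zero)
  moreover have "z c = \<zero>\<^bsub>P\<^esub>" if "c \<notin> arcs G" for c
    using zc that by (simp add: column_carrier)
  ultimately have "z = \<zero>\<^bsub>col\<^esub>"
    unfolding column_module_simps by blast
  then have "y = s" using yz C.M.l_zero[OF sc] by simp
  then show ?thesis by (simp only: s_def)
qed

lemma rel_value:
  assumes y: "y \<in> carrier rel_module" and i: "i \<notin> J"
  shows "y (b i) = rel_crd i y \<otimes>\<^bsub>P\<^esub> q (scale (eps (b i)) (arrow G (opp (b i))))"
proof -
  have yc: "y \<in> carrier col" using y by (simp_all add: rel_module_simps)
  have ya: "y a \<in> carrier P" for a using yc by (rule col_apply)
  have crd: "rel_crd i y \<in> carrier P" if "i \<notin> J" for i using that ya by (rule rel_crd_closed)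
  interpret C: graded_left_module P col by (rule col_module)
  have t: "(\<lambda>i. rel_crd i y \<odot>\<^bsub>col\<^esub> rel_col i) \<in> -J \<rightarrow> carrier col"
    using crd rel_col_closed by (intro funcsetI C.smult_closed) auto
  have "y (b i) = (\<Oplus>\<^bsub>col\<^esub>j\<in>-J. rel_crd j y \<odot>\<^bsub>col\<^esub> rel_col j) (b i)"
    by (simp only: rel_expansion[OF y])
  also have "\<dots> = (\<Oplus>\<^bsub>P\<^esub>j\<in>-J. (rel_crd j y \<odot>\<^bsub>col\<^esub> rel_col j) (b i))"
    using t idem_hpart P.hpart_closed by (intro P.column_finsum) blast+
  also have "\<dots> = (\<Oplus>\<^bsub>P\<^esub>j\<in>-J. if i = j then rel_crd j y \<otimes>\<^bsub>P\<^esub> q (scale (eps (b i)) (arrow G (opp (b i)))) else \<zero>\<^bsub>P\<^esub>)"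
    using i crd scaled_arrow_paths[OF b_arc[OF i]]
    by (intro P.finsum_cong') (auto simp: rel_col_def b_arc tail_b)
  also have "\<dots> = rel_crd i y \<otimes>\<^bsub>P\<^esub> q (scale (eps (b i)) (arrow G (opp (b i))))"
    using i crd scaled_arrow_paths[OF b_arc[OF i]] by (intro P.finsum_singleton) auto
  finally show ?thesis .
qed

lemma idem_fixed: "keys f \<subseteq> starting w \<Longrightarrow> q f \<otimes>\<^bsub>P\<^esub> idem P w = q f"
  using starting_paths[of f w] nf_starting[of f w] by (simp add: idem_fixed_iff)

lemma rel_crd_idem: "i \<notin> J \<Longrightarrow> y (b i) \<in> carrier P \<Longrightarrow> rel_crd i y \<otimes>\<^bsub>P\<^esub> idem P i = rel_crd i y"
  unfolding rel_crd_def by (rule idem_fixed[OF rel_crd_starting])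

text \<open>
  The coordinate is determined by the entry at the leading arc, which makes it linear over the algebra.
\<close>

lemma rel_crd_unique:
  assumes i: "i \<notin> J" and Z: "Z \<in> carrier P" "Z \<otimes>\<^bsub>P\<^esub> idem P i = Z"
    and y: "y (b i) = Z \<otimes>\<^bsub>P\<^esub> q (scale (eps (b i)) (arrow G (opp (b i))))"
  shows "rel_crd i y = Z"
proof -
  have f: "keys (rep Z) \<subseteq> starting i" using Z idem_fixed_iff by blast
  have "y (b i) = q (path_mult (rep Z) (scale (eps (b i)) (arrow G (opp (b i)))))"
    using y Z scaled_arrow_paths[OF b_arc[OF i]] by (simp add: q_mult rep_paths)
  then have "rep (y (b i)) = path_mult (rep Z) (scale (eps (b i)) (arrow G (opp (b i))))"
    using rep_q_normal[OF leading_mult(1)[OF i f]] by simp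
  then show ?thesis
    using leading_mult(2)[OF i f] Z by (simp add: rel_crd_def eps_nonzero)
qed

lemma rel_finsum:
  assumes "f \<in> B \<rightarrow> carrier rel_module"
  shows "(\<Oplus>\<^bsub>rel_module\<^esub>j\<in>B. f j) = (\<Oplus>\<^bsub>col\<^esub>j\<in>B. f j)"
proof -
  interpret K: graded_left_module P rel_module by (rule rel_module)
  interpret C: graded_left_module P col by (rule col_module)
  show ?thesis
    using assms K.M.abelian_group_axioms C.M.abelian_group_axioms
    by (intro additive_finsum[of rel_module col "\<lambda>x. x"]) (auto simp: rel_module_simps)
qed

lemma rel_dual_basis: "dual_basis P rel_module (-J) (\<lambda>_. 2) rel_col rel_crd"
proof -
  interpret K: graded_left_module P rel_module by (rule rel_module)
  have ap: "y a \<in> carrier P" if "y \<in> carrier rel_module" for y a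
    using that col_apply[of y] by (simp add: rel_module_simps)
  have exp: "x = (\<Oplus>\<^bsub>rel_module\<^esub>j\<in>-J. rel_crd j x \<odot>\<^bsub>rel_module\<^esub> rel_col j)"
    if x: "x \<in> carrier rel_module" for x
  proof -
    have "(\<lambda>j. rel_crd j x \<odot>\<^bsub>rel_module\<^esub> rel_col j) \<in> -J \<rightarrow> carrier rel_module"
      using x ap rel_crd_closed K.mpart_closed[OF rel_col_mpart] by (intro funcsetI K.smult_closed) auto
    from rel_finsum[OF this] show ?thesis using rel_expansion[OF x] by (simp add: rel_module_simps)
  qed
  have add: "rel_crd j (x \<oplus>\<^bsub>rel_module\<^esub> y) = rel_crd j x \<oplus>\<^bsub>P\<^esub> rel_crd j y"
    if "j \<in> -J" "x \<in> carrier rel_module" "y \<in> carrier rel_module" for j x y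
    using that ap[OF that(2), of "b j"] ap[OF that(3), of "b j"]
      starting_paths[OF rel_crd_starting, of j x] starting_paths[OF rel_crd_starting, of j y]
    by (simp add: rel_crd_def rel_module_simps rep_add strip_linear scale_add q_add)
  have smult: "rel_crd j (a \<odot>\<^bsub>rel_module\<^esub> x) = a \<otimes>\<^bsub>P\<^esub> rel_crd j x"
    if j: "j \<in> -J" and a: "a \<in> carrier P" and x: "x \<in> carrier rel_module" for j a x
  proof (rule rel_crd_unique)
    show "j \<notin> J" using j by simp
    have c: "rel_crd j x \<in> carrier P" using j x ap rel_crd_closed by auto
    then show "a \<otimes>\<^bsub>P\<^esub> rel_crd j x \<in> carrier P" using a by simp
    have "idem P j \<in> carrier P" using idem_hpart P.hpart_closed by blast
    then show "a \<otimes>\<^bsub>P\<^esub> rel_crd j x \<otimes>\<^bsub>P\<^esub> idem P j = a \<otimes>\<^bsub>P\<^esub> rel_crd j x"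
      using a c j x ap rel_crd_idem[of j x] by (simp add: P.m_assoc)
    show "(a \<odot>\<^bsub>rel_module\<^esub> x) (b j)
        = a \<otimes>\<^bsub>P\<^esub> rel_crd j x \<otimes>\<^bsub>P\<^esub> q (scale (eps (b j)) (arrow G (opp (b j))))"
      using a c j rel_value[OF x, of j] scaled_arrow_paths[OF b_arc, of j]
      by (simp add: rel_module_simps P.m_assoc)
  qed
  have degree: "if 2 \<le> d then rel_crd j x \<in> hpart P (d - 2) else rel_crd j x = \<zero>\<^bsub>P\<^esub>"
    if j: "j \<in> -J" and x: "x \<in> mpart rel_module d" for j d x
  proof -
    have m: "case d of 0 \<Rightarrow> x (b j) = \<zero>\<^bsub>P\<^esub> | Suc k \<Rightarrow> x (b j) \<in> hpart P k"
      using x b_arc[of j] j by (auto simp: rel_module_simps column_mpart)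
    consider "d = 0" | "d = 1" | k where "d = Suc (Suc k)"
      by (metis One_nat_def not0_implies_Suc)
    then show ?thesis
    proof cases
      case 1
      then show ?thesis using m by (simp add: rel_crd_def strip_linear q_zero)
    next
      case 2
      then have "keys (rep (x (b j))) \<subseteq> long_paths 0" using m by (simp add: hpart_iff)
      then show ?thesis using 2 by (simp add: rel_crd_def strip_long_0 q_zero)
    next
      case 3
      then have "keys (rep (x (b j))) \<subseteq> long_paths (Suc k)" using m by (simp add: hpart_iff)
      then have "rel_crd j x \<in> hpart P k"
        unfolding rel_crd_def by (intro hpartI keys_scale_paths strip_long)
      then show ?thesis using 3 by simp
    qed
  qed
  show ?thesis
    unfolding dual_basis_def
  proof (intro conjI ballI allI)
    fix j x assume "j \<in> -J" "x \<in> carrier rel_module"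
    then show "rel_crd j x \<in> carrier P" using ap rel_crd_closed by auto
  next
    fix j assume "j \<in> -J" then show "rel_col j \<in> mpart rel_module 2" using rel_col_mpart by simp
  next
    fix j d x assume "j \<in> -J" "x \<in> mpart rel_module d"
    then show "if 2 \<le> d then rel_crd j x \<in> hpart P (d - 2) else rel_crd j x = \<zero>\<^bsub>P\<^esub>" by (rule degree)
  next
    fix x assume "x \<in> carrier rel_module"
    then show "x = (\<Oplus>\<^bsub>rel_module\<^esub>j\<in>-J. rel_crd j x \<odot>\<^bsub>rel_module\<^esub> rel_col j)" by (rule exp)
  qed (simp_all add: add smult)
qed

section \<open>Vanishing of Ext off the diagonal\<close>

lemma Ext_rel_module:
  assumes "d \<noteq> int n + 2"
  shows "Ext_component_zero P rel_module RM n d"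
proof -
  interpret pm: projective_module P rel_module RM "-J" "\<lambda>_. 2" rel_col rel_crd
    by (intro projective_module.intro projective_module_axioms.intro rel_module RM_module rel_dual_basis)
  show ?thesis
  proof (cases n)
    case 0
    show ?thesis unfolding 0
    proof (rule Ext_zero_degree[OF rel_module RM_module, where B = "-J" and bas = rel_col and e = 2])
      fix x assume x: "x \<in> carrier rel_module"
      show "\<exists>c. (\<forall>j\<in>-J. c j \<in> carrier P) \<and> x = (\<Oplus>\<^bsub>rel_module\<^esub>j\<in>-J. c j \<odot>\<^bsub>rel_module\<^esub> rel_col j)"
        using pm.basis_expansion[OF x] pm.crd_closed[OF _ x] by (intro exI[of _ "\<lambda>j. rel_crd j x"]) auto
    qed (use assms 0 rel_col_mpart RM_mpart in auto)
  next
    case (Suc k)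
    then show ?thesis using pm.Ext_projective by simp
  qed
qed

lemma Ext_pos_module:
  assumes "d \<noteq> int n + 1"
  shows "Ext_component_zero P pos_module RM n d"
proof (cases n)
  case 0
  interpret M: graded_left_module P pos_module by (rule pos_module)
  have arr: "q (arrow G a) \<in> carrier pos_module" if "a \<in> arcs G" for a
    using that arrow_closed[OF that] nf_positive[OF arrow_keys[OF that]] arrow_keys[OF that]
    by (simp add: pos_module_simps) (simp add: arrow_def positive_def)
  show ?thesis unfolding 0
  proof (rule Ext_zero_degree[OF pos_module RM_module, where B = "arcs G" and bas = "\<lambda>a. q (arrow G a)" and e = 1])
    fix a assume "a \<in> arcs G"
    then show "q (arrow G a) \<in> mpart pos_module 1"
      using arr arrow_hpart by (simp add: pos_module_simps)
  next
    fix X assume X: "X \<in> carrier pos_module"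
    have c: "sec_col X a \<in> carrier P" for a
      using X sec_col_closed col_apply by (simp add: pos_module_simps)
    have "(\<Oplus>\<^bsub>pos_module\<^esub>a\<in>arcs G. sec_col X a \<odot>\<^bsub>pos_module\<^esub> q (arrow G a))
      = (\<Oplus>\<^bsub>P\<^esub>a\<in>arcs G. sec_col X a \<odot>\<^bsub>pos_module\<^esub> q (arrow G a))"
      using c arr M.M.abelian_group_axioms P.abelian_group_axioms M.smult_closed
      by (intro additive_finsum[of pos_module P "\<lambda>x. x"]) (auto simp: pos_module_simps)
    also have "\<dots> = X"
      using prj_sec_col[OF X] by (simp add: prj_col_def pos_module_simps)
    finally show "\<exists>c. (\<forall>a\<in>arcs G. c a \<in> carrier P) \<and>
        X = (\<Oplus>\<^bsub>pos_module\<^esub>a\<in>arcs G. c a \<odot>\<^bsub>pos_module\<^esub> q (arrow G a))"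
      using c by (intro exI[of _ "sec_col X"]) auto
  qed (use assms 0 RM_mpart in auto)
next
  case (Suc k)
  have "Ext_component_zero P rel_module RM k d"
    using assms Suc by (intro Ext_rel_module) auto
  then show ?thesis
    using syzygy.Ext_shift[OF syzygy_pos] Suc by (simp add: rel_module_def)
qed

text \<open>
  The generators of the residue module, of the ideal of positive degree and of its syzygies have the
  degrees 0, 1 and 2, and the last of these modules is projective.
\<close>

theorem Ext_off_diagonal:
  assumes "d \<noteq> int n"
  shows "Ext_component_zero P RM RM n d"
proof (cases n)
  case 0
  interpret M: graded_left_module P RM by (rule RM_module)
  show ?thesis unfolding 0
  proof (rule Ext_zero_degree[OF RM_module RM_module, where B = "{()}" and bas = "\<lambda>_. r \<one>\<^bsub>P\<^esub>" and e = 0])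
    show "r \<one>\<^bsub>P\<^esub> \<in> mpart RM 0" using one_hpart by simp
  next
    fix Z assume "Z \<in> carrier RM"
    then obtain X where X: "X \<in> carrier P" "Z = r X" by (auto simp: carrier_R)
    then have "(\<Oplus>\<^bsub>RM\<^esub>j\<in>{()}. X \<odot>\<^bsub>RM\<^esub> r \<one>\<^bsub>P\<^esub>) = Z"
      using r_closed[of X] r_closed[of "\<one>\<^bsub>P\<^esub>"] by (simp add: r_mult[symmetric])
    then show "\<exists>c. (\<forall>j\<in>{()}. c j \<in> carrier P) \<and> Z = (\<Oplus>\<^bsub>RM\<^esub>j\<in>{()}. c j \<odot>\<^bsub>RM\<^esub> r \<one>\<^bsub>P\<^esub>)"
      using X by (intro exI[of _ "\<lambda>_. X"]) auto
  qed (use assms 0 RM_mpart in auto)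
next
  case (Suc k)
  have "Ext_component_zero P pos_module RM k d"
    using assms Suc by (intro Ext_pos_module) auto
  then show ?thesis
    using syzygy.Ext_shift[OF syzygy_residue] Suc by (simp add: pos_module_def)
qed

section \<open>The Hilbert series\<close>

lemma subfield_emb: "subfield (range (emb P)) P"
proof (rule P.subfield_iff(1))
  have ne: "\<one>\<^bsub>P\<^esub> \<noteq> \<zero>\<^bsub>P\<^esub>"
  proof
    assume "\<one>\<^bsub>P\<^esub> = \<zero>\<^bsub>P\<^esub>"
    then have "nf unit = (0 :: _ \<Rightarrow>\<^sub>0 'k)" using q_eq[OF keys_unit, of 0] by (simp add: q_one q_zero)
    moreover have "keys (unit :: _ \<Rightarrow>\<^sub>0 'k) \<subseteq> all_normal"
      unfolding unit_def by (intro keys_sum_subset) (auto simp: in_all_normal path_Nil)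
    ultimately have "(unit :: _ \<Rightarrow>\<^sub>0 'k) = 0" by (simp add: nf_normal)
    then have "path_mult unit (e undefined) = 0" by simp
    then show False by (simp add: unit_mult) (metis lookup_single_eq lookup_zero zero_neq_one)
  qed
  have mult: "emb P c \<otimes>\<^bsub>P\<^esub> emb P d = emb P (c * d)" for c d
    using emb_mult[OF keys_scale_unit, of c d] by (simp add: emb_P[of d] emb_P[of "c * d"])
  have add: "emb P c \<oplus>\<^bsub>P\<^esub> emb P d = emb P (c + d)" for c d
    by (simp add: emb_P q_add[symmetric] keys_scale_unit scale_add_left)
  have one: "emb P 1 = \<one>\<^bsub>P\<^esub>" and zero: "emb P 0 = \<zero>\<^bsub>P\<^esub>"
    by (simp_all add: emb_P q_one q_zero)
  show "range (emb P) \<subseteq> carrier P" by auto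
  let ?K = "P\<lparr>carrier := range (emb P)\<rparr>"
  have "cring ?K"
  proof (rule cringI)
    show "abelian_group ?K"
    proof (rule abelian_groupI)
      fix x assume "x \<in> carrier ?K"
      then obtain c where c: "x = emb P c" by auto
      show "\<exists>y\<in>carrier ?K. y \<oplus>\<^bsub>?K\<^esub> x = \<zero>\<^bsub>?K\<^esub>"
        by (intro bexI[of _ "emb P (- c)"]) (simp_all add: c add zero)
    next
      have "emb P 0 \<in> range (emb P)" by blast
      then show "\<zero>\<^bsub>?K\<^esub> \<in> carrier ?K" by (simp add: zero)
    next
      fix x y assume "x \<in> carrier ?K" "y \<in> carrier ?K"
      then show "x \<oplus>\<^bsub>?K\<^esub> y \<in> carrier ?K" "x \<oplus>\<^bsub>?K\<^esub> y = y \<oplus>\<^bsub>?K\<^esub> x"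
        by (auto simp: add add.commute)
    next
      fix x y z assume "x \<in> carrier ?K" "y \<in> carrier ?K" "z \<in> carrier ?K"
      then show "x \<oplus>\<^bsub>?K\<^esub> y \<oplus>\<^bsub>?K\<^esub> z = x \<oplus>\<^bsub>?K\<^esub> (y \<oplus>\<^bsub>?K\<^esub> z)"
        by (auto simp: add add.assoc)
    next
      fix x assume "x \<in> carrier ?K"
      then show "\<zero>\<^bsub>?K\<^esub> \<oplus>\<^bsub>?K\<^esub> x = x" by auto
    qed
    show "Group.comm_monoid ?K"
    proof (rule comm_monoidI)
      have "emb P 1 \<in> range (emb P)" by blast
      then show "\<one>\<^bsub>?K\<^esub> \<in> carrier ?K" by (simp add: one)
    next
      fix x y assume "x \<in> carrier ?K" "y \<in> carrier ?K"
      then show "x \<otimes>\<^bsub>?K\<^esub> y \<in> carrier ?K" "x \<otimes>\<^bsub>?K\<^esub> y = y \<otimes>\<^bsub>?K\<^esub> x"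
        by (auto simp: mult mult.commute)
    next
      fix x y z assume "x \<in> carrier ?K" "y \<in> carrier ?K" "z \<in> carrier ?K"
      then show "x \<otimes>\<^bsub>?K\<^esub> y \<otimes>\<^bsub>?K\<^esub> z = x \<otimes>\<^bsub>?K\<^esub> (y \<otimes>\<^bsub>?K\<^esub> z)"
        by (auto simp: mult mult.assoc)
    next
      fix x assume "x \<in> carrier ?K"
      then show "\<one>\<^bsub>?K\<^esub> \<otimes>\<^bsub>?K\<^esub> x = x" by auto
    qed
  next
    fix x y z assume "x \<in> carrier ?K" "y \<in> carrier ?K" "z \<in> carrier ?K"
    then show "(x \<oplus>\<^bsub>?K\<^esub> y) \<otimes>\<^bsub>?K\<^esub> z = x \<otimes>\<^bsub>?K\<^esub> z \<oplus>\<^bsub>?K\<^esub> y \<otimes>\<^bsub>?K\<^esub> z"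
      by (auto simp: mult add distrib_right)
  qed
  then show "field ?K"
  proof (rule cring.cring_fieldI2)
    fix a assume "a \<in> carrier ?K" "a \<noteq> \<zero>\<^bsub>?K\<^esub>"
    then obtain c where c: "a = emb P c" "c \<noteq> 0" using zero by auto
    then show "\<exists>b\<in>carrier ?K. a \<otimes>\<^bsub>?K\<^esub> b = \<one>\<^bsub>?K\<^esub>"
      using mult[of c "inverse c"] one by (intro bexI[of _ "emb P (inverse c)"]) auto
  qed (use ne in simp)
qed

text \<open>
  Normal paths are linearly independent in the quotient because \<open>nf\<close> fixes their combinations.
\<close>

lemma dimension_normal:
  assumes "distinct ps" "set ps \<subseteq> all_normal"
  shows "ring.dimension P (length ps) (range (emb P)) (q ` {f. keys f \<subseteq> set ps})"
  using assms
proof (induction ps)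
  case Nil
  have "{f :: _ \<Rightarrow>\<^sub>0 'k. keys f \<subseteq> set []} = {0}" by auto
  then show ?case using P.zero_dim by (simp add: q_zero)
next
  case (Cons p ps)
  let ?v = "q (single p 1)" and ?E = "q ` {f :: _ \<Rightarrow>\<^sub>0 'k. keys f \<subseteq> set ps}"
  have p: "keys (single p (1::'k)) \<subseteq> all_normal" "keys (single p (1::'k)) \<subseteq> paths G"
    using Cons.prems all_normal_paths by auto
  have ps: "keys f \<subseteq> all_normal" "keys f \<subseteq> paths G" if "keys f \<subseteq> set ps" for f :: "_ \<Rightarrow>\<^sub>0 'k"
    using that Cons.prems all_normal_paths by auto
  have "?v \<notin> ?E"
  proof
    assume "?v \<in> ?E"
    then obtain f :: "_ \<Rightarrow>\<^sub>0 'k" where f: "q (single p 1) = q f" "keys f \<subseteq> set ps" by auto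
    then have "single p 1 = f"
      using p ps[OF f(2)] by (metis rep_q_normal)
    then show False using f(2) Cons.prems by auto
  qed
  moreover have "q ` {f. keys f \<subseteq> set (p # ps)} = P.line_extension (range (emb P)) ?v ?E"
  proof
    show "q ` {f. keys f \<subseteq> set (p # ps)} \<subseteq> P.line_extension (range (emb P)) ?v ?E"
    proof
      fix u assume "u \<in> q ` {f. keys f \<subseteq> set (p # ps)}"
      then obtain f where f: "u = q f" "keys f \<subseteq> insert p (set ps)" by auto
      let ?g = "f - single p (lookup f p)"
      have g: "keys ?g \<subseteq> set ps"
        using f(2) by (auto simp: in_keys_iff lookup_minus lookup_single when_def split: if_splits)
      have "u = q (scale (lookup f p) (single p 1) + ?g)" using f by simp
      also have "\<dots> = emb P (lookup f p) \<otimes>\<^bsub>P\<^esub> ?v \<oplus>\<^bsub>P\<^esub> q ?g"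
        by (simp only: q_add[OF keys_scale_paths[OF p(2)] ps(2)[OF g]] emb_mult[OF p(2)])
      finally show "u \<in> P.line_extension (range (emb P)) ?v ?E"
        unfolding P.line_extension_mem_iff using g by blast
    qed
    show "P.line_extension (range (emb P)) ?v ?E \<subseteq> q ` {f. keys f \<subseteq> set (p # ps)}"
    proof
      fix u assume "u \<in> P.line_extension (range (emb P)) ?v ?E"
      then obtain c f where f: "u = emb P c \<otimes>\<^bsub>P\<^esub> ?v \<oplus>\<^bsub>P\<^esub> q f" "keys f \<subseteq> set ps"
        unfolding P.line_extension_mem_iff by auto
      have "u = q (single p c + f)"
        using p ps(2)[OF f(2)] by (simp add: f(1) emb_mult q_add)
      moreover have "keys (single p c + f) \<subseteq> set (p # ps)"
        using f(2) keys_add[of "single p c" f] by (auto split: if_splits)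
      ultimately show "u \<in> q ` {f. keys f \<subseteq> set (p # ps)}" by blast
    qed
  qed
  ultimately show ?case
    using P.Suc_dim[OF q_closed[OF p(2)]] Cons by simp
qed

lemma finite_normal_paths: "finite (normal_paths u v d)"
proof (rule finite_subset)
  show "normal_paths u v d \<subseteq> (\<lambda>p. (u, p, v)) ` {p. set p \<subseteq> arcs G \<and> length p = d}"
    by (auto simp: normal_paths_def paths_def)
  show "finite ((\<lambda>p. (u, p, v)) ` {p. set p \<subseteq> arcs G \<and> length p = d})"
    by (intro finite_imageI finite_lists_length_eq finite_arcs)
qed

lemma idem_mult: "path_mult (e w) f = lext (\<lambda>(u, p, v). if v = w then single (u, p, v) 1 else 0) f"
proof (induction f rule: poly_mapping_induct[OF subset_UNIV])
  case (2 x c)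
  then show ?case by (cases x rule: prod_cases3) (auto simp: path_mult_single)
qed (auto simp: path_mult_add_right lext_add)

lemma idempotent_corner:
  "{idem P i \<otimes>\<^bsub>P\<^esub> X \<otimes>\<^bsub>P\<^esub> idem P j | X. X \<in> hpart P d} = q ` {f. keys f \<subseteq> normal_paths j i d}"
proof -
  have ep: "keys (e w) \<subseteq> paths G" for w by (simp add: path_Nil)
  have eq: "idem P i \<otimes>\<^bsub>P\<^esub> q f \<otimes>\<^bsub>P\<^esub> idem P j = q (path_mult (path_mult (e i) f) (e j))"
    if "keys f \<subseteq> paths G" for f
    using that ep path_mult_keys[OF ep that] by (simp add: idem_P q_mult)
  show ?thesis
  proof
    show "{idem P i \<otimes>\<^bsub>P\<^esub> X \<otimes>\<^bsub>P\<^esub> idem P j | X. X \<in> hpart P d} \<subseteq> q ` {f. keys f \<subseteq> normal_paths j i d}"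
    proof
      fix Y assume "Y \<in> {idem P i \<otimes>\<^bsub>P\<^esub> X \<otimes>\<^bsub>P\<^esub> idem P j | X. X \<in> hpart P d}"
      then obtain X where X: "X \<in> carrier P" "keys (rep X) \<subseteq> long_paths d"
        "Y = idem P i \<otimes>\<^bsub>P\<^esub> X \<otimes>\<^bsub>P\<^esub> idem P j" by (auto simp: hpart_iff)
      have "keys (path_mult (e i) (rep X)) \<subseteq> {(u, p, v) \<in> keys (rep X). v = i}"
        unfolding idem_mult by (rule lext_mono) (auto split: if_splits)
      moreover have "keys (path_mult (path_mult (e i) (rep X)) (e j))
          \<subseteq> {(u, p, v) \<in> keys (path_mult (e i) (rep X)). u = j}"
        unfolding mult_idem by (rule lext_mono) (auto split: if_splits)
      ultimately have "keys (path_mult (path_mult (e i) (rep X)) (e j)) \<subseteq> normal_paths j i d"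
        using rep_keys[OF X(1)] X(2) by (fastforce simp: normal_paths_def all_normal_def long_paths_def)
      moreover have "Y = q (path_mult (path_mult (e i) (rep X)) (e j))"
        using eq[OF rep_paths[OF X(1)]] X by simp
      ultimately show "Y \<in> q ` {f. keys f \<subseteq> normal_paths j i d}" by blast
    qed
    show "q ` {f. keys f \<subseteq> normal_paths j i d} \<subseteq> {idem P i \<otimes>\<^bsub>P\<^esub> X \<otimes>\<^bsub>P\<^esub> idem P j | X. X \<in> hpart P d}"
    proof
      fix Y assume "Y \<in> q ` {f. keys f \<subseteq> normal_paths j i d}"
      then obtain f where f: "Y = q f" "keys f \<subseteq> normal_paths j i d" by auto
      have fp: "keys f \<subseteq> long_paths d"
        using f(2) by (auto simp: normal_paths_def long_paths_def)
      have "path_mult (e i) f = f"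
        unfolding idem_mult using f(2) by (intro lext_id) (auto simp: normal_paths_def)
      moreover have "path_mult f (e j) = f"
        unfolding mult_idem using f(2) by (intro lext_id) (auto simp: normal_paths_def)
      ultimately have "Y = idem P i \<otimes>\<^bsub>P\<^esub> q f \<otimes>\<^bsub>P\<^esub> idem P j"
        using eq[OF long_paths_subset[OF fp]] f(1) by simp
      then show "Y \<in> {idem P i \<otimes>\<^bsub>P\<^esub> X \<otimes>\<^bsub>P\<^esub> idem P j | X. X \<in> hpart P d}"
        using hpartI[OF fp] by blast
    qed
  qed
qed

lemma hilbert_series_P: "hilbert_series P = (\<chi> i j. Abs_fps (\<lambda>d. int (card (normal_paths j i d))))"
proof -
  have "ring.dim P (range (emb P)) {idem P i \<otimes>\<^bsub>P\<^esub> X \<otimes>\<^bsub>P\<^esub> idem P j | X. X \<in> hpart P d}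
      = card (normal_paths j i d)" for i j d
  proof -
    obtain ps where ps: "set ps = normal_paths j i d" "distinct ps"
      using finite_distinct_list[OF finite_normal_paths] by blast
    have "P.dimension (length ps) (range (emb P)) (q ` {f. keys f \<subseteq> set ps})"
      using ps normal_paths_all by (intro dimension_normal) auto
    then have "P.dim (range (emb P)) (q ` {f. keys f \<subseteq> normal_paths j i d}) = length ps"
      using P.dimI[OF subfield_emb] ps by (simp add: over_def)
    also have "length ps = card (normal_paths j i d)"
      using ps distinct_card by metis
    finally show ?thesis unfolding idempotent_corner .
  qed
  then show ?thesis unfolding hilbert_series_def by simp
qed

lemma card_normal_paths_0: "card (normal_paths j i 0) = (if i = j then 1 else 0)"
proof -
  have "normal_paths j i 0 = (if i = j then {(j, [], i)} else {})"
    by (auto simp: normal_paths_def path_Nil_iff)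
  then show ?thesis by simp
qed

definition extensions :: "'v \<Rightarrow> 'v \<Rightarrow> nat \<Rightarrow> ('e \<times> 'e list) set" where
  "extensions j i d = {(a, p). a \<in> arcs G \<and> head G a = i \<and> (j, p, tail G a) \<in> normal_paths j (tail G a) d}"

lemma card_extensions:
  "card (extensions j i d) =
    (\<Sum>k\<in>UNIV. card {a \<in> arcs G. head G a = i \<and> tail G a = k} * card (normal_paths j k d))"
proof -
  define words where "words k = {p. (j, p, k) \<in> normal_paths j k d}" for k
  have np: "normal_paths j k d = (\<lambda>p. (j, p, k)) ` words k" for k
    by (auto simp: words_def normal_paths_def)
  have words: "finite (words k)" "card (words k) = card (normal_paths j k d)" for k
  proof -
    have inj: "inj_on (\<lambda>p. (j, p, k)) (words k)" by (simp add: inj_on_def)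
    show "finite (words k)"
      using finite_normal_paths[of j k d] unfolding np by (rule finite_imageD[OF _ inj])
    show "card (words k) = card (normal_paths j k d)"
      unfolding np by (rule card_image[OF inj, symmetric])
  qed
  have "extensions j i d = (\<Union>k\<in>UNIV. {a \<in> arcs G. head G a = i \<and> tail G a = k} \<times> words k)"
    by (auto simp: extensions_def words_def)
  also have "card \<dots> = (\<Sum>k\<in>UNIV. card ({a \<in> arcs G. head G a = i \<and> tail G a = k} \<times> words k))"
    by (intro card_UN_disjoint) (auto simp: words(1))
  finally show ?thesis by (simp add: card_cartesian_product words(2))
qed

lemma finite_extensions: "finite (extensions j i d)"
proof (rule finite_subset)
  show "extensions j i d \<subseteq> arcs G \<times> {p. set p \<subseteq> arcs G \<and> length p = d}"
    by (auto simp: extensions_def normal_paths_def paths_def)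
  show "finite (arcs G \<times> {p. set p \<subseteq> arcs G \<and> length p = d})"
    by (intro finite_SigmaI finite_lists_length_eq finite_arcs)
qed

lemma card_good_extensions:
  "card {(a, p) \<in> extensions j i d. normal (p @ [a])} = card (normal_paths j i (Suc d))"
proof -
  have "normal_paths j i (Suc d) = (\<lambda>(a, p). (j, p @ [a], i)) ` {(a, p) \<in> extensions j i d. normal (p @ [a])}"
  proof (intro equalityI subsetI)
    fix x assume "x \<in> normal_paths j i (Suc d)"
    then obtain p where p: "x = (j, p, i)" "(j, p, i) \<in> paths G" "normal p" "length p = Suc d"
      by (auto simp: normal_paths_def)
    then obtain p' a where "p = p' @ [a]" "length p' = d" using length_append_last by blast
    then show "x \<in> (\<lambda>(a, p). (j, p @ [a], i)) ` {(a, p) \<in> extensions j i d. normal (p @ [a])}"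
      using p by (intro image_eqI[of _ _ "(a, p')"])
        (auto simp: extensions_def in_normal_paths path_snoc_iff normal_snoc)
  qed (auto simp: extensions_def in_normal_paths path_snoc_iff)
  then show ?thesis by (auto simp: card_image inj_on_def)
qed

text \<open>
  A prolongation to a path that is not normal ends with the leading monomial at \<open>i\<close>. What precedes it is
  an arbitrary normal path to \<open>i\<close>, since by \<open>no_overlap\<close> appending a leading arc keeps paths normal.
\<close>

lemma card_bad_extensions:
  "card {(a, p) \<in> extensions j i (Suc d). \<not> normal (p @ [a])}
    = (if i \<in> J then 0 else card (normal_paths j i d))"
proof (cases "i \<in> J")
  case True
  have "{(a, p) \<in> extensions j i (Suc d). \<not> normal (p @ [a])} = {}"
  proof -
    have False if "(a, p) \<in> extensions j i (Suc d)" "\<not> normal (p @ [a])" for a p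
    proof -
      have "forbidden (last p) a" using that by (auto simp: extensions_def in_normal_paths normal_snoc)
      then obtain l where "l \<notin> J" "a = opp (b l)" by (auto simp: forbidden_def)
      moreover have "head G a = i" using that by (simp add: extensions_def)
      ultimately show False using True by (simp add: head_opp b_arc tail_b)
    qed
    then show ?thesis by blast
  qed
  then show ?thesis using True by (simp only: card.empty if_True)
next
  case False
  have "{(a, p) \<in> extensions j i (Suc d). \<not> normal (p @ [a])}
      = (\<lambda>(u, p, v). (opp (b i), p @ [b i])) ` normal_paths j i d"
  proof (intro equalityI subsetI)
    fix x assume "x \<in> {(a, p) \<in> extensions j i (Suc d). \<not> normal (p @ [a])}"
    then obtain a p where x: "x = (a, p)" and ap: "(a, p) \<in> extensions j i (Suc d)" "\<not> normal (p @ [a])"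
      by auto
    then have p: "(j, p, tail G a) \<in> paths G" "normal p" "length p = Suc d" "head G a = i"
      by (auto simp: extensions_def in_normal_paths)
    then obtain p' c where p': "p = p' @ [c]" "length p' = d" using length_append_last by blast
    have "forbidden c a" using ap(2) p(2) p'(1) normal_snoc[of p a] by simp
    then obtain l where l: "l \<notin> J" "c = b l" "a = opp (b l)" by (auto simp: forbidden_def)
    then have "l = i" using p by (simp add: head_opp b_arc tail_b)
    then show "x \<in> (\<lambda>(u, p, v). (opp (b i), p @ [b i])) ` normal_paths j i d"
      using x l p p' by (intro image_eqI[of _ _ "(j, p', i)"])
        (auto simp: in_normal_paths path_snoc_iff normal_snoc tail_b)
  next
    fix x assume "x \<in> (\<lambda>(u, p, v). (opp (b i), p @ [b i])) ` normal_paths j i d"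
    then obtain p where p: "x = (opp (b i), p @ [b i])" "(j, p, i) \<in> paths G" "normal p" "length p = d"
      by (auto simp: normal_paths_def)
    then show "x \<in> {(a, p) \<in> extensions j i (Suc d). \<not> normal (p @ [a])}"
      using False not_forbidden_b[of i]
      by (auto simp: extensions_def in_normal_paths path_snoc_iff normal_snoc opp_arc b_arc tail_b
          head_opp tail_opp forbidden_def)
  qed
  moreover have "inj_on (\<lambda>(u, p, v). (opp (b i), p @ [b i])) (normal_paths j i d)"
    by (auto simp: inj_on_def normal_paths_def)
  ultimately show ?thesis using False by (simp add: card_image)
qed

lemma card_extensions_split:
  "card (extensions j i d) = card {(a, p) \<in> extensions j i d. normal (p @ [a])}
    + card {(a, p) \<in> extensions j i d. \<not> normal (p @ [a])}"
proof -
  have "extensions j i d = {(a, p) \<in> extensions j i d. normal (p @ [a])}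
      \<union> {(a, p) \<in> extensions j i d. \<not> normal (p @ [a])}" by auto
  moreover have "card ({(a, p) \<in> extensions j i d. normal (p @ [a])}
      \<union> {(a, p) \<in> extensions j i d. \<not> normal (p @ [a])})
    = card {(a, p) \<in> extensions j i d. normal (p @ [a])} + card {(a, p) \<in> extensions j i d. \<not> normal (p @ [a])}"
    using finite_extensions[of j i d]
    by (intro card_Un_disjoint) (auto intro: finite_subset[rotated])
  ultimately show ?thesis by simp
qed

lemma card_normal_paths_1:
  "card (normal_paths j i 1) =
    (\<Sum>k\<in>UNIV. card {a \<in> arcs G. head G a = i \<and> tail G a = k} * card (normal_paths j k 0))"
proof -
  have bad: "{(a, p) \<in> extensions j i 0. \<not> normal (p @ [a])} = {}"
    by (auto simp: extensions_def in_normal_paths normal_snoc)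
  show ?thesis
    using card_extensions[of j i 0] card_extensions_split[of j i 0, unfolded bad card.empty]
      card_good_extensions[of j i 0] by simp
qed

lemma card_normal_paths_rec:
  "card (normal_paths j i (Suc (Suc d))) + (if i \<in> J then 0 else card (normal_paths j i d)) =
    (\<Sum>k\<in>UNIV. card {a \<in> arcs G. head G a = i \<and> tail G a = k} * card (normal_paths j k (Suc d)))"
  using card_extensions[of j i "Suc d"] card_extensions_split[of j i "Suc d"]
    card_good_extensions[of j i "Suc d"] card_bad_extensions[of j i d] by simp

end

section \<open>Inverting the matrix\<close>

definition quadratic_matrix :: "int ^ 'v ^ 'v \<Rightarrow> int ^ 'v ^ 'v \<Rightarrow> int fps ^ 'v ^ 'v::finite" where
  "quadratic_matrix C D = mat 1 - map_matrix (\<lambda>c. fps_const c * fps_X) C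
    + map_matrix (\<lambda>c. fps_const c * fps_X ^ 2) D"

lemma quadratic_matrix_entry:
  "fps_nth (quadratic_matrix C D $ i $ k * h) n =
    (if i = k then fps_nth h n else 0) - (if n = 0 then 0 else C $ i $ k * fps_nth h (n - 1))
      + (if n < 2 then 0 else D $ i $ k * fps_nth h (n - 2))"
  "fps_nth (h * quadratic_matrix C D $ i $ k) n =
    (if i = k then fps_nth h n else 0) - (if n = 0 then 0 else fps_nth h (n - 1) * C $ i $ k)
      + (if n < 2 then 0 else fps_nth h (n - 2) * D $ i $ k)"
proof -
  show 1: "fps_nth (quadratic_matrix C D $ i $ k * h) n =
    (if i = k then fps_nth h n else 0) - (if n = 0 then 0 else C $ i $ k * fps_nth h (n - 1))
      + (if n < 2 then 0 else D $ i $ k * fps_nth h (n - 2))" for h :: "int fps"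
  proof -
    have "quadratic_matrix C D $ i $ k * h = (if i = k then h else 0)
        - fps_const (C $ i $ k) * (fps_X * h) + fps_const (D $ i $ k) * (fps_X ^ 2 * h)"
      by (simp add: quadratic_matrix_def mat_def ring_distribs mult.assoc)
    then show ?thesis by (simp add: fps_X_power_mult_nth)
  qed
  show "fps_nth (h * quadratic_matrix C D $ i $ k) n =
    (if i = k then fps_nth h n else 0) - (if n = 0 then 0 else fps_nth h (n - 1) * C $ i $ k)
      + (if n < 2 then 0 else fps_nth h (n - 2) * D $ i $ k)"
    using 1[of h] by (simp add: mult.commute)
qed

lemma sum_delta_combination:
  fixes x y z :: "'v::finite \<Rightarrow> 'r::comm_ring_1"
  shows "(\<Sum>k\<in>UNIV. (if i = k then x k else 0) - y k + z k) = x i - sum y UNIV + sum z UNIV"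
    "(\<Sum>k\<in>UNIV. (if k = i then x k else 0) - y k + z k) = x i - sum y UNIV + sum z UNIV"
  by (simp_all only: sum.distrib sum_subtractf sum.delta sum.delta' finite UNIV_I if_True)

lemma right_inverse_quadratic_matrix:
  assumes 0: "\<And>i j. fps_nth (H $ i $ j) 0 = (if i = j then 1 else 0)"
    and 1: "\<And>i j. fps_nth (H $ i $ j) 1 = (\<Sum>k\<in>UNIV. C $ i $ k * fps_nth (H $ k $ j) 0)"
    and rec: "\<And>i j n. fps_nth (H $ i $ j) (Suc (Suc n))
      = (\<Sum>k\<in>UNIV. C $ i $ k * fps_nth (H $ k $ j) (Suc n)) - (\<Sum>k\<in>UNIV. D $ i $ k * fps_nth (H $ k $ j) n)"
  shows "quadratic_matrix C D ** H = mat 1"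
proof -
  have "fps_nth ((quadratic_matrix C D ** H) $ i $ j) n = fps_nth ((mat 1 :: int fps ^ _ ^ _) $ i $ j) n" for i j n
  proof -
    have eq: "fps_nth ((quadratic_matrix C D ** H) $ i $ j) n
      = fps_nth (H $ i $ j) n - (\<Sum>k\<in>UNIV. if n = 0 then 0 else C $ i $ k * fps_nth (H $ k $ j) (n - 1))
        + (\<Sum>k\<in>UNIV. if n < 2 then 0 else D $ i $ k * fps_nth (H $ k $ j) (n - 2))"
      by (simp only: matrix_matrix_mult_def vec_lambda_beta fps_sum_nth quadratic_matrix_entry
          sum_delta_combination)
    consider "n = 0" | "n = 1" | m where "n = Suc (Suc m)" by (metis One_nat_def not0_implies_Suc)
    then show ?thesis
      unfolding eq by cases (simp_all add: mat_def 0 1[unfolded One_nat_def] rec)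
  qed
  then show ?thesis by (simp add: vec_eq_iff fps_eq_iff)
qed

text \<open>
  The entries lie in a ring that is not a field, so a right inverse is not obviously a left inverse. A left
  inverse is built coefficient by coefficient; it then agrees with the right inverse.
\<close>

fun left_coeffs :: "int ^ 'v ^ 'v \<Rightarrow> int ^ 'v ^ 'v \<Rightarrow> nat \<Rightarrow> int ^ 'v ^ 'v::finite" where
  "left_coeffs C D 0 = mat 1"
| "left_coeffs C D (Suc 0) = C"
| "left_coeffs C D (Suc (Suc n)) = left_coeffs C D (Suc n) ** C - left_coeffs C D n ** D"

lemma left_inverse_quadratic_matrix: "\<exists>L. L ** quadratic_matrix C D = mat 1"
proof -
  define L where "L = (\<chi> i j. Abs_fps (\<lambda>n. left_coeffs C D n $ i $ j))"
  have "fps_nth ((L ** quadratic_matrix C D) $ i $ j) n = fps_nth ((mat 1 :: int fps ^ _ ^ _) $ i $ j) n" for i j n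
  proof -
    have eq: "fps_nth ((L ** quadratic_matrix C D) $ i $ j) n
      = fps_nth (L $ i $ j) n - (\<Sum>k\<in>UNIV. if n = 0 then 0 else fps_nth (L $ i $ k) (n - 1) * C $ k $ j)
        + (\<Sum>k\<in>UNIV. if n < 2 then 0 else fps_nth (L $ i $ k) (n - 2) * D $ k $ j)"
      by (simp only: matrix_matrix_mult_def vec_lambda_beta fps_sum_nth quadratic_matrix_entry
          sum_delta_combination)
    have Lc: "fps_nth (L $ i $ k) n = left_coeffs C D n $ i $ k" for k n by (simp add: L_def)
    consider "n = 0" | "n = 1" | m where "n = Suc (Suc m)" by (metis One_nat_def not0_implies_Suc)
    then show ?thesis
      unfolding eq by cases (simp_all add: Lc mat_def matrix_matrix_mult_def mult_delta_left if_distribR cong: if_cong)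
  qed
  then show ?thesis by (intro exI[of _ L]) (simp add: vec_eq_iff fps_eq_iff)
qed

lemma quadratic_matrix_inverse:
  assumes "quadratic_matrix C D ** H = mat 1"
  shows "invertible (quadratic_matrix C D)" "H = matrix_inv (quadratic_matrix C D)"
proof -
  let ?M = "quadratic_matrix C D"
  obtain L where L: "L ** ?M = mat 1" using left_inverse_quadratic_matrix by blast
  have "L = L ** (?M ** H)" by (simp add: assms)
  also have "\<dots> = H" by (simp add: matrix_mul_assoc L)
  finally have HM: "H ** ?M = mat 1" using L by simp
  show "invertible ?M" unfolding invertible_def using assms HM by blast
  have "\<exists>A'. ?M ** A' = mat 1 \<and> A' ** ?M = mat 1" using assms HM by blast
  then have "matrix_inv ?M ** ?M = mat 1"
    unfolding matrix_inv_def by (rule someI2_ex) simp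
  then have "matrix_inv ?M ** (?M ** H) = H" by (simp add: matrix_mul_assoc)
  then show "H = matrix_inv ?M" by (simp add: assms)
qed

section \<open>Renaming the arcs\<close>

text \<open>
  A quadratic algebra is a quotient of the path algebra of a quiver whose arcs are natural numbers, so
  the arcs of the double have to be renamed.
\<close>

definition relabel :: "('e \<Rightarrow> 'f) \<Rightarrow> (('v, 'e) path \<Rightarrow>\<^sub>0 'k::field) \<Rightarrow> (('v, 'f) path \<Rightarrow>\<^sub>0 'k)" where
  "relabel g = lext (\<lambda>(u, p, v). single (u, map g p, v) 1)"

lemma relabel_single [simp]: "relabel g (single (u, p, v) c) = single (u, map g p, v) c"
  by (simp add: relabel_def)

lemma relabel_linear: "relabel g 0 = 0" "relabel g (x + y) = relabel g x + relabel g y"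
  "relabel g (scale c x) = scale c (relabel g x)" "relabel g (sum h S) = (\<Sum>s\<in>S. relabel g (h s))"
  by (simp_all add: relabel_def lext_add lext_scale lext_sum)

lemma relabel_mult: "relabel g (path_mult x y) = path_mult (relabel g x) (relabel g y)"
proof (induction x rule: poly_mapping_induct[OF subset_UNIV])
  case (2 p c)
  obtain u p' v where p: "p = (u, p', v)" by (cases p rule: prod_cases3)
  show ?case
  proof (induction y rule: poly_mapping_induct[OF subset_UNIV])
    case (2 q d)
    obtain u' q' v' where "q = (u', q', v')" by (cases q rule: prod_cases3)
    then show ?case using p by (simp add: path_mult_single relabel_linear)
  qed (simp_all add: path_mult_add_right relabel_linear)
qed (simp_all add: path_mult_add_left relabel_linear)

lemma relabel_inverse:
  assumes "\<And>u p v a. (u, p, v) \<in> keys x \<Longrightarrow> a \<in> set p \<Longrightarrow> h (g a) = a"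
  shows "relabel h (relabel g x) = x"
proof -
  have "relabel h (relabel g x) = lext (\<lambda>(u, p, v). single (u, map (h \<circ> g) p, v) 1) x"
    unfolding relabel_def[of h] relabel_def[of g] lext_lext by (intro lext_cong) auto
  also have "\<dots> = x"
  proof (rule lext_id)
    fix y assume y: "y \<in> keys x"
    obtain u p v where p: "y = (u, p, v)" by (cases y rule: prod_cases3)
    have "map (h \<circ> g) p = p" using assms y p by (intro map_idI) auto
    then show "(case y of (u, p, v) \<Rightarrow> single (u, map (h \<circ> g) p, v) 1) = single y 1"
      by (simp add: p)
  qed
  finally show ?thesis .
qed

locale quiver_relabelling = G: finite_quiver G + H: finite_quiver H
  for G :: "('v::finite, 'e) pre_digraph" and H :: "('v, 'f) pre_digraph" +
  fixes g :: "'e \<Rightarrow> 'f"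
  assumes g_arc: "a \<in> arcs G \<Longrightarrow> g a \<in> arcs H"
    and tail_g: "a \<in> arcs G \<Longrightarrow> tail H (g a) = tail G a"
    and head_g: "a \<in> arcs G \<Longrightarrow> head H (g a) = head G a"
begin

lemma map_path: "(u, p, v) \<in> paths G \<Longrightarrow> (u, map g p, v) \<in> paths H"
  by (induction p arbitrary: u)
    (auto simp: G.path_Nil_iff H.path_Nil_iff G.path_Cons_iff H.path_Cons_iff g_arc tail_g head_g)

lemma relabel_paths: "keys x \<subseteq> paths G \<Longrightarrow> keys (relabel g x) \<subseteq> paths H"
  unfolding relabel_def by (rule lext_mono) (auto simp: map_path)

lemma relabel_length:
  "keys x \<subseteq> {(u, p, v) \<in> paths G. length p = d} \<Longrightarrow>
    keys (relabel g x) \<subseteq> {(u, p, v) \<in> paths H. length p = d}"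
  unfolding relabel_def by (rule lext_mono) (auto simp: map_path)

lemma relabel_unit: "relabel g G.unit = H.unit"
  by (simp add: G.unit_def H.unit_def relabel_linear)

lemma relabel_hom: "relabel g \<in> ring_hom (path_algebra G) (path_algebra H)"
  by (rule ring_hom_memI)
    (simp_all add: relabel_paths relabel_mult relabel_linear relabel_unit)

end

lemma (in ring) ideal_preimage:
  assumes S: "ring S" and h: "h \<in> ring_hom R S" and I: "ideal I S"
  shows "ideal {x \<in> carrier R. h x \<in> I} R"
proof -
  interpret ring_hom_ring R S h
    using ring_hom_ringI2[OF ring_axioms S h] .
  show ?thesis using ideal_vimage[OF I] .
qed

context involutive_quiver
begin

text \<open>
  The kernel of the composite of the renaming with the quotient map is generated by the renamed relation,
  because renaming back and forth carries each of the two ideals into the other.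
\<close>

theorem quadratic_P: "quadratic_algebra P"
proof -
  obtain f :: "'e \<Rightarrow> nat" and n where f: "f ` arcs G = {i. i < n}" "inj_on f (arcs G)"
    using finite_imp_inj_to_nat_seg[OF finite_arcs] by blast
  define g where "g = inv_into (arcs G) f"
  have gf: "g (f a) = a" if "a \<in> arcs G" for a
    using f(2) that by (simp add: g_def)
  have fg: "f (g i) = i" "g i \<in> arcs G" if "i \<in> f ` arcs G" for i
    using that by (auto simp: g_def f_inv_into_f inv_into_into)
  define H where "H = \<lparr> verts = (UNIV :: 'v set), arcs = f ` arcs G, tail = tail G \<circ> g, head = head G \<circ> g \<rparr>"
  have H: "fin_digraph H"
    by unfold_locales (auto simp: H_def)
  interpret H: finite_quiver H
    using H by (intro finite_quiver.intro finite_quiver_axioms.intro) (auto simp: H_def)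
  interpret GH: quiver_relabelling G H f
    by unfold_locales (auto simp: H_def gf)
  interpret HG: quiver_relabelling H G g
    by unfold_locales (auto simp: H_def gf)
  let ?B = "path_algebra H :: (_, 'k, 'v) graded_algebra"
  have gf': "relabel g (relabel f x) = x" if "keys x \<subseteq> paths G" for x :: "_ \<Rightarrow>\<^sub>0 'k"
    using that by (intro relabel_inverse gf) (auto simp: paths_def)
  have arcs_H: "a \<in> f ` arcs G" if "(u, p, v) \<in> paths H" "a \<in> set p" for u p v a
    using that by (auto simp: paths_def pre_digraph.awalk_def H_def)
  have fg': "relabel f (relabel g x) = x" if "keys x \<subseteq> paths H" for x :: "_ \<Rightarrow>\<^sub>0 'k"
    using that arcs_H by (intro relabel_inverse fg) blast
  define \<phi> where "\<phi> = q \<circ> relabel g"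
  have hom: "\<phi> \<in> ring_hom ?B P"
    unfolding \<phi>_def using HG.relabel_hom q_hom by (rule ring_hom_trans)
  define S where "S = {relabel f relation}"
  have "\<phi> ` carrier ?B = carrier P"
  proof
    show "\<phi> ` carrier ?B \<subseteq> carrier P" using ring_hom_closed[OF hom] by blast
    show "carrier P \<subseteq> \<phi> ` carrier ?B"
    proof
      fix X assume "X \<in> carrier P"
      then obtain x where x: "X = q x" "keys x \<subseteq> paths G" by (auto simp: carrier_P)
      then have "X = \<phi> (relabel f x)" by (simp add: \<phi>_def gf')
      moreover have "relabel f x \<in> carrier ?B" using x GH.relabel_paths by simp
      ultimately show "X \<in> \<phi> ` carrier ?B" by blast
    qed
  qed
  moreover have "\<phi> (emb ?B c) = emb P c" for c
    by (simp add: \<phi>_def relabel_linear HG.relabel_unit emb_P)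
  moreover have "\<phi> (idem ?B v) = idem P v" for v
    by (simp add: \<phi>_def idem_P)
  moreover have "\<phi> ` hpart ?B d = hpart P d" for d
  proof
    show "\<phi> ` hpart ?B d \<subseteq> hpart P d"
    proof
      fix X assume "X \<in> \<phi> ` hpart ?B d"
      then obtain x where x: "X = q (relabel g x)" "keys x \<subseteq> {(u, p, v) \<in> paths H. length p = d}"
        by (auto simp: \<phi>_def)
      show "X \<in> hpart P d"
        unfolding x(1) using HG.relabel_length[OF x(2)] by (intro hpartI) (simp add: long_paths_def)
    qed
    show "hpart P d \<subseteq> \<phi> ` hpart ?B d"
    proof
      fix X assume "X \<in> hpart P d"
      then obtain x where x: "X = q x" "keys x \<subseteq> long_paths d" by (auto simp: hpart_P)
      then have "X = \<phi> (relabel f x)" by (simp add: \<phi>_def gf' long_paths_subset)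
      moreover have "relabel f x \<in> hpart ?B d"
        using x(2) GH.relabel_length[of x d] by (simp add: long_paths_def)
      ultimately show "X \<in> \<phi> ` hpart ?B d" by blast
    qed
  qed
  moreover have Shp: "S \<subseteq> hpart ?B 2"
    unfolding S_def using GH.relabel_length[OF relation_keys] by simp
  moreover have "a_kernel ?B P \<phi> = Idl\<^bsub>?B\<^esub> S"
  proof -
    interpret B: ring ?B by (rule H.ring_PA)
    interpret A: ring A by (rule ring_PA)
    have Sc: "S \<subseteq> carrier ?B" using Shp by auto
    have ker: "a_kernel ?B P \<phi> = {x \<in> carrier ?B. relabel g x \<in> rel_ideal}"
    proof -
      have "\<phi> x = \<zero>\<^bsub>P\<^esub> \<longleftrightarrow> relabel g x \<in> rel_ideal" if "x \<in> carrier ?B" for x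
        using that HG.relabel_paths[of x] rel_ideal_iff[of "relabel g x"]
        by (simp add: \<phi>_def q_zero q_eq)
      then show ?thesis by (auto simp: a_kernel_def')
    qed
    have "Idl\<^bsub>?B\<^esub> S \<subseteq> {x \<in> carrier ?B. relabel g x \<in> rel_ideal}"
    proof (rule B.genideal_minimal)
      show "ideal {x \<in> carrier ?B. relabel g x \<in> rel_ideal} ?B"
        by (rule B.ideal_preimage[OF ring_PA HG.relabel_hom ideal_rel_ideal])
      show "S \<subseteq> {x \<in> carrier ?B. relabel g x \<in> rel_ideal}"
        using Sc relation_in_ideal relation_carrier by (auto simp: S_def gf')
    qed
    moreover have "rel_ideal \<subseteq> {y \<in> carrier A. relabel f y \<in> Idl\<^bsub>?B\<^esub> S}"
      unfolding rel_ideal_def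
    proof (rule A.genideal_minimal)
      show "ideal {y \<in> carrier A. relabel f y \<in> Idl\<^bsub>?B\<^esub> S} A"
        by (rule A.ideal_preimage[OF H.ring_PA GH.relabel_hom B.genideal_ideal[OF Sc]])
      show "{relation} \<subseteq> {y \<in> carrier A. relabel f y \<in> Idl\<^bsub>?B\<^esub> S}"
        using B.genideal_self[OF Sc] relation_carrier by (auto simp: S_def)
    qed
    then have "{x \<in> carrier ?B. relabel g x \<in> rel_ideal} \<subseteq> Idl\<^bsub>?B\<^esub> S"
      using fg' by fastforce
    ultimately show ?thesis unfolding ker by blast
  qed
  ultimately show ?thesis
    unfolding quadratic_algebra_def using hom H
    by (intro exI[of _ H] exI[of _ S] exI[of _ \<phi>]) (simp add: H_def del: H.PA_simps PA_simps)
qed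

theorem koszul_P: "koszul_algebra P"
  unfolding koszul_algebra_def using quadratic_P Ext_off_diagonal by blast

theorem hilbert_P:
  assumes "M = quadratic_matrix (adjacency_matrix G) (black_matrix J)"
  shows "invertible M \<and> hilbert_series P = matrix_inv M"
proof -
  have "quadratic_matrix (adjacency_matrix G) (black_matrix J) ** hilbert_series P = mat 1"
  proof (rule right_inverse_quadratic_matrix)
    fix i j
    show "fps_nth (hilbert_series P $ i $ j) 0 = (if i = j then 1 else 0)"
      by (simp add: hilbert_series_P card_normal_paths_0)
    show "fps_nth (hilbert_series P $ i $ j) 1
        = (\<Sum>k\<in>UNIV. adjacency_matrix G $ i $ k * fps_nth (hilbert_series P $ k $ j) 0)"
      by (simp add: hilbert_series_P card_normal_paths_1[unfolded One_nat_def] adjacency_matrix_def)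
    fix n
    have "(\<Sum>k\<in>UNIV. black_matrix J $ i $ k * fps_nth (hilbert_series P $ k $ j) n)
        = (\<Sum>k\<in>UNIV. if i = k then (if i \<in> J then 0 else int (card (normal_paths j i n))) else 0)"
      by (intro sum.cong) (auto simp: black_matrix_def hilbert_series_P)
    also have "\<dots> = int (if i \<in> J then 0 else card (normal_paths j i n))" by simp
    finally have D: "(\<Sum>k\<in>UNIV. black_matrix J $ i $ k * fps_nth (hilbert_series P $ k $ j) n)
        = int (if i \<in> J then 0 else card (normal_paths j i n))" .
    have "int (card (normal_paths j i (Suc (Suc n)))) + int (if i \<in> J then 0 else card (normal_paths j i n))
      = (\<Sum>k\<in>UNIV. adjacency_matrix G $ i $ k * fps_nth (hilbert_series P $ k $ j) (Suc n))"
      unfolding of_nat_add[symmetric] card_normal_paths_rec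
      by (simp add: hilbert_series_P adjacency_matrix_def)
    then show "fps_nth (hilbert_series P $ i $ j) (Suc (Suc n))
        = (\<Sum>k\<in>UNIV. adjacency_matrix G $ i $ k * fps_nth (hilbert_series P $ k $ j) (Suc n))
          - (\<Sum>k\<in>UNIV. black_matrix J $ i $ k * fps_nth (hilbert_series P $ k $ j) n)"
      unfolding D by (simp add: hilbert_series_P)
  qed
  from quadratic_matrix_inverse[OF this] show ?thesis using assms by simp
qed

end

section \<open>Partial preprojective algebras\<close>

fun opposite :: "'e double_arc \<Rightarrow> 'e double_arc" where
  "opposite (Arc a) = Star a"
| "opposite (Star a) = Arc a"

text \<open>
  In the relation the path \<open>a a\<^sup>*\<close> is travelled from \<open>a\<^sup>*\<close>, so the sign plus belongs to \<open>Star\<close>.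
\<close>

fun arc_sign :: "'e double_arc \<Rightarrow> 'k::field" where
  "arc_sign (Arc a) = - 1"
| "arc_sign (Star a) = 1"

lemma double_quiver_simps [simp]:
  "verts (double_quiver Q) = verts Q" "arcs (double_quiver Q) = Arc ` arcs Q \<union> Star ` arcs Q"
  "tail (double_quiver Q) = double_tail Q" "head (double_quiver Q) = double_head Q"
  by (simp_all add: double_quiver_def)

lemma double_arc_steps:
  assumes "Digraph_Component.connected Q" "u \<in> verts Q" "v \<in> verts Q"
  shows "(u, v) \<in> {(double_tail Q c, double_head Q c) | c. c \<in> arcs (double_quiver Q)}\<^sup>*"
proof -
  have "(u, v) \<in> rtrancl_on (verts (with_proj (mk_symmetric Q))) (arcs_ends (with_proj (mk_symmetric Q)))"
    using assms by (auto simp: Digraph_Component.connected_def strongly_connected_def reachable_def)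
  then show ?thesis
  proof (induction rule: rtrancl_on_induct)
    case (step y z)
    then have "(y, z) \<in> parcs (mk_symmetric Q)" by simp
    then obtain a where "a \<in> arcs Q" "(y, z) = (tail Q a, head Q a) \<or> (y, z) = (head Q a, tail Q a)"
      by (auto simp: parcs_mk_symmetric)
    then have "\<exists>c. c \<in> arcs (double_quiver Q) \<and> y = double_tail Q c \<and> z = double_head Q c"
      by (auto intro: exI[of _ "Arc a"] exI[of _ "Star a"])
    then have "(y, z) \<in> {(double_tail Q c, double_head Q c) | c. c \<in> arcs (double_quiver Q)}" by blast
    then show ?case using step.IH by (rule rtrancl_into_rtrancl[rotated])
  qed simp
qed

text \<open>
  The rank is the distance to \<open>J\<close> in the double, and \<open>b i\<close> is the first arc of a shortest path from \<open>i\<close> to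
  \<open>J\<close>.
\<close>

lemma arcs_towards:
  assumes Q: "Digraph_Component.connected Q" "verts Q = UNIV" and J: "J \<noteq> {}"
  obtains b :: "'v \<Rightarrow> 'e double_arc" and rank :: "'v \<Rightarrow> nat"
  where "\<And>i. i \<notin> J \<Longrightarrow> b i \<in> arcs (double_quiver Q)" "\<And>i. i \<notin> J \<Longrightarrow> double_tail Q (b i) = i"
    "\<And>i. i \<notin> J \<Longrightarrow> rank (double_head Q (b i)) < rank i"
proof -
  define E where "E = {(double_tail Q c, double_head Q c) | c. c \<in> arcs (double_quiver Q)}"
  define rank where "rank v = (LEAST n. \<exists>u\<in>J. (v, u) \<in> E ^^ n)" for v
  have ex: "\<exists>n. \<exists>u\<in>J. (v, u) \<in> E ^^ n" for v
  proof -
    obtain u where u: "u \<in> J" using J by blast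
    have "(v, u) \<in> E\<^sup>*" unfolding E_def by (rule double_arc_steps[OF Q(1)]) (simp_all add: Q(2))
    then show ?thesis using u rtrancl_imp_relpow by blast
  qed
  have "\<exists>c. c \<in> arcs (double_quiver Q) \<and> double_tail Q c = i \<and> rank (double_head Q c) < rank i"
    if i: "i \<notin> J" for i
  proof -
    obtain u where u: "u \<in> J" "(i, u) \<in> E ^^ rank i"
      using LeastI_ex[OF ex[of i]] unfolding rank_def by blast
    have "rank i \<noteq> 0" using u i by (cases "rank i = 0") auto
    then obtain n where n: "rank i = Suc n" by (cases "rank i") auto
    then obtain w where w: "(i, w) \<in> E" "(w, u) \<in> E ^^ n" using u relpow_Suc_D2 by metis
    then obtain c where c: "c \<in> arcs (double_quiver Q)" "i = double_tail Q c" "w = double_head Q c"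
      by (auto simp: E_def simp del: double_quiver_simps)
    have "rank w \<le> n" unfolding rank_def using u w by (intro Least_le) blast
    then show ?thesis using c n by (intro exI[of _ c]) auto
  qed
  then obtain b where "\<And>i. i \<notin> J \<Longrightarrow> b i \<in> arcs (double_quiver Q) \<and> double_tail Q (b i) = i
      \<and> rank (double_head Q (b i)) < rank i"
    by metis
  then show ?thesis using that[of b rank] by blast
qed

theorem theorem3p4p1:
  fixes Q :: "('v::finite, 'e) pre_digraph" and J :: "'v set"
    and P :: "((('v, 'e double_arc) path \<Rightarrow>\<^sub>0 'k::field) set, 'k, 'v) graded_algebra"
    and M :: "int fps ^ 'v ^ 'v"
  assumes "fin_digraph Q" and "verts Q = UNIV" and "Digraph_Component.connected Q"
    and "J \<subseteq> verts Q" and "J \<noteq> {}"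
    and "P = partial_preprojective Q J"
    and "M = mat 1
      - map_matrix (\<lambda>c. fps_const c * fps_X) (adjacency_matrix (double_quiver Q))
      + map_matrix (\<lambda>c. fps_const c * fps_X ^ 2) (black_matrix J)"
  shows "invertible M \<and> hilbert_series P = matrix_inv M \<and> koszul_algebra P"
proof -
  interpret Q: fin_digraph Q by fact
  obtain b :: "'v \<Rightarrow> 'e double_arc" and rank :: "'v \<Rightarrow> nat"
    where b: "\<And>i. i \<notin> J \<Longrightarrow> b i \<in> arcs (double_quiver Q)" "\<And>i. i \<notin> J \<Longrightarrow> double_tail Q (b i) = i"
      "\<And>i. i \<notin> J \<Longrightarrow> rank (double_head Q (b i)) < rank i"
    using arcs_towards[OF assms(3,2,5)] by blast
  have tail_opp: "double_tail Q (opposite c) = double_head Q c"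
    and head_opp: "double_head Q (opposite c) = double_tail Q c"
    and opp_opp: "opposite (opposite c) = c" and sign: "(arc_sign c :: 'k) \<noteq> 0" for c
    by (cases c; simp)+
  have opp_arc: "opposite c \<in> arcs (double_quiver Q)" if "c \<in> arcs (double_quiver Q)" for c
    using that by auto
  \<comment> \<open>Otherwise the ranks of \<open>i\<close> and \<open>j\<close> would each be smaller than the other.\<close>
  have no_overlap: "b i \<noteq> opposite (b j)" if "i \<notin> J" "j \<notin> J" for i j
  proof
    assume "b i = opposite (b j)"
    then have "i = double_head Q (b j)" "double_head Q (b i) = j"
      using b(2) that tail_opp head_opp by metis+
    then show False using b(3)[OF that(1)] b(3)[OF that(2)] by simp
  qed
  interpret involutive_quiver "double_quiver Q" opposite "arc_sign :: _ \<Rightarrow> 'k" J b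
  proof unfold_locales
    show "finite (arcs (double_quiver Q))" "finite (verts (double_quiver Q))" by auto
    show "verts (double_quiver Q) = UNIV" using assms(2) by simp
  qed (use b opp_arc no_overlap sign tail_opp head_opp opp_opp assms(2) in auto)
  have "relation = (partial_preprojective_relation Q J :: _ \<Rightarrow>\<^sub>0 'k)"
  proof -
    have split: "{c \<in> arcs (double_quiver Q). tail (double_quiver Q) c \<notin> J}
        = Star ` {a \<in> arcs Q. head Q a \<notin> J} \<union> Arc ` {a \<in> arcs Q. tail Q a \<notin> J}" by auto
    show ?thesis
      unfolding relation_def split partial_preprojective_relation_def Let_def
      by (subst sum.union_disjoint)
        (auto simp: sum.reindex inj_on_def arrow_def path_mult_single assms(2) single_uminus sum_negf
          intro!: sum.cong)
  qed
  then have "P = graded_quotient A rel_ideal"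
    by (simp add: assms(6) partial_preprojective_def rel_ideal_def Let_def)
  then show ?thesis
    using hilbert_P[OF assms(7)[folded quadratic_matrix_def]] koszul_P by simp
qed

end
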